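(* Let $n:[-1,1]\to(0,+\infty)$ with $\frac{n'}{n^2}\in L^\infty$, and let $f_-:(0,+\infty)\to[0,+\infty)$ and $f_+:(-\infty,0)\to[0,+\infty)$ belong to $L^\infty$. Assume: (i) $n'\le 0$; (ii) $\lambda:=\sup_{x\ge0}\int_{\sqrt x}^{+\infty}\frac{u f_-(u)}{\sqrt{u^2-x}}\,du<+\infty$; (iii) $f_-(u)=0$ for $0<u<2\sqrt{\frac{2\mu}{n(1)}}$, where $\mu:=\int_{-\infty}^0f_+(u)\,du+\lambda$; (iv) $\int_0^{+\infty}f_-(u)\,du<\int_{-\infty}^0f_+(u)\,du$ and $\int_{-\infty}^0\frac{f_+(u)}{u^2}\,du<\frac{n(1)}4$. Let $$K=\left\{\alpha\in W^{1,\infty}([-1,1]):\ \alpha\ge0,\ \alpha(1)-\alpha(-1)\le\frac{2\mu}{n(1)},\ 0\le\alpha'\le4\mu\left\|\frac{n'}{n^2}\right\|_\infty\right\}.$$ Then there is a unique solution $f\in L^\infty([-1,1]\times\mathbb{R})$ to $$v\frac{\partial f}{\partial z}-\left(\frac{\rho}{n}\right)'\frac{\partial f}{\partial v}=0,\qquad z\in[-1,1],\ v\in\mathbb{R},$$ $$f(-1,v)=f_-(v),\ v>0,\qquad f(1,v)=f_+(v),\ v<0,$$ where $\rho(z)=\int_{\mathbb{R}}f(z,v)\,dv$, such that $\frac{\rho}{n}\in K$.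
   Context: A prime denotes the derivative with respect to $z\in[-1,1]$. The unknown is $f=f(z,v)$; the density $\rho$ is determined by $f$ through $\rho(z)=\int_{\mathbb{R}} f(z,v)\,dv$, so the equation is nonlinear. The function $n$ is the given equilibrium density and $f_\pm$ are the given incoming boundary data. *)

theory Defs
  imports "HOL-Analysis.Analysis" "HOL-Probability.Essential_Supremum"
begin

text \<open>
  Elements of \<open>L\<^sup>\<infinity>(A)\<close> are represented by Borel functions on \<open>A\<close>, i.e. by functions that are
  measurable on \<^term>\<open>restrict_space lborel A\<close>; their values outside \<open>A\<close> never matter. Equality
  in \<open>L\<^sup>\<infinity>\<close> is equality almost everywhere.
\<close>

definition Linf :: "'a measure \<Rightarrow> ('a \<Rightarrow> real) \<Rightarrow> bool" where
  "Linf M g \<longleftrightarrow> g \<in> borel_measurable M \<and> esssup M (\<lambda>x. ereal \<bar>g x\<bar>) < \<infinity>"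

definition Linf_norm :: "'a measure \<Rightarrow> ('a \<Rightarrow> real) \<Rightarrow> real" where
  "Linf_norm M g = real_of_ereal (esssup M (\<lambda>x. ereal \<bar>g x\<bar>))"

abbreviation slab :: "real measure" where
  "slab \<equiv> restrict_space lborel {-1..1}"

abbreviation phase_space :: "(real \<times> real) measure" where
  "phase_space \<equiv> restrict_space lborel ({-1..1} \<times> UNIV)"

text \<open>\<open>g\<close> is the weak derivative of \<open>u\<close> on the open set \<open>S\<close>; test functions are \<open>C\<^sup>1\<close> with compact
  support in \<open>S\<close>.\<close>

definition locally_integrable_on :: "real set \<Rightarrow> (real \<Rightarrow> real) \<Rightarrow> bool" where
  "locally_integrable_on S u \<longleftrightarrow>
     (\<forall>K. compact K \<and> K \<subseteq> S \<longrightarrow> set_integrable lborel K u)"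

definition C1_test :: "real set \<Rightarrow> (real \<Rightarrow> real) \<Rightarrow> bool" where
  "C1_test S \<phi> \<longleftrightarrow> \<phi> C1_differentiable_on UNIV \<and>
     (\<exists>K. compact K \<and> K \<subseteq> S \<and> (\<forall>x. x \<notin> K \<longrightarrow> \<phi> x = 0))"

definition weak_deriv :: "real set \<Rightarrow> (real \<Rightarrow> real) \<Rightarrow> (real \<Rightarrow> real) \<Rightarrow> bool" where
  "weak_deriv S u g \<longleftrightarrow> locally_integrable_on S u \<and> locally_integrable_on S g \<and>
     (\<forall>\<phi>. C1_test S \<phi> \<longrightarrow>
        (LINT x:S|lborel. u x * deriv \<phi> x) = - (LINT x:S|lborel. g x * \<phi> x))"

definition rho :: "(real \<times> real \<Rightarrow> real) \<Rightarrow> real \<Rightarrow> real" where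
  "rho f z = (LINT v|lborel. f (z, v))"

text \<open>\<open>C\<^sup>1\<close> test functions with compact support in \<open>[-1,1] \<times> \<real>\<close> (restrictions of compactly supported
  \<open>C\<^sup>1\<close> functions on the plane), with partial derivatives \<open>\<phi>z\<close>, \<open>\<phi>v\<close>, that vanish on the
  outgoing part of the boundary, where no data are prescribed.\<close>

definition kinetic_test ::
  "(real \<times> real \<Rightarrow> real) \<Rightarrow> (real \<times> real \<Rightarrow> real) \<Rightarrow> (real \<times> real \<Rightarrow> real) \<Rightarrow> bool" where
  "kinetic_test \<phi> \<phi>z \<phi>v \<longleftrightarrow>
     (\<forall>p. (\<phi> has_derivative (\<lambda>(h, k). h * \<phi>z p + k * \<phi>v p)) (at p)) \<and>
     continuous_on UNIV \<phi>z \<and> continuous_on UNIV \<phi>v \<and> bounded {p. \<phi> p \<noteq> 0} \<and>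
     (\<forall>v>0. \<phi> (1, v) = 0) \<and> (\<forall>v<0. \<phi> (-1, v) = 0)"

text \<open>Weak formulation of
    \<open>v \<partial>\<^sub>z f - E(z) \<partial>\<^sub>v f = 0\<close>, \<open>f(-1,v) = fm(v)\<close> for \<open>v > 0\<close>, \<open>f(1,v) = fp(v)\<close> for \<open>v < 0\<close>:
  multiply by \<open>\<phi>\<close> and integrate by parts over \<open>[-1,1] \<times> \<real>\<close>. As \<open>E\<close> does not depend on \<open>v\<close>, the
  operator is in divergence form, and only the incoming boundary values contribute.\<close>

definition weak_transport_solution ::
  "(real \<Rightarrow> real) \<Rightarrow> (real \<Rightarrow> real) \<Rightarrow> (real \<Rightarrow> real) \<Rightarrow> (real \<times> real \<Rightarrow> real) \<Rightarrow> bool" where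
  "weak_transport_solution E fm fp f \<longleftrightarrow>
     (\<forall>\<phi> \<phi>z \<phi>v. kinetic_test \<phi> \<phi>z \<phi>v \<longrightarrow>
        (LINT p:({-1..1} \<times> UNIV)|lborel. f p * (snd p * \<phi>z p - E (fst p) * \<phi>v p)) =
        (LINT v:{..<0}|lborel. v * fp v * \<phi> (1, v)) -
        (LINT v:{0<..}|lborel. v * fm v * \<phi> (-1, v)))"

text \<open>The nonlinear problem. \<open>rho\<close> has to exist as a genuine integral (the Bochner integral of a
  non-integrable function is \<open>0\<close> by convention).\<close>

definition kinetic_solution ::
  "(real \<Rightarrow> real) \<Rightarrow> (real \<Rightarrow> real) \<Rightarrow> (real \<Rightarrow> real) \<Rightarrow> (real \<times> real \<Rightarrow> real) \<Rightarrow> bool" where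
  "kinetic_solution n fm fp f \<longleftrightarrow>
     Linf phase_space f \<and>
     (AE z in slab. integrable lborel (\<lambda>v. f (z, v))) \<and>
     (\<exists>E. Linf slab E \<and> weak_deriv {-1<..<1} (\<lambda>z. rho f z / n z) E \<and>
          weak_transport_solution E fm fp f)"

definition lambda_const :: "(real \<Rightarrow> real) \<Rightarrow> ennreal" where
  "lambda_const fm =
     (SUP x\<in>{0..}. \<integral>\<^sup>+u\<in>{sqrt x<..}. ennreal (u * fm u / sqrt (u\<^sup>2 - x)) \<partial>lborel)"

definition mu_const :: "(real \<Rightarrow> real) \<Rightarrow> (real \<Rightarrow> real) \<Rightarrow> real" where
  "mu_const fm fp = enn2real ((\<integral>\<^sup>+u\<in>{..<0}. ennreal (fp u) \<partial>lborel) + lambda_const fm)"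

text \<open>The set \<open>K\<close>, each element of \<open>W\<^sup>1\<^sup>,\<^sup>\<infinity>([-1,1])\<close> being given by its continuous representative;
  \<open>n'\<close> is the weak derivative of \<open>n\<close>.\<close>

definition K_set :: "(real \<Rightarrow> real) \<Rightarrow> (real \<Rightarrow> real) \<Rightarrow> real \<Rightarrow> (real \<Rightarrow> real) set" where
  "K_set n n' \<mu> = {\<alpha>. continuous_on {-1..1} \<alpha> \<and> Linf slab \<alpha> \<and>
     (\<forall>z\<in>{-1..1}. 0 \<le> \<alpha> z) \<and>
     \<alpha> 1 - \<alpha> (-1) \<le> 2 * \<mu> / n 1 \<and>
     (\<exists>\<alpha>'. Linf slab \<alpha>' \<and> weak_deriv {-1<..<1} \<alpha> \<alpha>' \<and>
        (AE z in slab. 0 \<le> \<alpha>' z \<and> \<alpha>' z \<le> 4 * \<mu> * Linf_norm slab (\<lambda>z. n' z / (n z)\<^sup>2)))}"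

definition AE_represents :: "(real \<Rightarrow> real) set \<Rightarrow> (real \<Rightarrow> real) \<Rightarrow> bool" where
  "AE_represents K a \<longleftrightarrow> (\<exists>\<alpha>\<in>K. AE z in slab. a z = \<alpha> z)"

end

theory Submission
  imports Defs
begin

text \<open>
  Writing \<open>\<alpha> = \<rho>/n\<close>, the energy \<open>v\<^sup>2/2 + \<alpha>(z)\<close> is constant along characteristics and \<open>\<alpha>\<close> increases.
  The particles entering at \<open>z = -1\<close> are, by (iii), fast enough to cross the slab, and those entering
  at \<open>z = 1\<close> are accelerated towards \<open>z = -1\<close>; hence for a given \<open>\<alpha>\<close> the linear problem has the explicit
  solution \<open>flow_density \<alpha>\<close>, the sum of two beams, and no other one. Its density depends on \<open>z\<close> only through \<open>\<alpha>(z)\<close>,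
  \<open>\<alpha>(-1)\<close>, \<open>\<alpha>(1)\<close>, so the nonlinear problem becomes the scalar equation
  \<open>n(z) \<alpha>(z) = A(\<alpha>(z) - \<alpha>(-1)) + B(\<alpha>(z) - \<alpha>(1))\<close>, where the increasing functions \<open>A\<close>, \<open>B\<close> are the fluxes
  of the two beams. By (ii)--(iv) their slopes are at most \<open>n(1)/4\<close>: this determines first
  \<open>\<alpha>(1) - \<alpha>(-1)\<close>, then the end values, then every \<open>\<alpha>(z)\<close>, and gives monotonicity and the Lipschitz bound.
\<close>

section \<open>Bounded primitives\<close>

text \<open>Conservation of energy replaces the flow: in the coordinates (z, energy), on each of the
  halves v > 0 and v < 0, the transport operator is v times differentiation in z. Existence for
  given \<alpha> rests on this change of variables, uniqueness on test functions of z, the energy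
  and a smoothed sign of v; the delicate points are those where v changes sign.

  The slope n(1)/4 explains the constants in the hypotheses. Put D = 2\<mu>/n(1), the bound on
  \<alpha>(1) - \<alpha>(-1) in \<open>K_set\<close>. By (iii) the left beam has u^2 \<ge> 4D, hence
  u^2 - 2y \<ge> 2D for y \<le> D, and the slope of A is at most \<lambda>/(2D) \<le> n(1)/4; the
  slope of B is at most the integral of f_+/u^2. Together they are at most n(1)/2, half of the least
  value of n, so n(z)s minus both fluxes is strictly increasing in s. The same margin gives one
  factor 2 of the 4 in \<open>K_set\<close>; the ratio n(x)/n(y) \<le> 2 over short distances gives
  the other.\<close>

lemma continuous_imp_antiderivative:
  fixes f :: "real \<Rightarrow> real"
  assumes "continuous_on UNIV f"
  shows "\<exists>G. \<forall>x. (G has_real_derivative f x) (at x)"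
proof -
  have "\<exists>G. \<forall>x::real. -\<infinity> < ereal x \<longrightarrow> ereal x < \<infinity> \<longrightarrow> (G has_vector_derivative f x) (at x)"
    by (rule einterval_antiderivative) (use assms in \<open>auto simp: continuous_on_eq_continuous_at\<close>)
  then show ?thesis by (auto simp: has_real_derivative_iff_has_vector_derivative)
qed

lemma continuous_on_interval_bounded:
  fixes f :: "real \<Rightarrow> real"
  assumes "continuous_on {a..b} f"
  obtains K where "\<And>x. x \<in> {a..b} \<Longrightarrow> \<bar>f x\<bar> \<le> K"
  using compact_imp_bounded[OF compact_continuous_image[OF assms compact_Icc]]
  unfolding bounded_iff by (metis imageI real_norm_def)

lemma mono_slope_imp_continuous_on:
  fixes F :: "real \<Rightarrow> real"
  assumes C: "0 \<le> C"
    and F: "\<And>x y. x \<in> S \<Longrightarrow> y \<in> S \<Longrightarrow> x \<le> y \<Longrightarrow> F x \<le> F y \<and> F y - F x \<le> C * (y - x)"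
  shows "continuous_on S F"
proof (rule lipschitz_on_continuous_on, rule lipschitz_onI[OF _ C])
  fix x y assume "x \<in> S" "y \<in> S"
  then show "dist (F x) (F y) \<le> C * dist x y"
    using F[of x y] F[of y x] by (cases "x \<le> y") (auto simp: dist_real_def)
qed

text \<open>A measurable function is a limit of continuous functions off a negligible set;
  truncation at -M and M preserves both continuity and the limit, and the resulting uniform bound is
  what dominated convergence asks for later.\<close>

lemma continuous_approx_AE:
  fixes E :: "real \<Rightarrow> real"
  assumes E: "E \<in> borel_measurable borel" and M: "\<And>x. \<bar>E x\<bar> \<le> M"
  obtains Ek where "\<And>k. continuous_on UNIV (Ek k)" "\<And>k x. \<bar>Ek k x\<bar> \<le> M"
    "AE x in lborel. (\<lambda>k. Ek k x) \<longlonglongrightarrow> E x"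
proof -
  have M0: "0 \<le> M" using M[of 0] by linarith
  have "E \<in> borel_measurable lebesgue"
    using E by (simp add: measurable_completion)
  then have "E measurable_on UNIV"
    by (rule lebesgue_measurable_imp_measurable_on_real) simp
  then obtain N g where N: "negligible N" and g: "\<And>k. continuous_on UNIV (g k)"
    and lim: "\<And>x. x \<notin> N \<Longrightarrow> (\<lambda>k. g k x) \<longlonglongrightarrow> E x"
    unfolding measurable_on_def by auto
  define Ek where "Ek k x = max (-M) (min M (g k x))" for k x
  have "AE x in lebesgue. x \<notin> N"
    using N by (simp add: negligible_iff_null_sets AE_not_in)
  then have "AE x in lborel. x \<notin> N"
    by (simp add: AE_completion_iff)
  then have AE: "AE x in lborel. (\<lambda>k. Ek k x) \<longlonglongrightarrow> E x"
  proof eventually_elim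
    case (elim x)
    then have "(\<lambda>k. Ek k x) \<longlonglongrightarrow> max (-M) (min M (E x))"
      unfolding Ek_def by (intro tendsto_intros lim)
    moreover have "max (-M) (min M (E x)) = E x" using M[of x] by linarith
    ultimately show ?case by simp
  qed
  show thesis
  proof (rule that)
    show "continuous_on UNIV (Ek k)" for k
      unfolding Ek_def by (intro continuous_intros g)
    show "\<bar>Ek k x\<bar> \<le> M" for k x
      unfolding Ek_def using M0 by linarith
  qed (rule AE)
qed

text \<open>Membership of \<open>\<alpha>\<close> in \<open>W\<^sup>1\<^sup>,\<^sup>\<infinity>([-1,1])\<close>, with an everywhere bounded Borel representative \<open>E\<close> of \<open>\<alpha>'\<close>.\<close>

definition bounded_primitive :: "real \<Rightarrow> (real \<Rightarrow> real) \<Rightarrow> (real \<Rightarrow> real) \<Rightarrow> bool" where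
  "bounded_primitive M E \<alpha> \<longleftrightarrow> E \<in> borel_measurable borel \<and> (\<forall>x. \<bar>E x\<bar> \<le> M) \<and>
     (\<forall>x y. -1 \<le> x \<and> x \<le> y \<and> y \<le> 1 \<longrightarrow> \<alpha> y - \<alpha> x = (LINT t:{x..y}|lborel. E t))"

lemma set_integrable_bounded:
  fixes E :: "real \<Rightarrow> real"
  assumes "E \<in> borel_measurable borel" "\<And>x. \<bar>E x\<bar> \<le> M"
  shows "set_integrable lborel {a..b} E"
  unfolding set_integrable_def
proof (rule Bochner_Integration.integrable_bound)
  show "integrable lborel (\<lambda>x. indicator {a..b} x *\<^sub>R M)"
    by (simp add: emeasure_lborel_Icc_eq)
  show "(\<lambda>x. indicat_real {a..b} x *\<^sub>R E x) \<in> borel_measurable lborel"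
    using assms(1) by simp
  show "AE x in lborel. norm (indicat_real {a..b} x *\<^sub>R E x) \<le> norm (indicat_real {a..b} x *\<^sub>R M)"
    using order_trans[OF assms(2) abs_ge_self] by (auto simp: indicator_def)
qed

lemma set_lebesgue_integral_abs_le:
  fixes E :: "real \<Rightarrow> real"
  assumes "E \<in> borel_measurable borel" "\<And>x. \<bar>E x\<bar> \<le> M" "a \<le> b"
  shows "\<bar>LINT t:{a..b}|lborel. E t\<bar> \<le> M * (b - a)"
proof -
  have "\<bar>LINT t:{a..b}|lborel. E t\<bar> \<le> (LINT t:{a..b}|lborel. \<bar>E t\<bar>)"
    using set_integral_norm_bound[OF set_integrable_bounded[OF assms(1,2)]] by simp
  also have "\<dots> \<le> (LINT t:{a..b}|lborel. M)"
    using assms set_integrable_bounded[of "\<lambda>x. \<bar>E x\<bar>" M] set_integrable_bounded[of "\<lambda>x. M" "\<bar>M\<bar>"]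
    by (intro set_integral_mono) auto
  also have "\<dots> = M * (b - a)"
    using assms(3) by (simp add: set_lebesgue_integral_def emeasure_lborel_Icc_eq measure_def)
  finally show ?thesis .
qed

lemma bounded_primitive_lipschitz:
  assumes "bounded_primitive M E \<alpha>" "x \<in> {-1..1}" "y \<in> {-1..1}"
  shows "\<bar>\<alpha> y - \<alpha> x\<bar> \<le> M * \<bar>y - x\<bar>"
proof -
  have *: "\<bar>\<alpha> y - \<alpha> x\<bar> \<le> M * (y - x)" if "-1 \<le> x" "x \<le> y" "y \<le> 1" for x y
    using set_lebesgue_integral_abs_le[of E M x y] assms(1) that
    by (simp add: bounded_primitive_def)
  show ?thesis
    using *[of x y] *[of y x] assms(2,3)
    by (cases "x \<le> y") (auto simp: abs_minus_commute)
qed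

lemma bounded_primitive_continuous:
  assumes "bounded_primitive M E \<alpha>"
  shows "continuous_on {-1..1} \<alpha>"
proof (rule lipschitz_on_continuous_on)
  have "0 \<le> M" using assms abs_ge_zero order_trans unfolding bounded_primitive_def by blast
  then show "M-lipschitz_on {-1..1} \<alpha>"
    using bounded_primitive_lipschitz[OF assms]
    by (intro lipschitz_onI) (auto simp: dist_real_def abs_minus_commute)
qed

text \<open>Convergence of \<open>Ek\<close> to \<open>E\<close> almost everywhere under a common
  bound gives convergence in L^1 on the slab, and the L^1 distance controls the primitives
  uniformly. They are anchored at z = 1 exactly, not merely close to \<alpha> there, because test
  functions built from them have to vanish on the outgoing half of the boundary z = 1.\<close>

lemma bounded_primitive_approx:
  assumes P: "bounded_primitive M E \<alpha>"
  obtains ak Ek where "\<And>k x. (ak k has_real_derivative Ek k x) (at x)"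
    "\<And>k. continuous_on UNIV (Ek k)" "\<And>k x. \<bar>Ek k x\<bar> \<le> M"
    "AE x in lborel. (\<lambda>k. Ek k x) \<longlonglongrightarrow> E x"
    "\<And>k. ak k 1 = \<alpha> 1" "uniform_limit {-1..1} ak \<alpha> sequentially"
proof -
  have Em[measurable]: "E \<in> borel_measurable borel" and EM: "\<And>x. \<bar>E x\<bar> \<le> M"
    and EI: "\<And>x y. -1 \<le> x \<Longrightarrow> x \<le> y \<Longrightarrow> y \<le> 1 \<Longrightarrow> \<alpha> y - \<alpha> x = (LINT t:{x..y}|lborel. E t)"
    using P by (auto simp: bounded_primitive_def)
  have M0: "0 \<le> M" using EM[of 0] by linarith
  obtain Ek where Ek: "\<And>k. continuous_on UNIV (Ek k)" "\<And>k x. \<bar>Ek k x\<bar> \<le> M"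
    "AE x in lborel. (\<lambda>k. Ek k x) \<longlonglongrightarrow> E x"
    using continuous_approx_AE[OF Em EM] by blast
  have Ekm[measurable]: "Ek k \<in> borel_measurable borel" for k
    using Ek(1) by (rule borel_measurable_continuous_onI)
  obtain G where G: "\<And>k x. (G k has_real_derivative Ek k x) (at x)"
    using continuous_imp_antiderivative[OF Ek(1)] by metis
  define ak where "ak k x = G k x - G k 1 + \<alpha> 1" for k x
  have ak: "(ak k has_real_derivative Ek k x) (at x)" for k x
    unfolding ak_def by (auto intro!: derivative_eq_intros G)
  have akI: "ak k y - ak k x = (LINT t:{x..y}|lborel. Ek k t)" if "x \<le> y" for k x y
    using that integral_FTC_Icc[of x y "ak k" "Ek k"] ak[of k] continuous_on_subset[OF Ek(1)[of k]]
    by (simp add: set_lebesgue_integral_def has_real_derivative_iff_has_vector_derivative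
         has_vector_derivative_at_within)
  define d where "d k = (LINT t:{-1..1}|lborel. \<bar>Ek k t - E t\<bar>)" for k
  have b2: "\<bar>Ek k x - E x\<bar> \<le> 2 * M" for k x
    using Ek(2)[of k x] EM[of x] by linarith
  have "d \<longlonglongrightarrow> (LINT t:{-1..1::real}|lborel. (0::real))"
    unfolding d_def set_lebesgue_integral_def
  proof (rule integral_dominated_convergence)
    show "integrable lborel (\<lambda>x. indicator {-1..1::real} x *\<^sub>R (2*M))"
      by (simp add: emeasure_lborel_Icc_eq)
    show "AE x in lborel. (\<lambda>i. indicator {-1..1} x *\<^sub>R \<bar>Ek i x - E x\<bar>) \<longlonglongrightarrow> indicator {-1..1} x *\<^sub>R (0::real)"
      using Ek(3)
    proof eventually_elim
      case (elim x)
      have "(\<lambda>i. \<bar>Ek i x - E x\<bar>) \<longlonglongrightarrow> \<bar>E x - E x\<bar>"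
        by (intro tendsto_intros elim)
      then show ?case by (auto simp: indicator_def)
    qed
    show "AE x in lborel. norm (indicat_real {-1..1} x *\<^sub>R \<bar>Ek i x - E x\<bar>) \<le> indicat_real {-1..1} x *\<^sub>R (2 * M)" for i
      using b2 by (auto simp: indicator_def)
  qed measurable
  then have d: "d \<longlonglongrightarrow> 0" by (simp add: set_lebesgue_integral_def)
  have bd: "dist (ak k x) (\<alpha> x) \<le> d k" if x: "x \<in> {-1..1}" for k x
  proof -
    have i: "set_integrable lborel {a..b} (\<lambda>t. Ek k t - E t)" for a b
      by (rule set_integrable_bounded[OF _ b2]) measurable
    have "\<alpha> x - ak k x = (LINT t:{x..1}|lborel. Ek k t) - (LINT t:{x..1}|lborel. E t)"
      using akI[of x 1 k] EI[of x 1] x by (simp add: ak_def)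
    also have "\<dots> = (LINT t:{x..1}|lborel. Ek k t - E t)"
      using set_integrable_bounded[OF _ Ek(2)[of k]] set_integrable_bounded[OF Em EM]
      by (subst set_integral_diff) auto
    finally have "\<bar>\<alpha> x - ak k x\<bar> \<le> (LINT t:{x..1}|lborel. \<bar>Ek k t - E t\<bar>)"
      using set_integral_norm_bound[OF i, of x 1] by simp
    also have "\<dots> \<le> d k"
      unfolding d_def set_lebesgue_integral_def
      using set_integrable_abs[OF i, of x 1] set_integrable_abs[OF i, of "-1" 1] x
      by (intro integral_mono) (auto simp: set_integrable_def indicator_def)
    finally show ?thesis by (simp add: dist_real_def abs_minus_commute)
  qed
  have "uniform_limit {-1..1} ak \<alpha> sequentially"
  proof (rule uniform_limitI)
    fix e :: real assume "e > 0"
    then have "\<forall>\<^sub>F k in sequentially. d k < e"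
      using d by (simp add: order_tendstoD)
    then show "\<forall>\<^sub>F k in sequentially. \<forall>x\<in>{-1..1}. dist (ak k x) (\<alpha> x) < e"
      by eventually_elim (use bd le_less_trans in blast)
  qed
  with ak Ek show thesis by (intro that[of ak Ek]) (auto simp: ak_def)
qed

text \<open>Integrated form of d/dz \<Psi>(z, \<alpha>(z)). For C1 approximations of \<alpha> it is
  the fundamental theorem of calculus, and both sides pass to the limit. Smoothness of \<Psi> is
  asked only on an open set around the graph of \<alpha>, since the functions of interest contain a
  square root that is smooth only away from turning points.\<close>

lemma chain_rule_integral:
  fixes \<Psi> \<Psi>z \<Psi>s :: "real \<times> real \<Rightarrow> real"
  assumes P: "bounded_primitive M E \<alpha>" and U: "open U"
    and D: "\<And>p. p \<in> U \<Longrightarrow> (\<Psi> has_derivative (\<lambda>(h, k). h * \<Psi>z p + k * \<Psi>s p)) (at p)"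
    and cz: "continuous_on U \<Psi>z" and cs: "continuous_on U \<Psi>s"
    and graph: "\<And>z. z \<in> {-1..1} \<Longrightarrow> (z, \<alpha> z) \<in> U"
  shows "(LINT z:{-1..1}|lborel. \<Psi>z (z, \<alpha> z) + \<Psi>s (z, \<alpha> z) * E z) = \<Psi> (1, \<alpha> 1) - \<Psi> (-1, \<alpha> (-1))"
proof -
  obtain ak Ek where ak: "\<And>k x. (ak k has_real_derivative Ek k x) (at x)"
    and Ek: "\<And>k. continuous_on UNIV (Ek k)" "\<And>k x. \<bar>Ek k x\<bar> \<le> M"
    "AE x in lborel. (\<lambda>k. Ek k x) \<longlonglongrightarrow> E x"
    and "\<And>k. ak k 1 = \<alpha> 1" and ul: "uniform_limit {-1..1} ak \<alpha> sequentially"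
    using bounded_primitive_approx[OF P] by blast
  have Em: "E \<in> borel_measurable borel" and EM: "\<And>x. \<bar>E x\<bar> \<le> M"
    using P by (auto simp: bounded_primitive_def)
  have M0: "0 \<le> M" using EM[of 0] by linarith
  have ca: "continuous_on {-1..1} \<alpha>" using P by (rule bounded_primitive_continuous)
  define C where "C = (\<lambda>z. (z, \<alpha> z)) ` {-1..1}"
  have "compact C" unfolding C_def
    by (intro compact_continuous_image continuous_intros ca) auto
  moreover have "C \<subseteq> U" using graph by (auto simp: C_def)
  ultimately obtain e where e: "e > 0" "(\<Union>x\<in>C. cball x e) \<subseteq> U"
    using compact_subset_open_imp_cball_epsilon_subset U by metis
  \<comment> \<open>A compact neighbourhood of the graph inside \<open>U\<close>. It contains the
    graphs of all late approximations, so the partial derivatives of \<Psi> are bounded along them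
    uniformly in k.\<close>
  define C' where "C' = {x + y |x y. x \<in> C \<and> y \<in> cball 0 e}"
  have cC': "compact C'" unfolding C'_def by (intro compact_sums \<open>compact C\<close> compact_cball)
  have C'U: "C' \<subseteq> U"
    using e(2) unfolding C'_def by (force simp: dist_norm)
  obtain B where B: "\<And>p. p \<in> C' \<Longrightarrow> \<bar>\<Psi>z p\<bar> \<le> B" "\<And>p. p \<in> C' \<Longrightarrow> \<bar>\<Psi>s p\<bar> \<le> B"
  proof -
    have "bounded (\<Psi>z ` C')" "bounded (\<Psi>s ` C')"
      using cz cs cC' C'U by (meson compact_continuous_image compact_imp_bounded continuous_on_subset)+
    then obtain B1 B2 where "\<forall>p\<in>C'. \<bar>\<Psi>z p\<bar> \<le> B1" "\<forall>p\<in>C'. \<bar>\<Psi>s p\<bar> \<le> B2"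
      by (auto simp: bounded_iff)
    then show thesis by (intro that[of "max B1 B2"]) (auto simp: max.coboundedI1 max.coboundedI2)
  qed
  have B0: "0 \<le> B" using B(1)[of "(1, \<alpha> 1)"] e(1) by (force simp: C'_def C_def)
  have "\<forall>\<^sub>F k in sequentially. \<forall>x\<in>{-1..1}. dist (ak k x) (\<alpha> x) < e"
    using ul e(1) by (rule uniform_limitD)
  then obtain k0 where k0: "\<And>k x. k \<ge> k0 \<Longrightarrow> x\<in>{-1..1} \<Longrightarrow> dist (ak k x) (\<alpha> x) < e"
    unfolding eventually_sequentially by blast
  have inC': "(x, ak (k+k0) x) \<in> C'" if "x \<in> {-1..1}" for k x
  proof -
    have "(x, ak (k+k0) x) = (x, \<alpha> x) + (0, ak (k+k0) x - \<alpha> x)" by simp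
    moreover have "(0, ak (k+k0) x - \<alpha> x) \<in> cball (0::real\<times>real) e"
      using k0[of "k+k0" x] that by (simp add: norm_Pair dist_real_def)
    moreover have "(x, \<alpha> x) \<in> C" using that by (simp add: C_def)
    ultimately show ?thesis unfolding C'_def by blast
  qed
  have inC: "(x, \<alpha> x) \<in> C'" if "x \<in> {-1..1}" for x
  proof -
    have "(x, \<alpha> x) = (x, \<alpha> x) + 0" "(x, \<alpha> x) \<in> C" "0 \<in> cball (0::real\<times>real) e"
      using that e(1) by (auto simp: C_def)
    then show ?thesis unfolding C'_def by blast
  qed
  \<comment> \<open>The shift by \<open>k0\<close> keeps every graph inside the neighbourhood, so
    the majorant is valid for all k and not only eventually.\<close>
  define g where "g k z = \<Psi>z (z, ak (k+k0) z) + \<Psi>s (z, ak (k+k0) z) * Ek (k+k0) z" for k z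
  have cak: "continuous_on S (ak k)" for k S
    using ak[of k] by (meson DERIV_continuous continuous_at_imp_continuous_on)
  have cg: "continuous_on {-1..1} (g k)" for k
    unfolding g_def using inC' C'U
    by (intro continuous_intros continuous_on_compose2[OF cz] continuous_on_compose2[OF cs]
         cak continuous_on_subset[OF Ek(1)]) auto
  have dg: "((\<lambda>z. \<Psi> (z, ak (k+k0) z)) has_real_derivative g k z) (at z within {-1..1})"
    if z: "z \<in> {-1..1}" for k z
  proof -
    have "((\<lambda>z. \<Psi> (z, ak (k+k0) z)) has_derivative
        (\<lambda>h. (\<lambda>(h, k'). h * \<Psi>z (z, ak (k+k0) z) + k' * \<Psi>s (z, ak (k+k0) z)) (h, Ek (k+k0) z * h))) (at z)"
    proof (rule has_derivative_compose[of "\<lambda>z. (z, ak (k+k0) z)"])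
      show "((\<lambda>z. (z, ak (k+k0) z)) has_derivative (\<lambda>h. (h, Ek (k+k0) z * h))) (at z)"
        using ak[of "k+k0" z] by (intro has_derivative_Pair has_derivative_ident)
          (simp add: has_field_derivative_def)
      show "(\<Psi> has_derivative (\<lambda>(h, k'). h * \<Psi>z (z, ak (k+k0) z) + k' * \<Psi>s (z, ak (k+k0) z))) (at (z, ak (k+k0) z))"
        using D inC' C'U z by blast
    qed
    then have "((\<lambda>z. \<Psi> (z, ak (k+k0) z)) has_real_derivative g k z) (at z)"
      unfolding has_field_derivative_def g_def by (rule back_subst[where P="\<lambda>f. (_ has_derivative f) _"])
         (auto simp: algebra_simps)
    then show ?thesis by (rule has_field_derivative_at_within)
  qed
  have I: "(LINT z:{-1..1}|lborel. g k z) = \<Psi> (1, ak (k+k0) 1) - \<Psi> (-1, ak (k+k0) (-1))" for k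
    using integral_FTC_Icc[of "-1" 1 "\<lambda>z. \<Psi> (z, ak (k+k0) z)" "g k"] dg[of _ k] cg[of k]
    by (simp add: set_lebesgue_integral_def has_real_derivative_iff_has_vector_derivative)
  have lak: "(\<lambda>k. ak (k+k0) z) \<longlonglongrightarrow> \<alpha> z" if "z \<in> {-1..1}" for z
    using tendsto_uniform_limitI[OF ul that] by (rule LIMSEQ_ignore_initial_segment)
  have lp: "(\<lambda>k. F (z, ak (k+k0) z)) \<longlonglongrightarrow> F (z, \<alpha> z)" if "z \<in> {-1..1}" "continuous_on U F"
    for F :: "real\<times>real \<Rightarrow> real" and z
    using that inC' C'U graph
    by (intro continuous_on_tendsto_compose[OF that(2)] tendsto_intros lak always_eventually) auto
  have cP: "continuous_on U \<Psi>"
    using D has_derivative_continuous by (blast intro: continuous_at_imp_continuous_on)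
  have "(\<lambda>k. LINT z:{-1..1}|lborel. g k z) \<longlonglongrightarrow> (LINT z:{-1..1}|lborel. \<Psi>z (z, \<alpha> z) + \<Psi>s (z, \<alpha> z) * E z)"
    unfolding set_lebesgue_integral_def
  proof (rule integral_dominated_convergence)
    show "integrable lborel (\<lambda>x. indicator {-1..1::real} x *\<^sub>R (B + B * M))"
      by (simp add: emeasure_lborel_Icc_eq)
    show "AE x in lborel. (\<lambda>i. indicat_real {-1..1} x *\<^sub>R g i x) \<longlonglongrightarrow>
          indicat_real {-1..1} x *\<^sub>R (\<Psi>z (x, \<alpha> x) + \<Psi>s (x, \<alpha> x) * E x)"
      using Ek(3)
    proof eventually_elim
      case (elim x)
      have "(\<lambda>i. g i x) \<longlonglongrightarrow> \<Psi>z (x, \<alpha> x) + \<Psi>s (x, \<alpha> x) * E x" if "x \<in> {-1..1}"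
        unfolding g_def using that
        by (intro tendsto_intros lp cz cs LIMSEQ_ignore_initial_segment[OF elim])
      then show ?case by (auto simp: indicator_def)
    qed
    show "AE x in lborel. norm (indicat_real {-1..1} x *\<^sub>R g i x) \<le> indicat_real {-1..1} x *\<^sub>R (B + B * M)" for i
    proof (intro always_eventually allI)
      fix x
      have "\<bar>g i x\<bar> \<le> B + B * M" if "x \<in> {-1..1}"
        unfolding g_def using B[OF inC'[OF that]] Ek(2) B0
        by (intro order_trans[OF abs_triangle_ineq] add_mono) (auto simp: abs_mult intro!: mult_mono)
      then show "norm (indicat_real {-1..1} x *\<^sub>R g i x) \<le> indicat_real {-1..1} x *\<^sub>R (B + B * M)"
        by (auto simp: indicator_def)
    qed
    have "continuous_on {-1..1} (\<lambda>x. \<Psi>z (x, \<alpha> x))" "continuous_on {-1..1} (\<lambda>x. \<Psi>s (x, \<alpha> x))"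
      using graph by (auto intro!: continuous_on_compose2[OF cz] continuous_on_compose2[OF cs] continuous_intros ca)
    from this[THEN borel_measurable_continuous_on_indicator[rotated]]
    have "(\<lambda>x. indicat_real {-1..1} x *\<^sub>R \<Psi>z (x, \<alpha> x)) \<in> borel_measurable borel"
       "(\<lambda>x. indicat_real {-1..1} x *\<^sub>R \<Psi>s (x, \<alpha> x)) \<in> borel_measurable borel" by auto
    then have "(\<lambda>x. indicat_real {-1..1} x *\<^sub>R \<Psi>z (x, \<alpha> x) + indicat_real {-1..1} x *\<^sub>R \<Psi>s (x, \<alpha> x) * E x)
       \<in> borel_measurable borel" using Em by measurable
    then show "(\<lambda>x. indicat_real {-1..1} x *\<^sub>R (\<Psi>z (x, \<alpha> x) + \<Psi>s (x, \<alpha> x) * E x)) \<in> borel_measurable lborel"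
      by (simp add: algebra_simps)
    show "(\<lambda>x. indicat_real {-1..1} x *\<^sub>R g i x) \<in> borel_measurable lborel" for i
      using borel_measurable_continuous_on_indicator[OF _ cg[of i]] by simp
  qed
  moreover have "(\<lambda>k. \<Psi> (1, ak (k+k0) 1) - \<Psi> (-1, ak (k+k0) (-1))) \<longlonglongrightarrow> \<Psi> (1, \<alpha> 1) - \<Psi> (-1, \<alpha> (-1))"
    by (intro tendsto_intros lp cP) auto
  ultimately show ?thesis
    unfolding I by (rule LIMSEQ_unique)
qed

section \<open>Bounded primitives and weak derivatives\<close>

lemma set_integral_Ioo:
  fixes f :: "real \<Rightarrow> real"
  shows "(LINT x:{a<..<b}|lborel. f x) = (LINT x:{a..b}|lborel. f x)"
  unfolding set_lebesgue_integral_def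
  by (rule integral_discrete_difference[of "{a, b}"]) (auto simp: indicator_def)

lemma set_integral_Ioc:
  fixes f :: "real \<Rightarrow> real"
  shows "(LINT x:{a<..b}|lborel. f x) = (LINT x:{a..b}|lborel. f x)"
  unfolding set_lebesgue_integral_def
  by (rule integral_discrete_difference[of "{a}"]) (auto simp: indicator_def)

text \<open>Integration by parts is the chain rule for \<Psi>(z, s) = \<phi>(z) s; the boundary
  terms vanish because \<phi> has compact support in the open interval.\<close>

lemma bounded_primitive_weak_deriv:
  assumes P: "bounded_primitive M E \<alpha>"
  shows "weak_deriv {-1<..<1} \<alpha> E"
proof -
  have Em[measurable]: "E \<in> borel_measurable borel" and EM: "\<And>x. \<bar>E x\<bar> \<le> M"
    using P by (auto simp: bounded_primitive_def)
  have ca: "continuous_on {-1..1} \<alpha>" using P by (rule bounded_primitive_continuous)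
  have la: "locally_integrable_on {-1<..<1} \<alpha>"
    unfolding locally_integrable_on_def set_integrable_def
  proof (intro allI impI borel_integrable_compact)
    fix K :: "real set" assume K: "compact K \<and> K \<subseteq> {-1<..<1}"
    have "{-1<..<1} \<subseteq> {-1..1::real}" by auto
    with K show "continuous_on K \<alpha>" by (blast intro: continuous_on_subset[OF ca])
  qed auto
  have lE: "locally_integrable_on {-1<..<1} E"
    unfolding locally_integrable_on_def
  proof (intro allI impI)
    fix K :: "real set" assume K: "compact K \<and> K \<subseteq> {-1<..<1}"
    show "set_integrable lborel K E"
      by (rule set_integrable_subset[OF set_integrable_bounded[OF Em EM, of "-1" 1]])
         (use K in \<open>auto simp: borel_compact\<close>)
  qed
  have "(LINT x:{-1<..<1}|lborel. \<alpha> x * deriv \<phi> x) = - (LINT x:{-1<..<1}|lborel. E x * \<phi> x)"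
    if "C1_test {-1<..<1} \<phi>" for \<phi>
  proof -
    have "\<exists>K. K \<subseteq> {-1<..<1} \<and> (\<forall>x. x \<notin> K \<longrightarrow> \<phi> x = 0)"
      using that unfolding C1_test_def by blast
    then have \<phi>0: "\<phi> 1 = 0" "\<phi> (-1) = 0" by force+
    have "\<phi> C1_differentiable_on UNIV"
      using that unfolding C1_test_def by blast
    then obtain D where D: "\<And>x. (\<phi> has_vector_derivative D x) (at x)" and cD: "continuous_on UNIV D"
      by (auto simp: C1_differentiable_on_def)
    have D': "(\<phi> has_real_derivative D x) (at x)" for x
      using D by (simp add: has_real_derivative_iff_has_vector_derivative)
    have c\<phi>: "continuous_on UNIV \<phi>"
      using D' by (meson DERIV_continuous continuous_at_imp_continuous_on)
    have dD: "deriv \<phi> = D" using D' DERIV_imp_deriv by blast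
    have "(LINT z:{-1..1}|lborel. D z * \<alpha> z + \<phi> z * E z) = \<phi> 1 * \<alpha> 1 - \<phi> (-1) * \<alpha> (-1)"
    proof -
      have d: "((\<lambda>p::real\<times>real. \<phi> (fst p) * snd p) has_derivative
         (\<lambda>(h, k). h * (D (fst p) * snd p) + k * \<phi> (fst p))) (at p)" for p
      proof -
        have "((\<lambda>p::real\<times>real. \<phi> (fst p)) has_derivative (\<lambda>h. D (fst p) * fst h)) (at p)"
          using D'[of "fst p"] unfolding has_field_derivative_def
          by (rule has_derivative_compose[rotated]) (auto intro!: derivative_eq_intros)
        then have "((\<lambda>p::real\<times>real. \<phi> (fst p) * snd p) has_derivative
           (\<lambda>h. \<phi> (fst p) * snd h + D (fst p) * fst h * snd p)) (at p)"
          by (intro has_derivative_mult) (auto intro!: derivative_eq_intros)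
        then show ?thesis
          by (rule back_subst[where P="\<lambda>f. (_ has_derivative f) _"]) (auto simp: algebra_simps)
      qed
      show ?thesis
        using chain_rule_integral[OF P open_UNIV d]
        by (simp add: continuous_intros continuous_on_compose2[OF cD] continuous_on_compose2[OF c\<phi>])
    qed
    also have "\<dots> = 0" by (simp add: \<phi>0)
    finally have I: "(LINT z:{-1..1}|lborel. D z * \<alpha> z + \<phi> z * E z) = 0" .
    have i1: "set_integrable lborel {-1..1} (\<lambda>z. D z * \<alpha> z)"
        using borel_integrable_compact[of "{-1..1}" "\<lambda>z. D z * \<alpha> z"] continuous_on_subset[OF cD subset_UNIV]
        by (auto simp: set_integrable_def intro!: continuous_intros ca)
    have i2: "set_integrable lborel {-1..1} (\<lambda>z. \<phi> z * E z)"
    proof -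
      obtain B where B: "\<And>x. x \<in> {-1..1} \<Longrightarrow> \<bar>\<phi> x\<bar> \<le> B"
        using continuous_on_interval_bounded[OF continuous_on_subset[OF c\<phi> subset_UNIV]] by blast
      have [measurable]: "\<phi> \<in> borel_measurable borel"
        using c\<phi> by (rule borel_measurable_continuous_onI)
      show ?thesis
        unfolding set_integrable_def
      proof (rule Bochner_Integration.integrable_bound)
        show "integrable lborel (\<lambda>x. indicator {-1..1::real} x *\<^sub>R (B * M))"
          by (simp add: emeasure_lborel_Icc_eq)
        show "AE x in lborel. norm (indicat_real {-1..1} x *\<^sub>R (\<phi> x * E x)) \<le> norm (indicat_real {-1..1} x *\<^sub>R (B * M))"
        proof (intro always_eventually allI)
          fix x
          have "0 \<le> B" using B[of 0] abs_ge_zero[of "\<phi> 0"] by auto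
          then have "\<bar>\<phi> x\<bar> * \<bar>E x\<bar> \<le> B * \<bar>M\<bar>" if "x \<in> {-1..1}"
            using B[OF that] EM[of x] by (intro mult_mono) auto
          then show "norm (indicat_real {-1..1} x *\<^sub>R (\<phi> x * E x)) \<le> norm (indicat_real {-1..1} x *\<^sub>R (B * M))"
            using \<open>0 \<le> B\<close> by (auto simp: indicator_def abs_mult)
        qed
      qed measurable
    qed
    have "(LINT z:{-1..1}|lborel. D z * \<alpha> z) = - (LINT z:{-1..1}|lborel. \<phi> z * E z)"
      using I set_integral_add(2)[OF i1 i2] by simp
    then show ?thesis by (simp add: dD mult.commute set_integral_Ioo)
  qed
  with la lE show ?thesis unfolding weak_deriv_def by blast
qed

text \<open>du Bois-Reymond: testing against the primitive of \<open>(\<beta> - c) w\<close>, where \<open>c\<close> is the \<open>w\<close>-mean of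
  \<open>\<beta>\<close>, gives \<open>\<integral> (\<beta> - c)\<^sup>2 w = 0\<close>.\<close>

lemma weak_deriv_zero_imp_constant:
  fixes \<beta> :: "real \<Rightarrow> real"
  assumes c: "continuous_on {-1..1} \<beta>"
    and w: "\<And>\<phi>. C1_test {-1<..<1} \<phi> \<Longrightarrow> (LINT x:{-1<..<1}|lborel. \<beta> x * deriv \<phi> x) = 0"
    and x: "x \<in> {-1..1}"
  shows "\<beta> x = \<beta> 0"
proof -
  have int: "(LINT x:{-1<..<1}|lborel. f x) = integral {-1..1} f" if "continuous_on {-1..1} f" for f :: "real \<Rightarrow> real"
  proof -
    have "(LINT x:{-1..1}|lborel. f x) = integral {-1..1} f"
      using borel_integrable_compact[OF compact_Icc that]
      by (intro set_borel_integral_eq_integral) (simp add: set_integrable_def)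
    then show ?thesis by (simp add: set_integral_Ioo)
  qed
  have key: "\<beta> x = \<beta> 0" if r: "\<bar>x\<bar> < r" "r < 1" for x r
  proof -
    \<comment> \<open>The weight is positive exactly on (-r, r). Hence \<open>h\<close> below is
      continuous, supported in [-r, r] and of mean zero, and its primitive vanishing at -1 is a C1
      test function. The clamp \<open>cl\<close> serves to define \<open>h\<close> on the whole
      line.\<close>
    define w0 where "w0 x = max 0 (r\<^sup>2 - x\<^sup>2)" for x :: real
    define cl where "cl x = max (-1) (min 1 x)" for x :: real
    have w0c: "continuous_on S w0" for S unfolding w0_def by (intro continuous_intros)
    have clc: "continuous_on S (\<lambda>x. \<beta> (cl x))" for S
      by (rule continuous_on_compose2[OF c]) (auto simp: cl_def intro!: continuous_intros)
    have r0: "0 < r" using r by linarith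
    have w00: "w0 x = 0" if "x \<notin> {-r..r}" for x
    proof -
      have "r\<^sup>2 \<le> x\<^sup>2" using abs_le_square_iff[of r x] that r0 by auto
      then show ?thesis by (simp add: w0_def)
    qed
    have w0p: "w0 x > 0" if "\<bar>x\<bar> < r" for x
      using power_strict_mono[OF that, of 2] by (auto simp: w0_def)
    define W where "W = integral {-1..1} w0"
    define c0 where "c0 = integral {-1..1} (\<lambda>x. \<beta> (cl x) * w0 x) / W"
    have W0: "W \<noteq> 0"
    proof
      assume "W = 0"
      moreover have "w0 integrable_on {-1..1}" by (intro integrable_continuous_interval w0c)
      ultimately have hi: "(w0 has_integral 0) (cbox (-1) 1)" by (simp add: W_def has_integral_iff)
      have "w0 0 = 0"
        by (rule has_integral_0_cbox_imp_0[OF w0c _ hi]) (auto simp: w0_def)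
      with w0p[of 0] r0 show False by simp
    qed
    define h where "h x = (\<beta> (cl x) - c0) * w0 x" for x
    have hc: "continuous_on S h" for S unfolding h_def by (intro continuous_intros w0c clc)
    have ih: "integral {-1..1} h = 0"
    proof -
      have "integral {-1..1} h = integral {-1..1} (\<lambda>x. \<beta> (cl x) * w0 x - c0 * w0 x)"
        unfolding h_def by (simp add: left_diff_distrib)
      also have "\<dots> = integral {-1..1} (\<lambda>x. \<beta> (cl x) * w0 x) - c0 * W"
        unfolding W_def
        by (subst Henstock_Kurzweil_Integration.integral_diff)
           (auto intro!: integrable_continuous_interval continuous_intros w0c clc)
      finally show ?thesis using W0 by (simp add: c0_def)
    qed
    obtain G where G: "\<And>x. (G has_vector_derivative h x) (at x)"
      using continuous_imp_antiderivative[OF hc] by (metis has_real_derivative_iff_has_vector_derivative)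
    define \<phi> where "\<phi> x = G x - G (-1)" for x
    have d\<phi>: "(\<phi> has_vector_derivative h x) (at x)" for x
      unfolding \<phi>_def using has_vector_derivative_diff[OF G[of x] has_vector_derivative_const[of "G (-1)"]] by simp
    have FTC: "(h has_integral (\<phi> b - \<phi> a)) {a..b}" if "a \<le> b" for a b
      using that d\<phi> by (intro fundamental_theorem_of_calculus) (auto intro: has_vector_derivative_at_within)
    have \<phi>1: "\<phi> 1 = 0" using FTC[of "-1" 1] ih by (simp add: \<phi>_def has_integral_iff)
    have zero: "\<phi> x = 0" if "x \<notin> {-r..r}" for x
    proof -
      have h0: "(h has_integral 0) {a..b}" if "\<forall>x\<in>{a<..<b}. x \<notin> {-r..r}" for a b
      proof -
        have "((\<lambda>x. 0) has_integral 0) {a..b}" by simp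
        then show ?thesis
          by (rule has_integral_spike_finite[of "{a,b}", rotated 2]) (use that w00 in \<open>auto simp: h_def\<close>)
      qed
      have d: "\<phi> b = \<phi> a" if "a \<le> b" "\<forall>x\<in>{a<..<b}. x \<notin> {-r..r}" for a b
        using has_integral_unique[OF h0[OF that(2)] FTC[OF that(1)]] by simp
      have "\<phi> (-1) = 0" by (simp add: \<phi>_def)
      have "x \<le> -1 \<or> (-1 \<le> x \<and> x < -r) \<or> (r < x \<and> x \<le> 1) \<or> 1 \<le> x"
        using that by auto
      then consider "x \<le> -1" | "-1 \<le> x" "x < -r" | "r < x" "x \<le> 1" | "1 \<le> x"
        by blast
      then show ?thesis
      proof cases
        case 1
        have "\<forall>t\<in>{x<..<-1}. t \<notin> {-r..r}" using r(2) by auto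
        then show ?thesis using d[OF 1] \<open>\<phi> (-1) = 0\<close> by simp
      next
        case 2
        then have "\<forall>t\<in>{-1<..<x}. t \<notin> {-r..r}" by auto
        then show ?thesis using d[OF 2(1)] \<open>\<phi> (-1) = 0\<close> by simp
      next
        case 3
        then have "\<forall>t\<in>{x<..<1}. t \<notin> {-r..r}" by auto
        then show ?thesis using d[OF 3(2)] \<phi>1 by simp
      next
        case 4
        have "\<forall>t\<in>{1<..<x}. t \<notin> {-r..r}" using r(2) by auto
        then show ?thesis using d[OF 4] \<phi>1 by simp
      qed
    qed
    have "C1_test {-1<..<1} \<phi>"
      unfolding C1_test_def C1_differentiable_on_def
      using d\<phi> hc zero r(2) by (intro conjI exI[of _ h] exI[of _ "{-r..r}"]) auto
    then have "(LINT x:{-1<..<1}|lborel. \<beta> x * deriv \<phi> x) = 0" by (rule w)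
    moreover have "deriv \<phi> = h"
      using d\<phi> by (intro ext DERIV_imp_deriv) (simp add: has_real_derivative_iff_has_vector_derivative)
    ultimately have "integral {-1..1} (\<lambda>x. \<beta> x * h x) = 0"
      using int[of "\<lambda>x. \<beta> x * h x"] c hc by (simp add: continuous_intros)
    \<comment> \<open>The mean of \<open>h\<close> is zero, so subtracting the constant
      \<open>c0\<close> from \<beta> costs nothing and turns the integrand into a square times the
      weight.\<close>
    then have "integral {-1..1} (\<lambda>x. \<beta> x * h x - c0 * h x) = 0"
      using ih c hc
      by (subst Henstock_Kurzweil_Integration.integral_diff)
         (auto intro!: integrable_continuous_interval continuous_intros)
    moreover have "\<beta> x * h x - c0 * h x = (\<beta> x - c0)\<^sup>2 * w0 x" if "x \<in> {-1..1}" for x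
      using that by (simp add: h_def cl_def power2_eq_square algebra_simps)
    ultimately have I0: "integral {-1..1} (\<lambda>x. (\<beta> x - c0)\<^sup>2 * w0 x) = 0"
      by (metis (no_types, lifting) Henstock_Kurzweil_Integration.integral_cong)
    have sc: "continuous_on {-1..1} (\<lambda>x. (\<beta> x - c0)\<^sup>2 * w0 x)"
      by (intro continuous_intros c w0c)
    then have hi: "((\<lambda>x. (\<beta> x - c0)\<^sup>2 * w0 x) has_integral 0) (cbox (-1) 1)"
      using I0 integrable_continuous_interval[OF sc] by (auto simp: has_integral_iff)
    have z: "(\<beta> y - c0)\<^sup>2 * w0 y = 0" if "y \<in> {-1..1}" for y
      by (rule has_integral_0_cbox_imp_0[OF _ _ hi]) (use sc that in \<open>auto simp: w0_def\<close>)
    have "\<beta> y = c0" if "\<bar>y\<bar> < r" for y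
      using z[of y] w0p[OF that] that r by (auto simp: abs_less_iff)
    then show "\<beta> x = \<beta> 0" using r by auto
  qed
  have "\<beta> x = \<beta> 0" if "x \<in> {-1<..<1}" for x
    using key[of x "(1 + \<bar>x\<bar>)/2"] that by (auto simp: abs_if)
  moreover have cl: "closure {-1<..<1} = {-1..1::real}" by simp
  ultimately show ?thesis
    using continuous_constant_on_closure[of "{-1<..<1}" \<beta> "\<beta> 0" x] c x unfolding cl by blast
qed

text \<open>The difference between \<alpha> and the primitive of \<open>E\<close> from -1 has weak
  derivative zero and is therefore constant. Continuity of \<alpha> makes the conclusion hold at
  every point, not merely almost everywhere.\<close>

lemma weak_deriv_imp_bounded_primitive:
  assumes wd: "weak_deriv {-1<..<1} \<alpha> E" and ca: "continuous_on {-1..1} \<alpha>"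
    and Em[measurable]: "E \<in> borel_measurable borel" and EM: "\<And>x. \<bar>E x\<bar> \<le> M"
  shows "bounded_primitive M E \<alpha>"
proof -
  define \<gamma> where "\<gamma> z = (LINT t:{-1..z}|lborel. E t)" for z
  have \<gamma>: "bounded_primitive M E \<gamma>"
    unfolding bounded_primitive_def
  proof (intro conjI allI impI EM Em)
    fix x y :: real assume xy: "-1 \<le> x \<and> x \<le> y \<and> y \<le> 1"
    have "\<gamma> y = (LINT t:{-1..x} \<union> {x<..y}|lborel. E t)"
      using ivl_disj_un_two(8)[of "-1" x y] xy by (simp add: \<gamma>_def)
    also have "\<dots> = \<gamma> x + (LINT t:{x<..y}|lborel. E t)"
      unfolding \<gamma>_def
    proof (rule set_integral_Un)
      show "set_integrable lborel {x<..y} E"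
        by (rule set_integrable_subset[OF set_integrable_bounded[OF Em EM, of x y]]) auto
    qed (auto intro: set_integrable_bounded[OF Em EM])
    finally show "\<gamma> y - \<gamma> x = (LINT t:{x..y}|lborel. E t)" by (simp add: set_integral_Ioc)
  qed
  have w\<gamma>: "weak_deriv {-1<..<1} \<gamma> E" using \<gamma> by (rule bounded_primitive_weak_deriv)
  have c\<gamma>: "continuous_on {-1..1} \<gamma>" using \<gamma> by (rule bounded_primitive_continuous)
  have const: "\<alpha> x - \<gamma> x = \<alpha> 0 - \<gamma> 0" if "x \<in> {-1..1}" for x
  proof (rule weak_deriv_zero_imp_constant[of "\<lambda>x. \<alpha> x - \<gamma> x"])
    show "continuous_on {-1..1} (\<lambda>x. \<alpha> x - \<gamma> x)" by (intro continuous_intros ca c\<gamma>)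
    fix \<phi> assume \<phi>: "C1_test {-1<..<1} \<phi>"
    have cd: "continuous_on UNIV (deriv \<phi>)"
    proof -
      obtain D where D: "\<And>x. (\<phi> has_vector_derivative D x) (at x)" "continuous_on UNIV D"
        using \<phi> by (auto simp: C1_test_def C1_differentiable_on_def)
      have "deriv \<phi> = D"
        using D(1) by (intro ext DERIV_imp_deriv) (simp add: has_real_derivative_iff_has_vector_derivative)
      with D(2) show ?thesis by simp
    qed
    have i: "set_integrable lborel {-1<..<1} (\<lambda>x. f x * deriv \<phi> x)" if "continuous_on {-1..1} f" for f
    proof (rule set_integrable_subset)
      show "set_integrable lborel {-1..1} (\<lambda>x. f x * deriv \<phi> x)"
        unfolding set_integrable_def
        by (intro borel_integrable_compact continuous_on_mult that compact_Icc
            continuous_on_subset[OF cd subset_UNIV])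
    qed auto
    show "(LINT x:{-1<..<1}|lborel. (\<alpha> x - \<gamma> x) * deriv \<phi> x) = 0"
    proof -
      have "(LINT x:{-1<..<1}|lborel. \<alpha> x * deriv \<phi> x) = - (LINT x:{-1<..<1}|lborel. E x * \<phi> x)"
        using wd \<phi> unfolding weak_deriv_def by blast
      moreover have "(LINT x:{-1<..<1}|lborel. \<gamma> x * deriv \<phi> x) = - (LINT x:{-1<..<1}|lborel. E x * \<phi> x)"
        using w\<gamma> \<phi> unfolding weak_deriv_def by blast
      ultimately show ?thesis
        using set_integral_diff(2)[OF i[OF ca] i[OF c\<gamma>]] by (simp add: left_diff_distrib)
    qed
  qed (use that in auto)
  show ?thesis
    using \<gamma> unfolding bounded_primitive_def
  proof (intro conjI allI impI; elim conjE)
    fix x y :: real assume xy: "-1 \<le> x" "x \<le> y" "y \<le> 1"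
      and *: "\<forall>x y. -1 \<le> x \<and> x \<le> y \<and> y \<le> 1 \<longrightarrow> \<gamma> y - \<gamma> x = (LINT t:{x..y}|lborel. E t)"
    show "\<alpha> y - \<alpha> x = (LINT t:{x..y}|lborel. E t)"
      using const[of x] const[of y] *[rule_format, of x y] xy by simp
  qed auto
qed

section \<open>Change of variables along characteristics\<close>

text \<open>Lebesgue measure on the half-line is compared with the image of 2v dv under v -> v^2. On
  [0, n] the two agree by substitution on a compact interval, and monotone exhaustion removes the
  bound; general \<open>h\<close> follows by integrating against equal measures.\<close>

lemma nn_integral_square_substitution:
  fixes h :: "real \<Rightarrow> ennreal"
  assumes [measurable]: "h \<in> borel_measurable borel"
  shows "(\<integral>\<^sup>+v. h (v\<^sup>2) * ennreal (2 * v) * indicator {0<..} v \<partial>lborel) = (\<integral>\<^sup>+t. h t * indicator {0<..} t \<partial>lborel)"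
proof -
  have eq: "density lborel (indicator {0<..}) = distr (density lborel (\<lambda>v. ennreal (2 * v) * indicator {0<..} v)) borel (\<lambda>v::real. v\<^sup>2)"
    (is "?N1 = ?N2")
  proof (rule measure_eqI)
    show "sets ?N1 = sets ?N2" by simp
  next
    fix A :: "real set" assume "A \<in> sets ?N1"
    then have A[measurable]: "A \<in> sets borel" by simp
    define M1 where "M1 = density lborel (\<lambda>t. ennreal (indicat_real A t))"
    define M2 where "M2 = density lborel (\<lambda>v. ennreal (indicat_real A (v\<^sup>2) * (2 * v)))"
    have step: "emeasure M1 {0..(real n)\<^sup>2} = emeasure M2 {0..real n}" for n
    proof -
      have "(\<integral>\<^sup>+x. ennreal (indicat_real A x * indicator {0\<^sup>2..(real n)\<^sup>2} x) \<partial>lborel)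
        = (\<integral>\<^sup>+x. ennreal (indicat_real A (x\<^sup>2) * (2 * x) * indicator {0..real n} x) \<partial>lborel)"
        by (rule nn_integral_substitution)
           (auto simp: set_borel_measurable_def intro!: derivative_eq_intros continuous_intros)
      then show ?thesis
        by (simp add: M1_def M2_def emeasure_density nn_integral_set_ennreal)
    qed
    have "emeasure M1 {0..} = (SUP n. emeasure M1 {0..(real n)\<^sup>2})"
    proof -
      have "t \<in> (\<Union>n. {0..(real n)\<^sup>2})" if "0 \<le> t" for t :: real
      proof -
        obtain n where "sqrt t \<le> real n" using real_arch_simple by blast
        then show ?thesis using that sqrt_le_D by fastforce
      qed
      then have "(\<Union>n. {0..(real n)\<^sup>2}) = {0..}" by auto
      moreover have "incseq (\<lambda>n. {0..(real n)\<^sup>2})"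
        by (auto simp: incseq_def intro: order_trans power_mono)
      ultimately show ?thesis
        by (subst SUP_emeasure_incseq) (auto simp: M1_def)
    qed
    also have "\<dots> = (SUP n. emeasure M2 {0..real n})" by (simp add: step)
    also have "\<dots> = emeasure M2 {0..}"
    proof -
      have "(\<Union>n. {0..real n}) = {0..}" using real_arch_simple by auto
      moreover have "incseq (\<lambda>n. {0..real n})"
        by (auto simp: incseq_def intro: order_trans)
      ultimately show ?thesis
        by (subst SUP_emeasure_incseq) (auto simp: M2_def)
    qed
    finally have E: "emeasure M1 {0..} = emeasure M2 {0..}" .
    have ne: "AE x in lborel. x \<noteq> (0::real)" by (rule AE_lborel_singleton)
    have "emeasure ?N1 A = emeasure M1 {0..}"
      using ne by (auto simp: M1_def emeasure_density intro!: nn_integral_cong_AE elim!: eventually_mono)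
         (auto simp: indicator_def)
    also have "\<dots> = (\<integral>\<^sup>+v. ennreal (2 * v) * indicator {0<..} v * indicator ((\<lambda>v::real. v\<^sup>2) -` A) v \<partial>lborel)"
      unfolding E M2_def
      by (subst emeasure_density) (auto intro!: nn_integral_cong simp: indicator_def)
    also have "\<dots> = emeasure ?N2 A"
    proof -
      have "(\<lambda>v::real. v\<^sup>2) -` A \<in> sets borel"
        using measurable_sets[of "\<lambda>v::real. v\<^sup>2" borel borel A] by simp
      then show ?thesis
        by (subst emeasure_distr) (auto simp: emeasure_density)
    qed
    finally show "emeasure ?N1 A = emeasure ?N2 A" .
  qed
  have "(\<integral>\<^sup>+t. h t * indicator {0<..} t \<partial>lborel) = (\<integral>\<^sup>+t. h t \<partial>density lborel (indicator {0<..}))"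
    by (subst nn_integral_density) (auto simp: mult.commute)
  also have "\<dots> = (\<integral>\<^sup>+v. h (v\<^sup>2) * ennreal (2 * v) * indicator {0<..} v \<partial>lborel)"
    unfolding eq by (subst nn_integral_distr) (auto simp: nn_integral_density mult_ac)
  finally show ?thesis ..
qed

text \<open>With t = v^2 and s = u^2 the relation u^2 = v^2 + c is a translation, which leaves
  Lebesgue measure invariant; this is v dv = u du at a fixed potential difference. The indicators
  keep both radicands positive, so c may have either sign.\<close>

lemma nn_integral_energy_substitution:
  fixes h :: "real \<Rightarrow> ennreal"
  assumes [measurable]: "h \<in> borel_measurable borel"
  shows "(\<integral>\<^sup>+v. h v * ennreal v * indicator {v. 0 < v \<and> 0 < v\<^sup>2 + c} v \<partial>lborel) =
    (\<integral>\<^sup>+u. h (sqrt (u\<^sup>2 - c)) * ennreal u * indicator {u. 0 < u \<and> c < u\<^sup>2} u \<partial>lborel)"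
proof -
  have e2: "a * ennreal (2 * v) = 2 * (a * ennreal v)" for v :: real and a
    by (cases "0 \<le> v") (auto simp: ennreal_mult ennreal_neg mult_nonneg_nonpos mult_ac)
  have "2 * (\<integral>\<^sup>+v. h v * ennreal v * indicator {v. 0 < v \<and> 0 < v\<^sup>2 + c} v \<partial>lborel) =
    (\<integral>\<^sup>+v. (h (sqrt (v\<^sup>2)) * indicator {t. 0 < t + c} (v\<^sup>2)) * ennreal (2 * v) * indicator {0<..} v \<partial>lborel)"
    by (subst nn_integral_cmult[symmetric]) (auto intro!: nn_integral_cong simp: indicator_def e2)
  also have "\<dots> = (\<integral>\<^sup>+t. (h (sqrt t) * indicator {t. 0 < t + c} t) * indicator {0<..} t \<partial>lborel)"
    by (rule nn_integral_square_substitution) measurable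
  also have "\<dots> = (\<integral>\<^sup>+s. (h (sqrt (s - c)) * indicator {s. c < s} s) * indicator {0<..} s \<partial>lborel)"
    by (subst nn_integral_real_affine[where c=1 and t="-c"]) (auto intro!: nn_integral_cong simp: indicator_def)
  also have "\<dots> = (\<integral>\<^sup>+u. (h (sqrt (u\<^sup>2 - c)) * indicator {s. c < s} (u\<^sup>2)) * ennreal (2 * u) * indicator {0<..} u \<partial>lborel)"
    by (rule nn_integral_square_substitution[symmetric]) measurable
  also have "\<dots> = 2 * (\<integral>\<^sup>+u. h (sqrt (u\<^sup>2 - c)) * ennreal u * indicator {u. 0 < u \<and> c < u\<^sup>2} u \<partial>lborel)"
    by (subst nn_integral_cmult[symmetric]) (auto intro!: nn_integral_cong simp: indicator_def e2)
  finally show ?thesis by (simp add: ennreal_mult_cancel_left)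
qed

lemma nn_integral_energy_substitution_signed:
  fixes h :: "real \<Rightarrow> ennreal"
  assumes [measurable]: "h \<in> borel_measurable borel" and \<sigma>: "\<sigma> = 1 \<or> \<sigma> = -1"
  shows "(\<integral>\<^sup>+v. h v * ennreal \<bar>v\<bar> * indicator {v. 0 < \<sigma> * v \<and> 0 < v\<^sup>2 + c} v \<partial>lborel) =
    (\<integral>\<^sup>+u. h (\<sigma> * sqrt (u\<^sup>2 - c)) * ennreal u * indicator {u. 0 < u \<and> c < u\<^sup>2} u \<partial>lborel)"
proof -
  have "\<sigma> \<noteq> 0" "\<bar>\<sigma>\<bar> = 1" using \<sigma> by auto
  then have "(\<integral>\<^sup>+v. h v * ennreal \<bar>v\<bar> * indicator {v. 0 < \<sigma> * v \<and> 0 < v\<^sup>2 + c} v \<partial>lborel) =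
    (\<integral>\<^sup>+v. h (\<sigma> * v) * ennreal v * indicator {v. 0 < v \<and> 0 < v\<^sup>2 + c} v \<partial>lborel)"
    using \<sigma> by (subst nn_integral_real_affine[where c=\<sigma> and t=0])
      (auto intro!: nn_integral_cong simp: indicator_def)
  also have "\<dots> = (\<integral>\<^sup>+u. h (\<sigma> * sqrt (u\<^sup>2 - c)) * ennreal u * indicator {u. 0 < u \<and> c < u\<^sup>2} u \<partial>lborel)"
    by (rule nn_integral_energy_substitution) measurable
  finally show ?thesis .
qed

text \<open>Tonelli reduces the plane to the substitution on each fibre. The result is phrased as an
  equality between a density and an image measure so that it applies to signed integrands through
  the transformation rule for integrals.\<close>

lemma energy_substitution_plane:
  fixes c :: "real \<Rightarrow> real"
  assumes [measurable]: "c \<in> borel_measurable borel" and \<sigma>: "\<sigma> = 1 \<or> \<sigma> = -1"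
  shows "density lborel (\<lambda>p::real \<times> real. ennreal (\<bar>snd p\<bar> * indicat_real {p. 0 < \<sigma> * snd p \<and> 0 < (snd p)\<^sup>2 + c (fst p)} p)) =
    distr (density lborel (\<lambda>p::real \<times> real. ennreal (snd p * indicat_real {p. 0 < snd p \<and> c (fst p) < (snd p)\<^sup>2} p)))
      borel (\<lambda>p. (fst p, \<sigma> * sqrt ((snd p)\<^sup>2 - c (fst p))))" (is "?N1 = ?N2")
proof (rule measure_eqI)
  show "sets ?N1 = sets ?N2" by simp
next
  fix A assume "A \<in> sets ?N1"
  then have A[measurable]: "A \<in> sets borel" by simp
  have [measurable]: "(\<lambda>p. \<bar>snd p\<bar> * indicat_real {p. 0 < \<sigma> * snd p \<and> 0 < (snd p)\<^sup>2 + c (fst p)} p) \<in> borel_measurable borel"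
    "(\<lambda>p. snd p * indicat_real {p. 0 < snd p \<and> c (fst p) < (snd p)\<^sup>2} p) \<in> borel_measurable borel"
    "(\<lambda>p. (fst p, \<sigma> * sqrt ((snd p)\<^sup>2 - c (fst p)))) \<in> borel \<rightarrow>\<^sub>M borel"
    unfolding borel_prod[symmetric] by measurable
  have m1: "(\<lambda>p. ennreal (\<bar>snd p\<bar> * indicat_real {p. 0 < \<sigma> * snd p \<and> 0 < (snd p)\<^sup>2 + c (fst p)} p) * indicator A p)
      \<in> borel_measurable (lborel \<Otimes>\<^sub>M lborel)"
    and m2: "(\<lambda>p. ennreal (snd p * indicat_real {p. 0 < snd p \<and> c (fst p) < (snd p)\<^sup>2} p) * indicator A (fst p, \<sigma> * sqrt ((snd p)\<^sup>2 - c (fst p))))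
      \<in> borel_measurable (lborel \<Otimes>\<^sub>M lborel)"
    unfolding lborel_prod by measurable
  have mA: "(\<lambda>v. (x, v)) \<in> borel \<rightarrow>\<^sub>M borel" for x :: real
    by (intro borel_measurable_continuous_onI continuous_intros)
  have "emeasure ?N1 A = (\<integral>\<^sup>+p. ennreal (\<bar>snd p\<bar> * indicat_real {p. 0 < \<sigma> * snd p \<and> 0 < (snd p)\<^sup>2 + c (fst p)} p) * indicator A p \<partial>(lborel \<Otimes>\<^sub>M lborel))"
    by (subst emeasure_density) (auto simp: lborel_prod)
  also have "\<dots> = (\<integral>\<^sup>+x. \<integral>\<^sup>+v. indicator A (x, v) * ennreal \<bar>v\<bar> * indicator {v. 0 < \<sigma> * v \<and> 0 < v\<^sup>2 + c x} v \<partial>lborel \<partial>lborel)"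
    unfolding lborel.nn_integral_fst[OF m1, symmetric]
    by (auto intro!: nn_integral_cong simp: indicator_def)
  also have "\<dots> = (\<integral>\<^sup>+x. \<integral>\<^sup>+u. indicator A (x, \<sigma> * sqrt (u\<^sup>2 - c x)) * ennreal u * indicator {u. 0 < u \<and> c x < u\<^sup>2} u \<partial>lborel \<partial>lborel)"
    by (intro nn_integral_cong nn_integral_energy_substitution_signed \<sigma>
        measurable_compose[OF mA borel_measurable_indicator] A)
  also have "\<dots> = (\<integral>\<^sup>+p. ennreal (snd p * indicat_real {p. 0 < snd p \<and> c (fst p) < (snd p)\<^sup>2} p) * indicator A (fst p, \<sigma> * sqrt ((snd p)\<^sup>2 - c (fst p))) \<partial>(lborel \<Otimes>\<^sub>M lborel))"
    unfolding lborel.nn_integral_fst[OF m2, symmetric]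
    by (auto intro!: nn_integral_cong simp: indicator_def)
  also have "\<dots> = emeasure ?N2 A"
  proof -
    have "(\<lambda>p. (fst p, \<sigma> * sqrt ((snd p)\<^sup>2 - c (fst p)))) -` A \<in> sets borel"
      using measurable_sets[of "\<lambda>p. (fst p, \<sigma> * sqrt ((snd p)\<^sup>2 - c (fst p)))" borel borel A] by simp
    then have "emeasure ?N2 A = (\<integral>\<^sup>+p. ennreal (snd p * indicat_real {p. 0 < snd p \<and> c (fst p) < (snd p)\<^sup>2} p) *
        indicator ((\<lambda>p. (fst p, \<sigma> * sqrt ((snd p)\<^sup>2 - c (fst p)))) -` A) p \<partial>lborel)"
      by (simp add: emeasure_distr emeasure_density)
    then show ?thesis by (simp add: lborel_prod indicator_def)
  qed
  finally show "emeasure ?N1 A = emeasure ?N2 A" .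
qed

text \<open>A particle at (z, v) that entered where the potential equals \<open>e\<close> did so
  with speed sqrt(v^2 + 2(\<alpha>(z) - e)), by conservation of energy. \<open>F\<close> is the
  incoming profile as a function of speed and \<sigma>, equal to 1 or -1, the direction of travel;
  positivity of the radicand excludes points that no such particle reaches.\<close>

definition beam :: "real \<Rightarrow> real \<Rightarrow> (real \<Rightarrow> real) \<Rightarrow> (real \<Rightarrow> real) \<Rightarrow> real \<times> real \<Rightarrow> real" where
  "beam \<sigma> e \<alpha> F p = (if 0 < \<sigma> * snd p \<and> 0 < (snd p)\<^sup>2 + 2 * (\<alpha> (fst p) - e)
     then F (sqrt ((snd p)\<^sup>2 + 2 * (\<alpha> (fst p) - e))) else 0)"

lemma beam_measurable [measurable]:
  assumes [measurable]: "\<alpha> \<in> borel_measurable borel" "F \<in> borel_measurable borel"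
  shows "beam \<sigma> e \<alpha> F \<in> borel_measurable borel"
  unfolding beam_def borel_prod[symmetric] by measurable

text \<open>The factor u / sqrt(u^2 - 2(\<alpha>(z) - e)) is the Jacobian dv/du of the energy
  relation. It is the kernel in the definition of \<open>lambda_const\<close>, with x =
  2(\<alpha>(z) - e).\<close>

lemma nn_integral_beam:
  assumes [measurable]: "F \<in> borel_measurable borel" and \<sigma>: "\<sigma> = 1 \<or> \<sigma> = -1" and F0: "\<And>u. 0 \<le> F u"
  shows "(\<integral>\<^sup>+v. ennreal (beam \<sigma> e \<alpha> F (z, v)) \<partial>lborel) =
     (\<integral>\<^sup>+u. ennreal (F u * u / sqrt (u\<^sup>2 - 2 * (\<alpha> z - e))) * indicator {u. 0 < u \<and> 2 * (\<alpha> z - e) < u\<^sup>2} u \<partial>lborel)"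
proof -
  let ?c = "2 * (\<alpha> z - e)"
  have "(\<integral>\<^sup>+v. ennreal (beam \<sigma> e \<alpha> F (z, v)) \<partial>lborel) =
    (\<integral>\<^sup>+v. ennreal (F (sqrt (v\<^sup>2 + ?c)) / \<bar>v\<bar>) * ennreal \<bar>v\<bar> * indicator {v. 0 < \<sigma> * v \<and> 0 < v\<^sup>2 + ?c} v \<partial>lborel)"
    by (intro nn_integral_cong) (auto simp: beam_def indicator_def ennreal_mult[symmetric] F0)
  also have "\<dots> = (\<integral>\<^sup>+u. ennreal (F (sqrt ((\<sigma> * sqrt (u\<^sup>2 - ?c))\<^sup>2 + ?c)) / \<bar>\<sigma> * sqrt (u\<^sup>2 - ?c)\<bar>) * ennreal u * indicator {u. 0 < u \<and> ?c < u\<^sup>2} u \<partial>lborel)"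
    by (rule nn_integral_energy_substitution_signed[OF _ \<sigma>]) measurable
  also have "\<dots> = (\<integral>\<^sup>+u. ennreal (F u * u / sqrt (u\<^sup>2 - ?c)) * indicator {u. 0 < u \<and> ?c < u\<^sup>2} u \<partial>lborel)"
    using \<sigma> by (intro nn_integral_cong) (auto simp: indicator_def ennreal_mult[symmetric] F0 power_mult_distrib)
  finally show ?thesis .
qed

section \<open>Test functions and integration along trajectories\<close>

lemma continuous_fst_borel [measurable]: "(fst :: real \<times> real \<Rightarrow> real) \<in> borel_measurable borel"
  and continuous_snd_borel [measurable]: "(snd :: real \<times> real \<Rightarrow> real) \<in> borel_measurable borel"
  by (intro borel_measurable_continuous_onI continuous_intros)+

lemma integrable_indicator_box:
  "integrable lborel (\<lambda>p. indicat_real (cbox a b :: (real \<times> real) set) p *\<^sub>R (c :: real))"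
  using emeasure_lborel_cbox_finite[of a b] by (intro integrable_scaleR_left integrable_real_indicator) auto

lemma kinetic_test_support:
  assumes "kinetic_test \<phi> \<phi>z \<phi>v"
  obtains R where "0 < R" "\<And>z v. R < \<bar>v\<bar> \<Longrightarrow> \<phi> (z, v) = 0 \<and> \<phi>z (z, v) = 0 \<and> \<phi>v (z, v) = 0"
proof -
  from assms have D: "\<And>p. (\<phi> has_derivative (\<lambda>(h, k). h * \<phi>z p + k * \<phi>v p)) (at p)"
    and b: "bounded {p. \<phi> p \<noteq> 0}"
    by (auto simp: kinetic_test_def)
  obtain R0 where R0: "\<And>p. \<phi> p \<noteq> 0 \<Longrightarrow> norm p \<le> R0" using b by (auto simp: bounded_iff)
  define R where "R = max R0 1"
  have z: "\<phi> (z, v) = 0" if "R < \<bar>v\<bar>" for z v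
    using R0[of "(z, v)"] norm_snd_le[of v z] that by (force simp: R_def)
  have "\<phi>z (z, v) = 0 \<and> \<phi>v (z, v) = 0" if Rv: "R < \<bar>v\<bar>" for z v
  proof -
    have "open {p :: real \<times> real. R < \<bar>snd p\<bar>}" by (intro open_Collect_less continuous_intros)
    then have "((\<lambda>_. 0) has_derivative (\<lambda>(h, k). h * \<phi>z (z, v) + k * \<phi>v (z, v))) (at (z, v))"
      by (rule has_derivative_transform_within_open[OF D]) (use Rv z in auto)
    then have "(\<lambda>(h, k). h * \<phi>z (z, v) + k * \<phi>v (z, v)) = (\<lambda>_. 0)"
      by (rule has_derivative_unique) simp
    from fun_cong[OF this, of "(1, 0)"] fun_cong[OF this, of "(0, 1)"] show ?thesis by simp
  qed
  with z show thesis by (intro that[of R]) (auto simp: R_def)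
qed

lemma kinetic_test_bounded:
  assumes "kinetic_test \<phi> \<phi>z \<phi>v"
  obtains R B where "0 < R" "0 \<le> B"
    "\<And>z v. R < \<bar>v\<bar> \<Longrightarrow> \<phi> (z, v) = 0 \<and> \<phi>z (z, v) = 0 \<and> \<phi>v (z, v) = 0"
    "\<And>z v. z \<in> {-1..1} \<Longrightarrow> \<bar>\<phi> (z, v)\<bar> \<le> B \<and> \<bar>\<phi>z (z, v)\<bar> \<le> B \<and> \<bar>\<phi>v (z, v)\<bar> \<le> B"
proof -
  obtain R where R: "0 < R" "\<And>z v. R < \<bar>v\<bar> \<Longrightarrow> \<phi> (z, v) = 0 \<and> \<phi>z (z, v) = 0 \<and> \<phi>v (z, v) = 0"
    using kinetic_test_support[OF assms] by blast
  have c: "continuous_on UNIV \<phi>" "continuous_on UNIV \<phi>z" "continuous_on UNIV \<phi>v"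
    using assms has_derivative_continuous unfolding kinetic_test_def
    by (blast intro: continuous_at_imp_continuous_on)+
  have k: "compact ({-1..1} \<times> {-R..R} :: (real \<times> real) set)" by (intro compact_Times compact_Icc)
  have "\<exists>B. \<forall>p\<in>{-1..1} \<times> {-R..R}. \<bar>g p\<bar> \<le> B" if "continuous_on UNIV g" for g :: "real \<times> real \<Rightarrow> real"
    using compact_imp_bounded[OF compact_continuous_image[OF continuous_on_subset[OF that subset_UNIV] k]]
    by (auto simp: bounded_iff)
  from this[OF c(1)] this[OF c(2)] this[OF c(3)] obtain B1 B2 B3 where
    B: "\<forall>p\<in>{-1..1} \<times> {-R..R}. \<bar>\<phi> p\<bar> \<le> B1" "\<forall>p\<in>{-1..1} \<times> {-R..R}. \<bar>\<phi>z p\<bar> \<le> B2" "\<forall>p\<in>{-1..1} \<times> {-R..R}. \<bar>\<phi>v p\<bar> \<le> B3"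
    by blast
  define B where "B = max 0 (max B1 (max B2 B3))"
  have "\<bar>\<phi> (z, v)\<bar> \<le> B \<and> \<bar>\<phi>z (z, v)\<bar> \<le> B \<and> \<bar>\<phi>v (z, v)\<bar> \<le> B" if "z \<in> {-1..1}" for z v
  proof (cases "R < \<bar>v\<bar>")
    case True
    with R(2) show ?thesis by (simp add: B_def)
  next
    case False
    then have "(z, v) \<in> {-1..1} \<times> {-R..R}" using that by auto
    with B have "\<bar>\<phi> (z, v)\<bar> \<le> B1" "\<bar>\<phi>z (z, v)\<bar> \<le> B2" "\<bar>\<phi>v (z, v)\<bar> \<le> B3" by blast+
    then show ?thesis by (simp add: B_def le_max_iff_disj)
  qed
  with R show thesis by (intro that[of R B]) (auto simp: B_def)
qed

lemma kinetic_test_measurable: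
  assumes "kinetic_test \<phi> \<phi>z \<phi>v"
  shows "\<phi> \<in> borel_measurable borel" "\<phi>z \<in> borel_measurable borel" "\<phi>v \<in> borel_measurable borel"
  using assms has_derivative_continuous unfolding kinetic_test_def
  by (blast intro: borel_measurable_continuous_onI continuous_at_imp_continuous_on)+

lemma kinetic_test_integrable:
  fixes f :: "real \<times> real \<Rightarrow> real"
  assumes t: "kinetic_test \<phi> \<phi>z \<phi>v"
    and [measurable]: "f \<in> borel_measurable borel" "E \<in> borel_measurable borel"
    and C: "\<And>p. \<bar>f p\<bar> \<le> C" and M: "\<And>z. \<bar>E z\<bar> \<le> M"
  shows "integrable lborel (\<lambda>p. indicator ({-1..1} \<times> UNIV) p * (f p * (snd p * \<phi>z p - E (fst p) * \<phi>v p)))"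
proof -
  obtain R B where R: "0 < R" "0 \<le> B"
    "\<And>z v. R < \<bar>v\<bar> \<Longrightarrow> \<phi> (z, v) = 0 \<and> \<phi>z (z, v) = 0 \<and> \<phi>v (z, v) = 0"
    "\<And>z v. z \<in> {-1..1} \<Longrightarrow> \<bar>\<phi> (z, v)\<bar> \<le> B \<and> \<bar>\<phi>z (z, v)\<bar> \<le> B \<and> \<bar>\<phi>v (z, v)\<bar> \<le> B"
    using kinetic_test_bounded[OF t] by blast
  have C0: "0 \<le> C" and M0: "0 \<le> M" using C[of undefined] M[of undefined] by linarith+
  show ?thesis
  proof (rule Bochner_Integration.integrable_bound)
    show "integrable lborel (\<lambda>p. indicator (cbox (-1::real, -R) (1, R)) p *\<^sub>R (C * (R * B + M * B)))"
      by (rule integrable_indicator_box)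
    show "AE p in lborel. norm (indicator ({-1..1} \<times> UNIV) p * (f p * (snd p * \<phi>z p - E (fst p) * \<phi>v p)))
       \<le> norm (indicat_real (cbox (-1::real, -R) (1, R)) p *\<^sub>R (C * (R * B + M * B)))"
    proof (intro always_eventually allI)
      fix p :: "real \<times> real"
      obtain z v where p: "p = (z, v)" by (cases p)
      show "norm (indicator ({-1..1} \<times> UNIV) p * (f p * (snd p * \<phi>z p - E (fst p) * \<phi>v p)))
       \<le> norm (indicat_real (cbox (-1::real, -R) (1, R)) p *\<^sub>R (C * (R * B + M * B)))"
      proof (cases "z \<in> {-1..1} \<and> \<bar>v\<bar> \<le> R")
        case True
        have "\<bar>v * \<phi>z p - E z * \<phi>v p\<bar> \<le> \<bar>v\<bar> * \<bar>\<phi>z p\<bar> + \<bar>E z\<bar> * \<bar>\<phi>v p\<bar>"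
          by (metis abs_mult abs_triangle_ineq4)
        also have "\<dots> \<le> R * B + M * B"
          using True R(2,4) M M0 R(1) unfolding p by (intro add_mono mult_mono) auto
        finally have "\<bar>f p * (v * \<phi>z p - E z * \<phi>v p)\<bar> \<le> C * (R * B + M * B)"
          unfolding abs_mult using C C0 by (intro mult_mono) auto
        then show ?thesis using True C0 M0 R(1,2) by (auto simp: p indicator_def)
      next
        case False
        then show ?thesis using R(3) by (auto simp: p indicator_def)
      qed
    qed
    have "(\<lambda>p::real \<times> real. E (fst p)) \<in> borel_measurable borel"
      by (rule measurable_compose[OF continuous_fst_borel]) fact
    moreover have "({-1..1} \<times> UNIV :: (real \<times> real) set) \<in> sets borel"
      by (intro borel_Times) auto
    ultimately show "(\<lambda>p. indicat_real ({-1..1} \<times> UNIV) p * (f p * (snd p * \<phi>z p - E (fst p) * \<phi>v p)))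
      \<in> borel_measurable lborel"
      using continuous_snd_borel kinetic_test_measurable[OF t] assms(2)
      by (intro borel_measurable_times borel_measurable_diff borel_measurable_indicator) simp_all
  qed
qed

text \<open>Along w one has w w' = - E, so the integrand is the total derivative of \<phi>(z, w(z)).
  As w is only as regular as \<alpha>, the chain rule is applied to \<Psi>(z, s) = \<phi>(z, W(s)),
  with \<open>W\<close> smooth where the speed stays positive.\<close>

lemma characteristic_integral:
  assumes P: "bounded_primitive M E \<alpha>" and t: "kinetic_test \<phi> \<phi>z \<phi>v"
    and \<sigma>: "\<sigma> = 1 \<or> \<sigma> = -1" and pos: "\<And>z. z \<in> {-1..1} \<Longrightarrow> 2 * (\<alpha> z - e) < u\<^sup>2"
  defines "w \<equiv> \<lambda>z. \<sigma> * sqrt (u\<^sup>2 - 2 * (\<alpha> z - e))"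
  shows "(LINT z:{-1..1}|lborel. \<phi>z (z, w z) - E z / w z * \<phi>v (z, w z)) = \<phi> (1, w 1) - \<phi> (-1, w (-1))"
proof -
  from t have D: "\<And>p. (\<phi> has_derivative (\<lambda>(h, k). h * \<phi>z p + k * \<phi>v p)) (at p)"
    and cz: "continuous_on UNIV \<phi>z" and cv: "continuous_on UNIV \<phi>v"
    by (auto simp: kinetic_test_def)
  define U where "U = {p :: real \<times> real. 2 * (snd p - e) < u\<^sup>2}"
  define W where "W s = \<sigma> * sqrt (u\<^sup>2 - 2 * (s - e))" for s
  have U: "open U" unfolding U_def by (intro open_Collect_less continuous_intros)
  have dW: "(W has_real_derivative - (1 / W s)) (at s)" if "2 * (s - e) < u\<^sup>2" for s
  proof -
    have "((\<lambda>s. sqrt (u\<^sup>2 - 2 * (s - e))) has_real_derivative - (1 / sqrt (u\<^sup>2 - 2 * (s - e)))) (at s)"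
    proof -
      have g: "((\<lambda>s. u\<^sup>2 - 2 * (s - e)) has_real_derivative - 2) (at s)"
        by (auto intro!: derivative_eq_intros)
      have "0 < u\<^sup>2 - 2 * (s - e)" using that by simp
      from DERIV_chain2[OF DERIV_real_sqrt[OF this] g] show ?thesis
        by (simp add: inverse_eq_divide)
    qed
    then have "((\<lambda>s. \<sigma> * sqrt (u\<^sup>2 - 2 * (s - e))) has_real_derivative \<sigma> * - (1 / sqrt (u\<^sup>2 - 2 * (s - e)))) (at s)"
      by (rule DERIV_cmult)
    moreover have "\<sigma> * - (1 / sqrt (u\<^sup>2 - 2 * (s - e))) = - (1 / W s)"
      using \<sigma> by (auto simp: W_def)
    moreover have "W = (\<lambda>s. \<sigma> * sqrt (u\<^sup>2 - 2 * (s - e)))" by (simp add: W_def fun_eq_iff)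
    ultimately show ?thesis by simp
  qed
  have cW: "continuous_on U (\<lambda>p. W (snd p))" unfolding W_def by (intro continuous_intros)
  have d: "((\<lambda>p. \<phi> (fst p, W (snd p))) has_derivative
     (\<lambda>(h, k). h * \<phi>z (fst p, W (snd p)) + k * (- (1 / W (snd p)) * \<phi>v (fst p, W (snd p))))) (at p)"
    if "p \<in> U" for p
  proof -
    have "((\<lambda>p. W (snd p)) has_derivative (\<lambda>h. - (1 / W (snd p)) * snd h)) (at p)"
    proof -
      have "(W has_derivative (\<lambda>h. - (1 / W (snd p)) * h)) (at (snd p))"
        using dW[of "snd p"] that by (simp only: has_field_derivative_def U_def mem_Collect_eq)
      from has_derivative_compose[OF has_derivative_snd[OF has_derivative_ident] this]
      show ?thesis by simp
    qed
    then have "((\<lambda>p. (fst p, W (snd p))) has_derivative (\<lambda>h. (fst h, - (1 / W (snd p)) * snd h))) (at p)"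
      by (intro has_derivative_Pair has_derivative_fst has_derivative_ident)
    from has_derivative_compose[OF this D] show ?thesis
      by (rule back_subst[where P="\<lambda>f. (_ has_derivative f) _"]) (auto simp: algebra_simps)
  qed
  have nz: "W (snd p) \<noteq> 0" if "p \<in> U" for p
    using that \<sigma> by (auto simp: W_def U_def)
  have c1: "continuous_on U (\<lambda>p. \<phi>z (fst p, W (snd p)))"
    by (rule continuous_on_compose2[OF cz]) (auto intro!: continuous_intros cW)
  have c2: "continuous_on U (\<lambda>p. - (1 / W (snd p)) * \<phi>v (fst p, W (snd p)))"
    using nz by (intro continuous_intros cW continuous_on_compose2[OF cv]) auto
  have "(LINT z:{-1..1}|lborel. \<phi>z (z, W (\<alpha> z)) + (- (1 / W (\<alpha> z)) * \<phi>v (z, W (\<alpha> z))) * E z)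
     = \<phi> (1, W (\<alpha> 1)) - \<phi> (-1, W (\<alpha> (-1)))"
    using chain_rule_integral[OF P U d c1 c2] pos by (simp only: U_def mem_Collect_eq fst_conv snd_conv)
  then show ?thesis by (simp add: w_def W_def algebra_simps)
qed

text \<open>In the coordinates (z, u), with u the entrance speed, the measure |v| dz dv becomes u dz
  du and F(u) is constant along trajectories, so the z-integral is that of an exact derivative and
  only its end values remain. By \<open>F0\<close>, speeds charged by \<open>F\<close> meet no
  turning point in the slab.\<close>

lemma beam_weak_form:
  assumes P: "bounded_primitive M E \<alpha>" and \<alpha>[measurable]: "\<alpha> \<in> borel_measurable borel"
    and t: "kinetic_test \<phi> \<phi>z \<phi>v" and \<sigma>: "\<sigma> = 1 \<or> \<sigma> = -1"
    and F[measurable]: "F \<in> borel_measurable borel" and C: "\<And>u. \<bar>F u\<bar> \<le> C"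
    and F0: "\<And>u z. 0 < u \<Longrightarrow> z \<in> {-1..1} \<Longrightarrow> u\<^sup>2 \<le> 2 * (\<alpha> z - e) \<Longrightarrow> F u = 0"
  shows "(LINT p:({-1..1} \<times> UNIV)|lborel. beam \<sigma> e \<alpha> F p * (snd p * \<phi>z p - E (fst p) * \<phi>v p)) =
    (LINT u:{0<..}|lborel. \<sigma> * u * F u *
       (\<phi> (1, \<sigma> * sqrt (u\<^sup>2 - 2 * (\<alpha> 1 - e))) - \<phi> (-1, \<sigma> * sqrt (u\<^sup>2 - 2 * (\<alpha> (-1) - e)))))"
proof -
  have Em[measurable]: "E \<in> borel_measurable borel" and EM: "\<And>x. \<bar>E x\<bar> \<le> M"
    using P by (auto simp: bounded_primitive_def)
  note [measurable] = kinetic_test_measurable[OF t, folded borel_prod]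
  have [measurable]: "({-1..1} \<times> UNIV :: (real \<times> real) set) \<in> sets (borel \<Otimes>\<^sub>M borel)"
    by (intro pair_measureI) auto
  define c where "c z = 2 * (\<alpha> z - e)" for z
  have [measurable]: "c \<in> borel_measurable borel" unfolding c_def by measurable
  define T where "T = (\<lambda>p::real \<times> real. (fst p, \<sigma> * sqrt ((snd p)\<^sup>2 - c (fst p))))"
  define d1 where "d1 = (\<lambda>p::real \<times> real. \<bar>snd p\<bar> * indicat_real {p. 0 < \<sigma> * snd p \<and> 0 < (snd p)\<^sup>2 + c (fst p)} p)"
  define d2 where "d2 = (\<lambda>p::real \<times> real. snd p * indicat_real {p. 0 < snd p \<and> c (fst p) < (snd p)\<^sup>2} p)"
  \<comment> \<open>The integrand with the factor |v| split off, so that \<open>d1\<close> times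
    \<open>G\<close> is \<open>g\<close>; the density \<open>d1\<close> is the one carried by the
    change of variables.\<close>
  define G where "G p = indicat_real ({-1..1} \<times> UNIV) p *
      (F (sqrt ((snd p)\<^sup>2 + c (fst p))) * ((snd p * \<phi>z p - E (fst p) * \<phi>v p) / \<bar>snd p\<bar>))" for p
  define g where "g p = indicat_real ({-1..1} \<times> UNIV) p *
      (beam \<sigma> e \<alpha> F p * (snd p * \<phi>z p - E (fst p) * \<phi>v p))" for p
  have "T \<in> borel \<Otimes>\<^sub>M borel \<rightarrow>\<^sub>M borel \<Otimes>\<^sub>M borel" "d1 \<in> borel_measurable (borel \<Otimes>\<^sub>M borel)"
    "d2 \<in> borel_measurable (borel \<Otimes>\<^sub>M borel)" "G \<in> borel_measurable (borel \<Otimes>\<^sub>M borel)"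
    unfolding T_def d1_def d2_def G_def by measurable
  then have m: "T \<in> borel \<rightarrow>\<^sub>M borel" "d1 \<in> borel_measurable borel"
    "d2 \<in> borel_measurable borel" "G \<in> borel_measurable borel"
    unfolding borel_prod .
  have m': "T \<in> density lborel (\<lambda>p. ennreal (d2 p)) \<rightarrow>\<^sub>M borel" "d1 \<in> borel_measurable lborel"
    "d2 \<in> borel_measurable lborel" "G \<in> borel_measurable lborel" "(\<lambda>p. G (T p)) \<in> borel_measurable lborel"
    using m measurable_compose[OF m(1) m(4)] by simp_all
  have eq: "density lborel (\<lambda>p. ennreal (d1 p)) = distr (density lborel (\<lambda>p. ennreal (d2 p))) borel T"
    unfolding d1_def d2_def T_def by (rule energy_substitution_plane[OF _ \<sigma>]) measurable
  have nn: "0 \<le> d1 p" "0 \<le> d2 p" for p by (auto simp: d1_def d2_def indicator_def)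
  have bC: "\<bar>beam \<sigma> e \<alpha> F p\<bar> \<le> C" for p
    using C[of 0] C by (auto simp: beam_def intro: order_trans[OF abs_ge_zero])
  have gi: "integrable lborel g"
    unfolding g_def by (rule kinetic_test_integrable[OF t beam_measurable[OF \<alpha> F] Em bC EM])
  have gG: "g p = d1 p *\<^sub>R G p" for p
    by (auto simp: g_def G_def d1_def beam_def c_def indicator_def)
  have Gi: "integrable (distr (density lborel (\<lambda>p. ennreal (d2 p))) borel T) G"
    unfolding eq[symmetric] using gi nn m'
    by (subst integrable_density) (auto simp: gG[abs_def])
  then have i2: "integrable lborel (\<lambda>p. d2 p *\<^sub>R G (T p))"
    using m m' nn by (subst (asm) integrable_distr_eq) (auto simp: integrable_density)
  have "integral\<^sup>L lborel g = integral\<^sup>L (density lborel (\<lambda>p. ennreal (d1 p))) G"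
    using nn m' by (subst integral_density) (auto simp: gG[abs_def])
  also have "\<dots> = integral\<^sup>L (density lborel (\<lambda>p. ennreal (d2 p))) (\<lambda>p. G (T p))"
    unfolding eq using m m' by (subst integral_distr) auto
  also have "\<dots> = integral\<^sup>L lborel (\<lambda>p. d2 p *\<^sub>R G (T p))"
    using nn m' by (subst integral_density) auto
  also have "\<dots> = integral\<^sup>L (lborel \<Otimes>\<^sub>M lborel) (\<lambda>(z, u). d2 (z, u) *\<^sub>R G (T (z, u)))"
    by (simp add: lborel_prod case_prod_beta')
  \<comment> \<open>Fubini with z inside: for fixed u the inner integral runs along a single
    trajectory.\<close>
  also have "\<dots> = (\<integral>u. (\<integral>z. d2 (z, u) *\<^sub>R G (T (z, u)) \<partial>lborel) \<partial>lborel)"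
    using i2 by (subst lborel_pair.integral_snd) (simp_all add: lborel_prod case_prod_beta')
  also have "\<dots> = (LINT u:{0<..}|lborel. \<sigma> * u * F u *
       (\<phi> (1, \<sigma> * sqrt (u\<^sup>2 - 2 * (\<alpha> 1 - e))) - \<phi> (-1, \<sigma> * sqrt (u\<^sup>2 - 2 * (\<alpha> (-1) - e)))))"
    unfolding set_lebesgue_integral_def
  proof (rule Bochner_Integration.integral_cong[OF refl])
    fix u :: real
    show "(\<integral>z. d2 (z, u) *\<^sub>R G (T (z, u)) \<partial>lborel) = indicat_real {0<..} u *\<^sub>R (\<sigma> * u * F u *
       (\<phi> (1, \<sigma> * sqrt (u\<^sup>2 - 2 * (\<alpha> 1 - e))) - \<phi> (-1, \<sigma> * sqrt (u\<^sup>2 - 2 * (\<alpha> (-1) - e)))))"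
    proof (cases "0 < u \<and> F u \<noteq> 0")
      case False
      then have "d2 (z, u) *\<^sub>R G (T (z, u)) = 0" for z
        using \<sigma> by (auto simp: d2_def G_def T_def indicator_def power_mult_distrib)
      then have "(\<integral>z. d2 (z, u) *\<^sub>R G (T (z, u)) \<partial>lborel) = 0" by (simp only: integral_zero)
      then show ?thesis using False by (auto simp: indicator_def)
    next
      case True
      have pos: "c z < u\<^sup>2" if "z \<in> {-1..1}" for z
        using F0[of u z] True that by (force simp: c_def not_le[symmetric])
      define w where "w z = \<sigma> * sqrt (u\<^sup>2 - c z)" for z
      have "d2 (z, u) *\<^sub>R G (T (z, u)) =
          (\<sigma> * u * F u) * (indicator {-1..1} z *\<^sub>R (\<phi>z (z, w z) - E z / w z * \<phi>v (z, w z)))" for z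
      proof (cases "z \<in> {-1..1}")
        case False
        then show ?thesis by (simp add: G_def T_def)
      next
        case z: True
        have s: "0 < sqrt (u\<^sup>2 - c z)" using pos[OF z] by simp
        have "d2 (z, u) *\<^sub>R G (T (z, u)) = u * (F u * ((w z * \<phi>z (z, w z) - E z * \<phi>v (z, w z)) / sqrt (u\<^sup>2 - c z)))"
          using True z pos[OF z] \<sigma>
          by (auto simp: d2_def G_def T_def w_def indicator_def power_mult_distrib)
        also have "(w z * \<phi>z (z, w z) - E z * \<phi>v (z, w z)) / sqrt (u\<^sup>2 - c z) =
           \<sigma> * (\<phi>z (z, w z) - E z / w z * \<phi>v (z, w z))"
          using s \<sigma> unfolding w_def by (elim disjE) (simp_all add: field_simps)
        finally show ?thesis using z by simp
      qed
      then have "(\<integral>z. d2 (z, u) *\<^sub>R G (T (z, u)) \<partial>lborel) =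
         (\<sigma> * u * F u) * (LINT z:{-1..1}|lborel. \<phi>z (z, w z) - E z / w z * \<phi>v (z, w z))"
        by (simp add: set_lebesgue_integral_def)
      also have "(LINT z:{-1..1}|lborel. \<phi>z (z, w z) - E z / w z * \<phi>v (z, w z)) = \<phi> (1, w 1) - \<phi> (-1, w (-1))"
        unfolding w_def c_def by (rule characteristic_integral[OF P t \<sigma>]) (use pos in \<open>simp add: c_def\<close>)
      finally show ?thesis using True by (simp add: w_def c_def)
    qed
  qed
  finally show ?thesis
    unfolding g_def by (simp add: set_lebesgue_integral_def)
qed

section \<open>Uniqueness for the linear transport problem\<close>

lemma has_real_derivative_imp_continuous_on:
  assumes "\<And>x. (f has_real_derivative f' x) (at x)"
  shows "continuous_on S f"
  using assms by (meson DERIV_continuous continuous_at_imp_continuous_on)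

text \<open>Squaring makes the positive part C1 across 0; the cutoff, the step and the bumps below
  are all composed from this one function.\<close>

lemma has_real_derivative_max_0_square:
  "((\<lambda>x. (max 0 x)\<^sup>2) has_real_derivative 2 * max 0 x) (at x)" for x :: real
proof -
  consider "x < 0" | "x = 0" | "0 < x" by linarith
  then show ?thesis
  proof cases
    case 1
    have "((\<lambda>x. 0) has_real_derivative 2 * max 0 x) (at x)" using 1 by simp
    then show ?thesis
      by (rule has_field_derivative_transform_within_open[where S="{..<0}"]) (use 1 in auto)
  next
    case 2
    have "((\<lambda>h. ((max 0 h)\<^sup>2 - 0) / h) \<longlongrightarrow> 0) (at (0::real))"
    proof (rule Lim_null_comparison)
      show "\<forall>\<^sub>F h in at (0::real). norm (((max 0 h)\<^sup>2 - 0) / h) \<le> \<bar>h\<bar>"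
        by (intro always_eventually allI) (auto simp: max_def power2_eq_square)
      show "((\<lambda>h. \<bar>h\<bar>) \<longlongrightarrow> 0) (at (0::real))" by (auto intro!: tendsto_eq_intros)
    qed
    then show ?thesis using 2 by (simp add: has_field_derivative_iff)
  next
    case 3
    have "((\<lambda>x. x\<^sup>2) has_real_derivative 2 * max 0 x) (at x)"
      using 3 by (auto intro!: derivative_eq_intros)
    then show ?thesis
      by (rule has_field_derivative_transform_within_open[where S="{0<..}"]) (use 3 in auto)
  qed
qed

text \<open>Test functions live on the whole plane and need bounded support, whereas the weak
  equation sees only the slab. Multiplication by \<eta> confines z to [-2, 2] and leaves all
  integrals over the slab unchanged.\<close>

lemma C1_cutoff:
  obtains \<eta> \<eta>' :: "real \<Rightarrow> real" where "\<And>x. (\<eta> has_real_derivative \<eta>' x) (at x)" "continuous_on UNIV \<eta>'"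
    "\<And>x. x \<in> {-1..1} \<Longrightarrow> \<eta> x = 1 \<and> \<eta>' x = 0" "\<And>x. 2 < \<bar>x\<bar> \<Longrightarrow> \<eta> x = 0"
proof -
  define q where "q x = (max 0 x)\<^sup>2" for x :: real
  define \<eta> where "\<eta> x = q (1 - q (x\<^sup>2 - 1))" for x
  define \<eta>' where "\<eta>' x = 2 * max 0 (1 - q (x\<^sup>2 - 1)) * (0 - 2 * max 0 (x\<^sup>2 - 1) * (2 * x))" for x :: real
  have q: "(q has_real_derivative 2 * max 0 x) (at x)" for x
    unfolding q_def by (rule has_real_derivative_max_0_square)
  have "(\<eta> has_real_derivative \<eta>' x) (at x)" for x
  proof -
    have "((\<lambda>x. x\<^sup>2 - 1) has_real_derivative 2 * x) (at x)" by (auto intro!: derivative_eq_intros)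
    from DERIV_chain2[OF q this] have "((\<lambda>x. 1 - q (x\<^sup>2 - 1)) has_real_derivative 0 - 2 * max 0 (x\<^sup>2 - 1) * (2 * x)) (at x)"
      by (intro DERIV_diff DERIV_const)
    from DERIV_chain2[OF q this] show ?thesis unfolding \<eta>_def \<eta>'_def .
  qed
  moreover have "continuous_on UNIV \<eta>'" unfolding \<eta>'_def q_def by (intro continuous_intros)
  moreover have "\<eta> x = 1 \<and> \<eta>' x = 0" if "x \<in> {-1..1}" for x
  proof -
    have "x\<^sup>2 \<le> 1" using that abs_square_le_1[of x] by auto
    then show ?thesis by (simp add: \<eta>_def \<eta>'_def q_def)
  qed
  moreover have "\<eta> x = 0" if "2 < \<bar>x\<bar>" for x
  proof -
    have "2\<^sup>2 < \<bar>x\<bar>\<^sup>2" using that by (intro power_strict_mono) auto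
    then have x: "4 < x\<^sup>2" by simp
    then have "1\<^sup>2 \<le> (x\<^sup>2 - 1)\<^sup>2" by (intro power_mono) auto
    then show ?thesis using x by (simp add: \<eta>_def q_def)
  qed
  ultimately show thesis by (rule that)
qed

text \<open>A C1 replacement for the indicator of v > 0, used to separate the two directions of
  travel: its derivative lives on [0, \<epsilon>], so it causes no error term where |v| \<ge>
  \<epsilon>. The quotient is well defined because max(0, x) and max(0, \<epsilon> - x) never vanish
  together.\<close>

lemma C1_step:
  fixes \<epsilon> :: real
  assumes "0 < \<epsilon>"
  obtains S S' :: "real \<Rightarrow> real" where "\<And>x. (S has_real_derivative S' x) (at x)" "continuous_on UNIV S'"
    "\<And>x. x \<le> 0 \<Longrightarrow> S x = 0 \<and> S' x = 0" "\<And>x. \<epsilon> \<le> x \<Longrightarrow> S x = 1 \<and> S' x = 0"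
    "\<And>x. \<bar>S x\<bar> \<le> 1"
proof -
  define q where "q x = (max 0 x)\<^sup>2" for x :: real
  define D where "D x = q x + q (\<epsilon> - x)" for x
  define S where "S x = q x / D x" for x
  define S' where "S' x = (2 * max 0 x * D x - q x * (2 * max 0 x + 2 * max 0 (\<epsilon> - x) * (0 - 1))) / (D x * D x)" for x
  have q: "(q has_real_derivative 2 * max 0 x) (at x)" for x
    unfolding q_def by (rule has_real_derivative_max_0_square)
  have Dp: "D x \<noteq> 0" for x
  proof -
    have "0 < q x \<or> 0 < q (\<epsilon> - x)" "0 \<le> q x" "0 \<le> q (\<epsilon> - x)"
      using assms by (auto simp: q_def max_def)
    then show ?thesis unfolding D_def by linarith
  qed
  have D: "(D has_real_derivative 2 * max 0 x + 2 * max 0 (\<epsilon> - x) * (0 - 1)) (at x)" for x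
    unfolding D_def by (intro DERIV_add q DERIV_chain2[OF q] DERIV_diff DERIV_const DERIV_ident)
  have "(S has_real_derivative S' x) (at x)" for x
    unfolding S_def S'_def by (intro DERIV_divide q D Dp)
  moreover have "continuous_on UNIV S'"
    unfolding S'_def using Dp has_real_derivative_imp_continuous_on[OF q] has_real_derivative_imp_continuous_on[OF D]
    by (intro continuous_intros) auto
  moreover have "S x = 0 \<and> S' x = 0" if "x \<le> 0" for x
    using that by (simp add: S_def S'_def q_def)
  moreover have "S x = 1 \<and> S' x = 0" if "\<epsilon> \<le> x" for x
    using that assms Dp[of x] by (simp add: S_def S'_def D_def q_def)
  moreover have "\<bar>S x\<bar> \<le> 1" for x
  proof -
    have "0 \<le> q x" "0 \<le> q (\<epsilon> - x)" by (simp_all add: q_def)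
    then show ?thesis using Dp[of x] by (simp add: S_def D_def)
  qed
  ultimately show thesis by (rule that)
qed

text \<open>For a C1 bump t that is positive exactly on (p, q), the quotient t/(t + 1/(j+1)) tends
  to 1 where t > 0 and is 0 elsewhere.\<close>

lemma C1_indicator_approx:
  fixes p q :: real
  assumes "p < q"
  obtains b b' :: "nat \<Rightarrow> real \<Rightarrow> real" where "\<And>j x. (b j has_real_derivative b' j x) (at x)"
    "\<And>j. continuous_on UNIV (b' j)" "\<And>j x. 0 \<le> b j x \<and> b j x \<le> 1"
    "\<And>j x. x \<notin> {p<..<q} \<Longrightarrow> b j x = 0 \<and> b' j x = 0"
    "\<And>x. (\<lambda>j. b j x) \<longlonglongrightarrow> indicator {p<..<q} x"
proof -
  define e where "e j = 1 / real (Suc j)" for j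
  have e: "0 < e j" for j by (simp add: e_def)
  define t where "t x = (max 0 ((x - p) * (q - x)))\<^sup>2" for x
  define t' where "t' x = 2 * max 0 ((x - p) * (q - x)) * ((1 - 0) * (q - x) + (0 - 1) * (x - p))" for x :: real
  have t0: "0 \<le> t x" for x by (simp add: t_def)
  have tn: "t x + e j \<noteq> 0" for x j using t0[of x] e[of j] by linarith
  have t: "(t has_real_derivative t' x) (at x)" for x
    unfolding t_def t'_def
    by (intro DERIV_chain2[OF has_real_derivative_max_0_square] DERIV_mult DERIV_diff DERIV_const DERIV_ident)
  define b where "b j x = t x / (t x + e j)" for j x
  define b' where "b' j x = (t' x * (t x + e j) - t x * (t' x + 0)) / ((t x + e j) * (t x + e j))" for j x
  have "(b j has_real_derivative b' j x) (at x)" for j x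
    unfolding b_def b'_def by (intro DERIV_divide DERIV_add t tn DERIV_const)
  moreover have ct': "continuous_on UNIV t'" unfolding t'_def by (intro continuous_intros)
  have "continuous_on UNIV (b' j)" for j
    unfolding b'_def using tn by (intro continuous_intros ct' has_real_derivative_imp_continuous_on[OF t]) auto
  moreover have "0 \<le> b j x \<and> b j x \<le> 1" for j x
    using t0[of x] e[of j] by (auto simp: b_def divide_simps)
  moreover have "b j x = 0 \<and> b' j x = 0" if "x \<notin> {p<..<q}" for j x
  proof -
    have "(x - p) * (q - x) \<le> 0" using that assms by (auto simp: mult_le_0_iff)
    then show ?thesis by (simp add: b_def b'_def t_def t'_def)
  qed
  moreover have "(\<lambda>j. b j x) \<longlonglongrightarrow> indicator {p<..<q} x" for x
  proof (cases "x \<in> {p<..<q}")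
    case True
    then have "0 < (x - p) * (q - x)" by simp
    moreover have "x \<noteq> p" "q \<noteq> x" using True by auto
    ultimately have tx: "t x \<noteq> 0" by (simp add: t_def)
    have "e \<longlonglongrightarrow> 0" unfolding e_def by (rule LIMSEQ_Suc[OF lim_1_over_n])
    then have "(\<lambda>j. b j x) \<longlonglongrightarrow> t x / (t x + 0)"
      unfolding b_def using tx by (intro tendsto_intros) auto
    then show ?thesis using True tx by simp
  next
    case False
    then have "b j x = 0" for j using \<open>\<And>j x. x \<notin> {p<..<q} \<Longrightarrow> b j x = 0 \<and> b' j x = 0\<close> by blast
    then show ?thesis using False by simp
  qed
  ultimately show thesis by (rule that)
qed

text \<open>\<open>H\<close> is the energy for a C1 potential \<open>a\<close>. A bound on
  \<open>H\<close> bounds v because \<open>a\<close> is bounded on [-2, 2], whence the bounded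
  support. The two outgoing conditions are not symmetric: the approximating potentials are anchored
  at z = 1 only, so at z = -1 the product of \<open>A\<close> and \<open>S\<close> has to vanish
  whatever the energy.\<close>

lemma energy_kinetic_test:
  assumes a: "\<And>x. (a has_real_derivative Ea x) (at x)" "continuous_on UNIV Ea"
    and A: "\<And>x. (A has_real_derivative A' x) (at x)" "continuous_on UNIV A'"
    and B: "\<And>x. (B has_real_derivative B' x) (at x)" "continuous_on UNIV B'"
    and S: "\<And>x. (S has_real_derivative S' x) (at x)" "continuous_on UNIV S'"
    and AR: "\<And>x. 2 < \<bar>x\<bar> \<Longrightarrow> A x = 0" and BR: "\<And>h. R < h \<Longrightarrow> B h = 0"
    and b1: "\<And>v. 0 < v \<Longrightarrow> A 1 * B (v\<^sup>2 / 2 + a 1) * S v = 0"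
    and b2: "\<And>v. v < 0 \<Longrightarrow> A (-1) * S v = 0"
  defines "H \<equiv> \<lambda>p. (snd p)\<^sup>2 / 2 + a (fst p)"
  shows "kinetic_test (\<lambda>p. A (fst p) * B (H p) * S (snd p))
    (\<lambda>p. A' (fst p) * B (H p) * S (snd p) + A (fst p) * (B' (H p) * Ea (fst p)) * S (snd p))
    (\<lambda>p. A (fst p) * (B' (H p) * snd p) * S (snd p) + A (fst p) * B (H p) * S' (snd p))"
  unfolding kinetic_test_def
proof (intro conjI allI impI)
  fix p :: "real \<times> real"
  have f: "((\<lambda>p. g (fst p)) has_derivative (\<lambda>h. g' * fst h)) (at p)"
    if "(g has_real_derivative g') (at (fst p))" for g g'
    using has_derivative_compose[OF has_derivative_fst[OF has_derivative_ident] that[unfolded has_field_derivative_def]]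
    by simp
  have s: "((\<lambda>p. g (snd p)) has_derivative (\<lambda>h. g' * snd h)) (at p)"
    if "(g has_real_derivative g') (at (snd p))" for g g'
    using has_derivative_compose[OF has_derivative_snd[OF has_derivative_ident] that[unfolded has_field_derivative_def]]
    by simp
  have "((\<lambda>v. v\<^sup>2 / 2) has_real_derivative snd p) (at (snd p))" by (auto intro!: derivative_eq_intros)
  then have H: "(H has_derivative (\<lambda>h. snd p * snd h + Ea (fst p) * fst h)) (at p)"
    unfolding H_def by (intro has_derivative_add s f a)
  have BH: "((\<lambda>p. B (H p)) has_derivative (\<lambda>h. B' (H p) * (snd p * snd h + Ea (fst p) * fst h))) (at p)"
    using has_derivative_compose[OF H B(1)[unfolded has_field_derivative_def]] by simp
  have "((\<lambda>p. A (fst p) * B (H p) * S (snd p)) has_derivative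
     (\<lambda>h. (A (fst p) * B (H p)) * (S' (snd p) * snd h) +
       (A (fst p) * (B' (H p) * (snd p * snd h + Ea (fst p) * fst h)) + (A' (fst p) * fst h) * B (H p)) * S (snd p))) (at p)"
    by (intro has_derivative_mult f s A S BH)
  then show "((\<lambda>p. A (fst p) * B (H p) * S (snd p)) has_derivative
       (\<lambda>(h, k). h * (A' (fst p) * B (H p) * S (snd p) + A (fst p) * (B' (H p) * Ea (fst p)) * S (snd p)) +
         k * (A (fst p) * (B' (H p) * snd p) * S (snd p) + A (fst p) * B (H p) * S' (snd p)))) (at p)"
    by (rule back_subst[where P="\<lambda>f. (_ has_derivative f) _"]) (auto simp: algebra_simps)
next
  have ca: "continuous_on UNIV a" using a(1) by (rule has_real_derivative_imp_continuous_on)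
  have cH: "continuous_on UNIV H"
    unfolding H_def by (intro continuous_intros continuous_on_compose2[OF ca]) auto
  have c: "continuous_on UNIV (\<lambda>p::real \<times> real. g (fst p))" "continuous_on UNIV (\<lambda>p::real \<times> real. g (snd p))"
    "continuous_on UNIV (\<lambda>p::real \<times> real. g (H p))" if "continuous_on UNIV g" for g :: "real \<Rightarrow> real"
    by (rule continuous_on_compose2[OF that]; auto intro!: continuous_intros cH)+
  note cc = has_real_derivative_imp_continuous_on[OF A(1)] has_real_derivative_imp_continuous_on[OF B(1)]
    has_real_derivative_imp_continuous_on[OF S(1)]
  show "continuous_on UNIV (\<lambda>p. A' (fst p) * B (H p) * S (snd p) + A (fst p) * (B' (H p) * Ea (fst p)) * S (snd p))"
    "continuous_on UNIV (\<lambda>p. A (fst p) * (B' (H p) * snd p) * S (snd p) + A (fst p) * B (H p) * S' (snd p))"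
    by (intro continuous_on_add continuous_on_mult c cc a A B S continuous_on_snd continuous_on_id)+
  obtain m where m: "\<And>z. z \<in> {-2..2} \<Longrightarrow> \<bar>a z\<bar> \<le> m"
    using continuous_on_interval_bounded[OF continuous_on_subset[OF ca subset_UNIV]] by blast
  have "p \<in> {-2..2} \<times> {-(2 * (R + m) + 1)..2 * (R + m) + 1}" if "A (fst p) * B (H p) * S (snd p) \<noteq> 0" for p
  proof -
    have z: "fst p \<in> {-2..2}" using AR[of "fst p"] that by force
    have "H p \<le> R" using BR[of "H p"] that by force
    with m[OF z] have v2: "(snd p)\<^sup>2 \<le> 2 * (R + m)" by (simp add: H_def)
    have "\<bar>snd p\<bar> \<le> (snd p)\<^sup>2 + 1"
    proof -
      have "0 \<le> (\<bar>snd p\<bar> - 1)\<^sup>2" by simp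
      then have "2 * \<bar>snd p\<bar> \<le> (snd p)\<^sup>2 + 1" by (simp add: power2_eq_square algebra_simps)
      then show ?thesis by (smt (verit) zero_le_power2)
    qed
    with v2 z show ?thesis by (auto simp: mem_Times_iff)
  qed
  then show "bounded {p. A (fst p) * B (H p) * S (snd p) \<noteq> 0}"
    by (intro bounded_subset[OF bounded_Times[OF bounded_closed_interval bounded_closed_interval]]) blast
  show "A (fst (1, v)) * B (H (1, v)) * S (snd (1, v)) = 0" if "0 < v" for v
    using b1[OF that] by (simp add: H_def)
  show "A (fst (-1, v)) * B (H (-1, v)) * S (snd (-1, v)) = 0" if "v < 0" for v
    using b2[OF that] by auto
qed

section \<open>Vanishing of bounded solutions with zero data\<close>

lemma abs_le_of_half_square_le:
  fixes v r :: real
  assumes "v\<^sup>2 / 2 \<le> r"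
  shows "\<bar>v\<bar> \<le> 2 * r + 1"
proof -
  define y where "y = \<bar>v\<bar>"
  have "0 \<le> (y - 1)\<^sup>2" by simp
  then have "2 * y \<le> y\<^sup>2 + 1" by (simp add: power2_eq_square algebra_simps)
  moreover have "y\<^sup>2 / 2 \<le> r" "0 \<le> y\<^sup>2" using assms by (simp_all add: y_def)
  ultimately have "y \<le> 2 * r + 1" by linarith
  then show ?thesis by (simp add: y_def)
qed

lemma AE_lborel_fst:
  assumes "AE x in (lborel :: real measure). Q x"
  shows "AE p in (lborel :: (real \<times> real) measure). Q (fst p)"
proof -
  obtain N where N: "N \<in> null_sets (lborel :: real measure)" "{x. \<not> Q x} \<subseteq> N"
    using assms by (auto elim!: AE_E3 simp: null_sets_def eventually_ae_filter)
  have "N \<times> UNIV \<in> null_sets (lborel \<Otimes>\<^sub>M (lborel :: real measure))"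
  proof (rule null_setsI)
    show "emeasure (lborel \<Otimes>\<^sub>M lborel) (N \<times> (UNIV :: real set)) = 0"
      using N(1) by (subst lborel.emeasure_pair_measure_Times) (auto simp: null_sets_def)
    show "N \<times> UNIV \<in> sets (lborel \<Otimes>\<^sub>M (lborel :: real measure))"
      using N(1) by (intro pair_measureI) (auto simp: null_sets_def)
  qed
  then have "N \<times> UNIV \<in> null_sets (lborel :: (real \<times> real) measure)" by (simp add: lborel_prod)
  then show ?thesis
    by (rule AE_I') (use N(2) in auto)
qed

text \<open>The test function is \<open>A(z) B(H) S(v)\<close>, for which only the terms without a derivative of \<open>B\<close> survive.
  As \<open>\<alpha>\<close> is merely Lipschitz, it is first replaced by \<open>C\<^sup>1\<close> approximations equal to \<open>\<alpha>\<close> at \<open>z = 1\<close>.\<close>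

lemma energy_test_identity:
  fixes A A' B B' S S' :: "real \<Rightarrow> real"
  assumes P: "bounded_primitive M E \<alpha>" and \<alpha>[measurable]: "\<alpha> \<in> borel_measurable borel"
    and f[measurable]: "f \<in> borel_measurable borel" and C: "\<And>p. \<bar>f p\<bar> \<le> C"
    and hom: "\<And>\<phi> \<phi>z \<phi>v. kinetic_test \<phi> \<phi>z \<phi>v \<Longrightarrow>
      (LINT p:({-1..1} \<times> UNIV)|lborel. f p * (snd p * \<phi>z p - E (fst p) * \<phi>v p)) = 0"
    and A: "\<And>x. (A has_real_derivative A' x) (at x)" "continuous_on UNIV A'"
    and B: "\<And>x. (B has_real_derivative B' x) (at x)" "continuous_on UNIV B'"
    and S: "\<And>x. (S has_real_derivative S' x) (at x)" "continuous_on UNIV S'"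
    and BR: "\<And>h. R < \<bar>h\<bar> \<Longrightarrow> B h = 0 \<and> B' h = 0"
    and b1: "\<And>v. 0 < v \<Longrightarrow> A 1 * B (v\<^sup>2 / 2 + \<alpha> 1) * S v = 0"
    and b2: "\<And>v. v < 0 \<Longrightarrow> A (-1) * S v = 0"
  defines "H \<equiv> \<lambda>p. (snd p)\<^sup>2 / 2 + \<alpha> (fst p)"
  shows "(LINT p:({-1..1} \<times> UNIV)|lborel. f p * (snd p * A' (fst p) * B (H p) * S (snd p)
      - E (fst p) * A (fst p) * B (H p) * S' (snd p))) = 0"
proof -
  have Em[measurable]: "E \<in> borel_measurable borel" and EM: "\<And>x. \<bar>E x\<bar> \<le> M"
    using P by (auto simp: bounded_primitive_def)
  obtain ak Ek where ak: "\<And>k x. (ak k has_real_derivative Ek k x) (at x)"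
    and Ek: "\<And>k. continuous_on UNIV (Ek k)" "\<And>k x. \<bar>Ek k x\<bar> \<le> M"
      "AE x in lborel. (\<lambda>k. Ek k x) \<longlonglongrightarrow> E x"
    and ak1: "\<And>k. ak k 1 = \<alpha> 1" and ul: "uniform_limit {-1..1} ak \<alpha> sequentially"
    using bounded_primitive_approx[OF P] by blast
  obtain \<eta> \<eta>' where \<eta>: "\<And>x. (\<eta> has_real_derivative \<eta>' x) (at x)" "continuous_on UNIV \<eta>'"
    "\<And>x. x \<in> {-1..1} \<Longrightarrow> \<eta> x = 1 \<and> \<eta>' x = 0" "\<And>x. 2 < \<bar>x\<bar> \<Longrightarrow> \<eta> x = 0"
    using C1_cutoff by blast
  note cA = has_real_derivative_imp_continuous_on[OF A(1)]
  note cB = has_real_derivative_imp_continuous_on[OF B(1)]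
  note cS = has_real_derivative_imp_continuous_on[OF S(1)]
  note c\<eta> = has_real_derivative_imp_continuous_on[OF \<eta>(1)]
  have [measurable]: "A \<in> borel_measurable borel" "A' \<in> borel_measurable borel"
    "B \<in> borel_measurable borel" "B' \<in> borel_measurable borel"
    "S \<in> borel_measurable borel" "S' \<in> borel_measurable borel"
    "Ek k \<in> borel_measurable borel" "ak k \<in> borel_measurable borel" for k
    using cA cB cS A(2) B(2) S(2) Ek(1) has_real_derivative_imp_continuous_on[OF ak]
    by (auto intro: borel_measurable_continuous_onI)
  define Hk where "Hk k p = (snd p)\<^sup>2 / 2 + ak k (fst p)" for k and p :: "real \<times> real"
  define I where "I = indicat_real ({-1..1::real} \<times> (UNIV :: real set))"
  \<comment> \<open>When the test function is inserted, the two terms containing B' combine to a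
    multiple of \<open>Ek\<close> - \<open>E\<close>, since the approximate energy is conserved by
    the field \<open>Ek\<close> and not by \<open>E\<close>; this remainder vanishes in the
    limit.\<close>
  define g where "g k p = I p * (f p * (snd p * A' (fst p) * B (Hk k p) * S (snd p)
      + A (fst p) * B' (Hk k p) * (snd p) * S (snd p) * (Ek k (fst p) - E (fst p))
      - E (fst p) * A (fst p) * B (Hk k p) * S' (snd p)))" for k p
  define g0 where "g0 p = I p * (f p * (snd p * A' (fst p) * B (H p) * S (snd p)
      - E (fst p) * A (fst p) * B (H p) * S' (snd p)))" for p
  have g_int: "integral\<^sup>L lborel (g k) = 0" for k
  proof -
    define \<phi> where "\<phi> = (\<lambda>p. (\<eta> (fst p) * A (fst p)) * B (Hk k p) * S (snd p))"
    define \<phi>z where "\<phi>z = (\<lambda>p. (\<eta> (fst p) * A' (fst p) + \<eta>' (fst p) * A (fst p)) * B (Hk k p) * S (snd p)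
       + (\<eta> (fst p) * A (fst p)) * (B' (Hk k p) * Ek k (fst p)) * S (snd p))"
    define \<phi>v where "\<phi>v = (\<lambda>p. (\<eta> (fst p) * A (fst p)) * (B' (Hk k p) * snd p) * S (snd p)
       + (\<eta> (fst p) * A (fst p)) * B (Hk k p) * S' (snd p))"
    have "kinetic_test \<phi> \<phi>z \<phi>v"
      unfolding \<phi>_def \<phi>z_def \<phi>v_def Hk_def
    proof (rule energy_kinetic_test[where R=R])
      show "((\<lambda>x. \<eta> x * A x) has_real_derivative (\<eta> x * A' x + \<eta>' x * A x)) (at x)" for x
        by (rule DERIV_mult'[OF \<eta>(1) A(1)])
      show "continuous_on UNIV (\<lambda>x. \<eta> x * A' x + \<eta>' x * A x)"
        by (intro continuous_intros \<eta> A cA c\<eta>)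
      show "\<eta> x * A x = 0" if "2 < \<bar>x\<bar>" for x using \<eta>(4)[OF that] by simp
      show "B h = 0" if "R < h" for h using BR[of h] that by simp
      show "\<eta> 1 * A 1 * B (v\<^sup>2 / 2 + ak k 1) * S v = 0" if "0 < v" for v
        using b1[OF that] by (auto simp: ak1)
      show "\<eta> (-1) * A (-1) * S v = 0" if "v < 0" for v using b2[OF that] by auto
    qed (rule ak Ek B S)+
    from hom[OF this] have "integral\<^sup>L lborel (\<lambda>p. I p * (f p * (snd p * \<phi>z p - E (fst p) * \<phi>v p))) = 0"
      by (simp add: set_lebesgue_integral_def I_def)
    moreover have "I p * (f p * (snd p * \<phi>z p - E (fst p) * \<phi>v p)) = g k p" for p
      using \<eta>(3)[of "fst p"]
      by (auto simp: I_def g_def \<phi>z_def \<phi>v_def indicator_def mem_Times_iff algebra_simps)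
    ultimately show ?thesis by simp
  qed
  define m where "m = \<bar>\<alpha> 1\<bar> + 2 * M"
  have am: "\<bar>ak k z\<bar> \<le> m" if "z \<in> {-1..1}" for k z
  proof -
    have "norm (ak k z - ak k 1) \<le> M * norm (z - 1)"
      by (rule field_differentiable_bound[of UNIV]) (use ak Ek(2) in \<open>auto intro: has_field_derivative_at_within\<close>)
    also have "\<dots> \<le> M * 2" using that EM[of 0] by (intro mult_left_mono) auto
    finally show ?thesis by (simp add: m_def ak1)
  qed
  \<comment> \<open>Where \<open>B\<close> or \<open>B'\<close> is nonzero the energy is at most
    \<open>R\<close>, so v lies in an interval independent of k; this gives an integrable
    majorant.\<close>
  define V where "V = max 0 (2 * (R + m) + 1)"
  have vV: "\<bar>v\<bar> \<le> V" if "z \<in> {-1..1}" "\<bar>v\<^sup>2 / 2 + ak k z\<bar> \<le> R" for v z k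
  proof -
    have "v\<^sup>2 / 2 \<le> R + m" using am[OF that(1), of k] that(2) by linarith
    then have "\<bar>v\<bar> \<le> 2 * (R + m) + 1" by (rule abs_le_of_half_square_le)
    then show ?thesis by (simp add: V_def)
  qed
  have bd: "\<exists>K. \<forall>x\<in>{a..b}. \<bar>F x\<bar> \<le> K" if cF: "continuous_on UNIV F" for F :: "real \<Rightarrow> real" and a b
  proof -
    obtain K where "\<And>x. x \<in> {a..b} \<Longrightarrow> \<bar>F x\<bar> \<le> K"
      using continuous_on_interval_bounded[OF continuous_on_subset[OF cF subset_UNIV]] by blast
    then show ?thesis by blast
  qed
  obtain K1 where K1: "\<forall>x\<in>{-1..1}. \<bar>A x\<bar> \<le> K1" using bd[OF cA] by blast
  obtain K2 where K2: "\<forall>x\<in>{-1..1}. \<bar>A' x\<bar> \<le> K2" using bd[OF A(2)] by blast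
  obtain K3 where K3: "\<forall>x\<in>{-R..R}. \<bar>B x\<bar> \<le> K3" using bd[OF cB] by blast
  obtain K4 where K4: "\<forall>x\<in>{-R..R}. \<bar>B' x\<bar> \<le> K4" using bd[OF B(2)] by blast
  obtain K5 where K5: "\<forall>x\<in>{-V..V}. \<bar>S x\<bar> \<le> K5" using bd[OF cS] by blast
  obtain K6 where K6: "\<forall>x\<in>{-V..V}. \<bar>S' x\<bar> \<le> K6" using bd[OF S(2)] by blast
  note K = K1 K2 K3 K4 K5 K6
  \<comment> \<open>One constant above all the bounds, so that every product of factors is estimated
    by a power of it.\<close>
  define K where "K = Max {0, C, M, V, K1, K2, K3, K4, K5, K6}"
  have Kge: "0 \<le> K" "C \<le> K" "M \<le> K" "V \<le> K" "K1 \<le> K" "K2 \<le> K" "K3 \<le> K" "K4 \<le> K" "K5 \<le> K" "K6 \<le> K"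
    unfolding K_def by (intro Max_ge; simp)+
  have prod4: "\<bar>x1 * x2 * x3 * x4\<bar> \<le> K * K * K * K"
    if "\<bar>x1\<bar> \<le> K" "\<bar>x2\<bar> \<le> K" "\<bar>x3\<bar> \<le> K" "\<bar>x4\<bar> \<le> K" for x1 x2 x3 x4
    unfolding abs_mult using that Kge(1) by (intro mult_mono) auto
  define L where "L = K * (K * K * K * K + K * K * K * K * (2 * K) + K * K * K * K)"
  have gbound: "norm (g k p) \<le> indicat_real (cbox (-1::real, -V) (1, V)) p *\<^sub>R L" for k p
  proof (cases "fst p \<in> {-1..1} \<and> \<bar>Hk k p\<bar> \<le> R")
    case False
    then have "g k p = 0" using BR[of "Hk k p"] by (auto simp: g_def I_def indicator_def mem_Times_iff)
    then show ?thesis using Kge(1) by (auto simp: L_def indicator_def)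
  next
    case True
    obtain z v where p: "p = (z, v)" by (cases p)
    have z: "z \<in> {-1..1}" and h: "\<bar>v\<^sup>2 / 2 + ak k z\<bar> \<le> R" using True by (auto simp: p Hk_def)
    have v: "\<bar>v\<bar> \<le> V" using vV[OF z h] .
    then have v': "v \<in> {-V..V}" by auto
    have h': "v\<^sup>2 / 2 + ak k z \<in> {-R..R}" 
      using abs_le_D1[OF h] abs_le_D2[OF h] unfolding atLeastAtMost_iff by (intro conjI; linarith)
    define hh where "hh = v\<^sup>2 / 2 + ak k z"
    have b: "\<bar>v\<bar> \<le> K" "\<bar>A z\<bar> \<le> K" "\<bar>A' z\<bar> \<le> K" "\<bar>B hh\<bar> \<le> K" "\<bar>B' hh\<bar> \<le> K"
      "\<bar>S v\<bar> \<le> K" "\<bar>S' v\<bar> \<le> K" "\<bar>E z\<bar> \<le> K" "\<bar>f p\<bar> \<le> K"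
      using K z v v' h' Kge EM[of z] C[of p] unfolding hh_def by (meson order_trans)+
    have e: "\<bar>Ek k z - E z\<bar> \<le> 2 * K" using EM[of z] Ek(2)[of k z] Kge(3) by linarith
    define t1 where "t1 = v * A' z * B hh * S v"
    define t2 where "t2 = A z * B' hh * v * S v * (Ek k z - E z)"
    define t3 where "t3 = E z * A z * B hh * S' v"
    have "\<bar>t1\<bar> \<le> K * K * K * K" "\<bar>t3\<bar> \<le> K * K * K * K" unfolding t1_def t3_def by (intro prod4 b)+
    moreover have "\<bar>t2\<bar> \<le> K * K * K * K * (2 * K)"
      unfolding t2_def abs_mult[of "A z * B' hh * v * S v"]
      using Kge(1) by (intro mult_mono prod4 b e) auto
    ultimately have "\<bar>t1 + t2 - t3\<bar> \<le> K * K * K * K + K * K * K * K * (2 * K) + K * K * K * K" by linarith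
    then have "\<bar>f p * (t1 + t2 - t3)\<bar> \<le> L"
      unfolding L_def abs_mult using b(9) Kge(1) by (intro mult_mono) auto
    moreover have "p \<in> cbox (-1, -V) (1, V)" using z v' by (simp add: p)
    moreover have "g k p = f p * (t1 + t2 - t3)"
      using z by (simp add: g_def I_def p Hk_def t1_def t2_def t3_def hh_def)
    ultimately show ?thesis by simp
  qed
  have meas: "g k \<in> borel_measurable borel" "g0 \<in> borel_measurable borel" for k
  proof -
    have [measurable]: "f \<in> borel_measurable (borel \<Otimes>\<^sub>M borel)" using f by (simp add: borel_prod)
    have [measurable]: "I \<in> borel_measurable (borel \<Otimes>\<^sub>M borel)"
      unfolding I_def by (intro borel_measurable_indicator pair_measureI) auto
    show "g k \<in> borel_measurable borel" "g0 \<in> borel_measurable borel"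
      unfolding g_def g0_def Hk_def H_def borel_prod[symmetric] by measurable
  qed
  have "(\<lambda>k. integral\<^sup>L lborel (g k)) \<longlonglongrightarrow> integral\<^sup>L lborel g0"
  proof (rule integral_dominated_convergence)
    show "integrable lborel (\<lambda>p. indicat_real (cbox (-1::real, -V) (1, V)) p *\<^sub>R L)"
      by (rule integrable_indicator_box)
    show "AE p in lborel. (\<lambda>k. g k p) \<longlonglongrightarrow> g0 p"
      using AE_lborel_fst[OF Ek(3)]
    proof eventually_elim
      case (elim p)
      show ?case
      proof (cases "fst p \<in> {-1..1}")
        case False
        then have "I p = 0" by (auto simp: I_def indicator_def mem_Times_iff)
        then show ?thesis by (simp add: g_def g0_def)
      next
        case True
        have "(\<lambda>k. ak k (fst p)) \<longlonglongrightarrow> \<alpha> (fst p)" using tendsto_uniform_limitI[OF ul True] .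
        then have Hl: "(\<lambda>k. Hk k p) \<longlonglongrightarrow> H p" unfolding Hk_def H_def by (intro tendsto_intros)
        have Bl: "(\<lambda>k. F (Hk k p)) \<longlonglongrightarrow> F (H p)" if "continuous_on UNIV F" for F :: "real \<Rightarrow> real"
          using continuous_on_tendsto_compose[OF that Hl] by simp
        have "(\<lambda>k. g k p) \<longlonglongrightarrow> I p * (f p * (snd p * A' (fst p) * B (H p) * S (snd p)
           + A (fst p) * B' (H p) * (snd p) * S (snd p) * (E (fst p) - E (fst p))
           - E (fst p) * A (fst p) * B (H p) * S' (snd p)))"
          unfolding g_def by (intro tendsto_intros Bl cB B elim)
        then show ?thesis by (simp add: g0_def)
      qed
    qed
    show "AE p in lborel. norm (g k p) \<le> indicat_real (cbox (-1::real, -V) (1, V)) p *\<^sub>R L" for k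
      using gbound by simp
  qed (use meas in simp_all)
  then have "integral\<^sup>L lborel g0 = 0"
    unfolding g_int by (rule LIMSEQ_unique[OF _ tendsto_const, rotated -1, symmetric] | simp add: LIMSEQ_const_iff)+
  then show ?thesis by (simp add: g0_def[abs_def] I_def set_lebesgue_integral_def)
qed

text \<open>\<open>A\<close> is taken as the primitive, vanishing at \<open>e\<close>, of an
  approximate indicator of (p, q), and \<open>B\<close> as an approximate indicator of (h1, h2), so
  the term with A' becomes the box integral. With e = q the function \<open>A\<close> vanishes to
  the right of q, which meets the outgoing condition at z = 1; with e = p it vanishes to the left of
  p, which meets the one at z = -1. The opposite ends are left to \<open>c1\<close> and
  \<open>c2\<close>, and \<open>c3\<close> removes the term with S'.\<close>

lemma energy_box_integral:
  fixes S S' :: "real \<Rightarrow> real"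
  assumes P: "bounded_primitive M E \<alpha>" and \<alpha>[measurable]: "\<alpha> \<in> borel_measurable borel"
    and f[measurable]: "f \<in> borel_measurable borel" and C: "\<And>p. \<bar>f p\<bar> \<le> C"
    and hom: "\<And>\<phi> \<phi>z \<phi>v. kinetic_test \<phi> \<phi>z \<phi>v \<Longrightarrow>
      (LINT p:({-1..1} \<times> UNIV)|lborel. f p * (snd p * \<phi>z p - E (fst p) * \<phi>v p)) = 0"
    and S: "\<And>x. (S has_real_derivative S' x) (at x)" "continuous_on UNIV S'"
    and SK: "\<And>v. \<bar>S v\<bar> \<le> 1"
    and pq: "-1 \<le> p" "p < q" "q \<le> 1" and h12: "h1 < h2" and e: "e = p \<or> e = q"
    and c1: "\<And>v. 0 < v \<Longrightarrow> e = p \<Longrightarrow> v\<^sup>2 / 2 + \<alpha> 1 < h2 \<Longrightarrow> h1 < v\<^sup>2 / 2 + \<alpha> 1 \<Longrightarrow> S v = 0"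
    and c2: "\<And>v. v < 0 \<Longrightarrow> e = q \<Longrightarrow> S v = 0"
    and c3: "\<And>z v. z \<in> {-1..1} \<Longrightarrow> (e = q \<Longrightarrow> z < q) \<Longrightarrow> h1 < v\<^sup>2 / 2 + \<alpha> z \<Longrightarrow> S' v = 0"
  shows "(LINT x:({-1..1} \<times> UNIV)|lborel. f x * (snd x * indicator {p<..<q} (fst x) *
      indicator {h1<..<h2} ((snd x)\<^sup>2 / 2 + \<alpha> (fst x)) * S (snd x))) = 0"
proof -
  define H where "H x = (snd x)\<^sup>2 / 2 + \<alpha> (fst x)" for x :: "real \<times> real"
  obtain b b' where b: "\<And>j x. (b j has_real_derivative b' j x) (at x)" "\<And>j. continuous_on UNIV (b' j)"
    "\<And>j x. 0 \<le> b j x \<and> b j x \<le> (1::real)" "\<And>j x. x \<notin> {p<..<q} \<Longrightarrow> b j x = 0 \<and> b' j x = 0"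
    "\<And>x. (\<lambda>j. b j x) \<longlonglongrightarrow> indicator {p<..<q} x"
    using C1_indicator_approx[OF pq(2)] by blast
  obtain B B' where B: "\<And>j x. (B j has_real_derivative B' j x) (at x)" "\<And>j. continuous_on UNIV (B' j)"
    "\<And>j x. 0 \<le> B j x \<and> B j x \<le> (1::real)" "\<And>j x. x \<notin> {h1<..<h2} \<Longrightarrow> B j x = 0 \<and> B' j x = 0"
    "\<And>x. (\<lambda>j. B j x) \<longlonglongrightarrow> indicator {h1<..<h2} x"
    using C1_indicator_approx[OF h12] by blast
  have cb: "continuous_on UNIV (b j)" and cB: "continuous_on UNIV (B j)" for j
    using has_real_derivative_imp_continuous_on[OF b(1)] has_real_derivative_imp_continuous_on[OF B(1)] by blast+
  have cS: "continuous_on UNIV S" using has_real_derivative_imp_continuous_on[OF S(1)] .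
  obtain G where G: "\<And>j x. (G j has_real_derivative b j x) (at x)"
    using continuous_imp_antiderivative[OF cb] by metis
  define A where "A j x = G j x - G j e" for j x
  have dA: "(A j has_real_derivative b j x) (at x)" for j x
    unfolding A_def by (auto intro!: derivative_eq_intros G)
  have flat: "A j x = A j y" if "x \<le> y" "y \<le> p \<or> q \<le> x" for j x y
  proof (cases "x = y")
    case False
    then have "x < y" using that by simp
    moreover have "(A j has_real_derivative 0) (at t)" if "x < t" "t < y" for t
    proof -
      have "t \<notin> {p<..<q}" using that \<open>y \<le> p \<or> q \<le> x\<close> by auto
      then have "b j t = 0" using b(4) by blast
      then show ?thesis using dA[of j t] by simp
    qed
    ultimately have "A j y = A j x"
      by (intro DERIV_isconst2[where a=x and b=y] has_real_derivative_imp_continuous_on[OF dA]) auto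
    then show ?thesis by simp
  qed simp
  have Ae: "A j e = 0" for j by (simp add: A_def)
  have Aq: "A j x = 0" if "e = q" "q \<le> x" for j x
    using flat[OF that(2), of j] that(1) Ae[of j] by simp
  have Ap: "A j x = 0" if "e = p" "x \<le> p" for j x
    using flat[OF that(2), of j] that(1) Ae[of j] by simp
  define I where "I = indicat_real ({-1..1::real} \<times> (UNIV :: real set))"
  define g where "g j x = I x * (f x * (snd x * b j (fst x) * B j (H x) * S (snd x)))" for j x
  define g0 where "g0 x = I x * (f x * (snd x * indicator {p<..<q} (fst x) * indicator {h1<..<h2} (H x) * S (snd x)))" for x
  have g_int: "integral\<^sup>L lborel (g j) = 0" for j
  proof -
    have "(LINT x:({-1..1} \<times> UNIV)|lborel. f x * (snd x * b j (fst x) * B j ((snd x)\<^sup>2 / 2 + \<alpha> (fst x)) * S (snd x)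
      - E (fst x) * A j (fst x) * B j ((snd x)\<^sup>2 / 2 + \<alpha> (fst x)) * S' (snd x))) = 0"
    proof (rule energy_test_identity[OF P \<alpha> f C hom dA cb B(1,2) S, where R="max \<bar>h1\<bar> \<bar>h2\<bar>"])
      show "B j h = 0 \<and> B' j h = 0" if "max \<bar>h1\<bar> \<bar>h2\<bar> < \<bar>h\<bar>" for h
        by (rule B(4)) (use that in auto)
      show "A j 1 * B j (v\<^sup>2 / 2 + \<alpha> 1) * S v = 0" if "0 < v" for v
      proof (cases "e = p")
        case True
        show ?thesis using c1[OF that True] B(4)[of "v\<^sup>2 / 2 + \<alpha> 1" j] by force
      next
        case False
        then have "A j 1 = 0" using e pq Aq by blast
        then show ?thesis by simp
      qed
      show "A j (-1) * S v = 0" if "v < 0" for v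
        using c2[OF that] Ap[of "-1" j] e pq by auto
    qed
    also have "(LINT x:({-1..1} \<times> UNIV)|lborel. f x * (snd x * b j (fst x) * B j ((snd x)\<^sup>2 / 2 + \<alpha> (fst x)) * S (snd x)
      - E (fst x) * A j (fst x) * B j ((snd x)\<^sup>2 / 2 + \<alpha> (fst x)) * S' (snd x))) = integral\<^sup>L lborel (g j)"
      unfolding set_lebesgue_integral_def
    proof (rule Bochner_Integration.integral_cong[OF refl])
      fix x :: "real \<times> real"
      have "A j (fst x) * B j (H x) * S' (snd x) = 0" if "fst x \<in> {-1..1}"
      proof (cases "(e = q \<longrightarrow> fst x < q) \<and> h1 < H x")
        case True
        then show ?thesis using c3[of "fst x" "snd x"] that by (simp add: H_def)
      next
        case False
        then show ?thesis using Aq[of "fst x" j] B(4)[of "H x" j] by force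
      qed
      then show "indicat_real ({-1..1} \<times> UNIV) x *\<^sub>R (f x * (snd x * b j (fst x) * B j ((snd x)\<^sup>2 / 2 + \<alpha> (fst x)) * S (snd x)
        - E (fst x) * A j (fst x) * B j ((snd x)\<^sup>2 / 2 + \<alpha> (fst x)) * S' (snd x))) = g j x"
        by (auto simp: g_def I_def H_def indicator_def mem_Times_iff)
    qed
    finally show ?thesis by simp
  qed
  have [measurable]: "b j \<in> borel_measurable borel" "B j \<in> borel_measurable borel" "S \<in> borel_measurable borel" for j
    using cb cB cS by (auto intro: borel_measurable_continuous_onI)
  have meas: "g k \<in> borel_measurable borel" "g0 \<in> borel_measurable borel" for k
  proof -
    have [measurable]: "f \<in> borel_measurable (borel \<Otimes>\<^sub>M borel)" using f by (simp add: borel_prod)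
    have [measurable]: "I \<in> borel_measurable (borel \<Otimes>\<^sub>M borel)"
      unfolding I_def by (intro borel_measurable_indicator pair_measureI) auto
    show "g k \<in> borel_measurable borel" "g0 \<in> borel_measurable borel"
      unfolding g_def g0_def H_def borel_prod[symmetric] by measurable
  qed
  define m where "m = \<bar>\<alpha> 1\<bar> + 2 * M"
  have am: "\<bar>\<alpha> z\<bar> \<le> m" if "z \<in> {-1..1}" for z
  proof -
    have "\<bar>\<alpha> z - \<alpha> 1\<bar> \<le> M * \<bar>z - 1\<bar>" using bounded_primitive_lipschitz[OF P, of 1 z] that by simp
    also have "\<dots> \<le> M * 2"
      using that P by (intro mult_left_mono) (auto simp: bounded_primitive_def intro: order_trans[OF abs_ge_zero])
    finally show ?thesis by (simp add: m_def)
  qed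
  define V where "V = max 0 (2 * (h2 + m) + 1)"
  have C0: "0 \<le> C" using C[of undefined] by linarith
  have gbound: "norm (g j x) \<le> indicat_real (cbox (-1::real, -V) (1, V)) x *\<^sub>R (C * V)" for j x
  proof (cases "fst x \<in> {-1..1} \<and> H x < h2")
    case False
    then have "g j x = 0" using B(4)[of "H x" j] by (auto simp: g_def I_def indicator_def mem_Times_iff)
    then show ?thesis using C0 by (auto simp: V_def indicator_def)
  next
    case True
    obtain z v where x: "x = (z, v)" by (cases x)
    have z: "z \<in> {-1..1}" and "v\<^sup>2 / 2 + \<alpha> z < h2" using True by (auto simp: x H_def)
    then have "v\<^sup>2 / 2 \<le> h2 + m" using am[OF z] by linarith
    then have v: "\<bar>v\<bar> \<le> V" using abs_le_of_half_square_le unfolding V_def by fastforce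
    have "\<bar>v * b j z * B j (H x) * S v\<bar> \<le> V * 1 * 1 * 1"
      unfolding abs_mult using b(3)[of j z] B(3)[of j "H x"] SK[of v] v by (intro mult_mono) auto
    then have "\<bar>f x * (v * b j z * B j (H x) * S v)\<bar> \<le> C * V"
      unfolding abs_mult[of "f x"] using C[of x] C0 by (intro mult_mono) auto
    moreover have "x \<in> cbox (-1, -V) (1, V)" using z v by (auto simp: x)
    ultimately show ?thesis using z by (simp add: g_def I_def x)
  qed
  have "(\<lambda>k. integral\<^sup>L lborel (g k)) \<longlonglongrightarrow> integral\<^sup>L lborel g0"
  proof (rule integral_dominated_convergence)
    show "integrable lborel (\<lambda>p. indicat_real (cbox (-1::real, -V) (1, V)) p *\<^sub>R (C * V))"
      by (rule integrable_indicator_box)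
    show "AE x in lborel. (\<lambda>k. g k x) \<longlonglongrightarrow> g0 x"
      unfolding g_def g0_def by (intro always_eventually allI tendsto_intros b B)
    show "AE x in lborel. norm (g k x) \<le> indicat_real (cbox (-1::real, -V) (1, V)) x *\<^sub>R (C * V)" for k
      using gbound by simp
  qed (use meas in simp_all)
  then have "integral\<^sup>L lborel g0 = 0"
    by (simp add: g_int LIMSEQ_const_iff)
  then show ?thesis by (simp add: g0_def[abs_def] I_def H_def set_lebesgue_integral_def)
qed

text \<open>In the coordinates \<open>(z, H)\<close> the open boxes form a \<open>\<pi>\<close>-system, and on \<open>\<sigma> v > 0\<close> these
  coordinates determine \<open>(z, v)\<close>.\<close>

lemma AE_zero_of_energy_boxes:
  fixes \<alpha> :: "real \<Rightarrow> real" and f :: "real \<times> real \<Rightarrow> real"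
  assumes ca: "continuous_on UNIV \<alpha>" and \<sigma>: "\<sigma> = 1 \<or> \<sigma> = -1"
    and f[measurable]: "f \<in> borel_measurable borel" and C: "\<And>p. \<bar>f p\<bar> \<le> C"
    and z0: "z0 \<le> 1"
    and boxes: "\<And>p q h1 h2. -1 \<le> p \<Longrightarrow> p < q \<Longrightarrow> q \<le> z0 \<Longrightarrow> c \<le> h1 \<Longrightarrow> h1 < h2 \<Longrightarrow> h2 \<le> d \<Longrightarrow>
      (LINT x|lborel. f x * (snd x * indicator {p<..<q} (fst x) *
      indicator {h1<..<h2} ((snd x)\<^sup>2 / 2 + \<alpha> (fst x)) * indicator {v. 0 < \<sigma> * v} (snd x))) = 0"
  shows "AE x in lborel. -1 < fst x \<and> fst x < z0 \<and> 0 < \<sigma> * snd x \<and>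
     c < (snd x)\<^sup>2 / 2 + \<alpha> (fst x) \<and> (snd x)\<^sup>2 / 2 + \<alpha> (fst x) < d \<longrightarrow> f x = 0"
proof -
  have [measurable]: "\<alpha> \<in> borel_measurable borel" using ca by (rule borel_measurable_continuous_onI)
  have [measurable]: "f \<in> borel_measurable (borel \<Otimes>\<^sub>M borel)" using f by (simp add: borel_prod)
  define H where "H x = (snd x)\<^sup>2 / 2 + \<alpha> (fst x)" for x :: "real \<times> real"
  define T where "T x = (fst x, H x)" for x
  define D where "D = {x. -1 < fst x \<and> fst x < z0 \<and> 0 < \<sigma> * snd x \<and> c < H x \<and> H x < d}"
  \<comment> \<open>The positive part (s = 1) or negative part (s = -1) of f, weighted by |v| and
    restricted to the region \<open>D\<close>; the goal is that both vanish.\<close>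
  define k where "k s x = max 0 (s * f x) * \<bar>snd x\<bar> * indicat_real D x" for s x
  have [measurable]: "H \<in> borel_measurable (borel \<Otimes>\<^sub>M borel)" unfolding H_def by measurable
  have mD[measurable]: "D \<in> sets (borel \<Otimes>\<^sub>M borel)"
  proof -
    have "{x \<in> space (borel \<Otimes>\<^sub>M borel). -1 < fst x \<and> fst x < z0 \<and> 0 < \<sigma> * snd x \<and> c < H x \<and> H x < d} \<in> sets (borel \<Otimes>\<^sub>M borel)"
      by measurable
    then show ?thesis by (simp add: D_def space_pair_measure)
  qed
  have "k s \<in> borel_measurable (borel \<Otimes>\<^sub>M borel)" "T \<in> borel \<Otimes>\<^sub>M borel \<rightarrow>\<^sub>M borel \<Otimes>\<^sub>M borel" for s
    unfolding k_def T_def by measurable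
  then have mk[measurable]: "k s \<in> borel_measurable borel" and mT[measurable]: "T \<in> borel \<rightarrow>\<^sub>M borel" for s
    unfolding borel_prod by auto
  have C0: "0 \<le> C" using C[of undefined] by linarith
  obtain m where m: "\<And>z. z \<in> {-1..1} \<Longrightarrow> \<bar>\<alpha> z\<bar> \<le> m"
    using continuous_on_interval_bounded[OF continuous_on_subset[OF ca subset_UNIV]] by blast
  define V where "V = max 0 (2 * (d + m) + 1)"
  have kb: "\<bar>k s x\<bar> \<le> indicator (cbox (-1::real, -V) (1, V)) x *\<^sub>R (C * V)" if s: "\<bar>s\<bar> = 1" for s x
  proof (cases "x \<in> D")
    case False
    then show ?thesis using C0 by (auto simp: k_def V_def)
  next
    case True
    obtain z v where x: "x = (z, v)" by (cases x)
    have z: "z \<in> {-1..1}" and "v\<^sup>2 / 2 + \<alpha> z < d" using True z0 by (auto simp: x H_def D_def)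
    then have "v\<^sup>2 / 2 \<le> d + m" using m[OF z] by linarith
    then have v: "\<bar>v\<bar> \<le> V" using abs_le_of_half_square_le unfolding V_def by fastforce
    have "\<bar>max 0 (s * f x)\<bar> \<le> \<bar>s * f x\<bar>" by (simp add: max_def)
    also have "\<dots> \<le> C" using C[of x] s by (simp add: abs_mult)
    finally have "\<bar>max 0 (s * f x) * \<bar>v\<bar>\<bar> \<le> C * V"
      unfolding abs_mult using v C0 by (intro mult_mono) auto
    moreover have "x \<in> cbox (-1, -V) (1, V)" using z v by (auto simp: x)
    ultimately show ?thesis using True by (simp add: k_def x)
  qed
  have ik: "integrable lborel (k s)" if s: "\<bar>s\<bar> = 1" for s
  proof (rule Bochner_Integration.integrable_bound)
    show "integrable lborel (\<lambda>p. indicat_real (cbox (-1::real, -V) (1, V)) p *\<^sub>R (C * V))"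
      by (rule integrable_indicator_box)
    show "AE x in lborel. norm (k s x) \<le> norm (indicat_real (cbox (-1::real, -V) (1, V)) x *\<^sub>R (C * V))"
      using order_trans[OF kb[OF s] abs_ge_self] by simp
  qed simp
  have k0: "0 \<le> k s x" for s x by (simp add: k_def)
  \<comment> \<open>Images of the two parts under (z, v) -> (z, H). The hypothesis
    \<open>boxes\<close> makes them agree on boxes, hence on all Borel sets.\<close>
  define N where "N s = distr (density lborel (\<lambda>x. ennreal (k s x))) borel T" for s
  have N_eq: "emeasure (N s) X = (\<integral>\<^sup>+x. ennreal (k s x * indicator X (T x)) \<partial>lborel)" if X[measurable]: "X \<in> sets borel" for s X
  proof -
    have "T -` X \<in> sets borel" using measurable_sets[OF mT X] by simp
    then have "emeasure (N s) X = (\<integral>\<^sup>+x. ennreal (k s x) * indicator (T -` X) x \<partial>lborel)"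
      by (simp add: N_def emeasure_distr emeasure_density)
    also have "\<dots> = (\<integral>\<^sup>+x. ennreal (k s x * indicator X (T x)) \<partial>lborel)"
      by (intro nn_integral_cong) (auto simp: indicator_def)
    finally show ?thesis .
  qed
  have ikX: "integrable lborel (\<lambda>x. k s x * indicator X (T x))" if "\<bar>s\<bar> = 1" "X \<in> sets borel" for s X
  proof (rule Bochner_Integration.integrable_bound[OF ik[OF that(1)]])
    have [measurable]: "X \<in> sets borel" by fact
    have "(\<lambda>x. indicat_real X (T x)) \<in> borel_measurable borel"
      by (rule measurable_compose[OF mT]) measurable
    then show "(\<lambda>x. k s x * indicator X (T x)) \<in> borel_measurable lborel" by simp
    show "AE x in lborel. norm (k s x * indicat_real X (T x)) \<le> norm (k s x)"
      by (auto simp: indicator_def)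
  qed
  have N_int: "emeasure (N s) X = ennreal (\<integral>x. k s x * indicator X (T x) \<partial>lborel)" if "\<bar>s\<bar> = 1" "X \<in> sets borel" for s X
    unfolding N_eq[OF that(2)] using ikX[OF that] k0 by (intro nn_integral_eq_integral) auto
  have NN: "N 1 = N (-1)"
  proof (rule measure_eqI_generator_eq[where \<Omega>=UNIV and E="range (\<lambda>(a, b). box a b)"])
    show "Int_stable (range (\<lambda>(a, b). box a b :: (real \<times> real) set))"
      by (auto simp: Int_stable_def box_Int_box)
    show "sets (N 1) = sigma_sets UNIV (range (\<lambda>(a, b). box a b))"
      "sets (N (-1)) = sigma_sets UNIV (range (\<lambda>(a, b). box a b))"
      by (simp_all add: N_def borel_eq_box)
    show "range (\<lambda>n::nat. box (- real n, - real n) (real n, real n)) \<subseteq> range (\<lambda>(a, b). box a b)" by auto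
    show "(\<Union>n::nat. box (- real n, - real n) (real n, real n)) = UNIV"
    proof (intro set_eqI iffI UNIV_I)
      fix x :: "real \<times> real"
      obtain n where "max \<bar>fst x\<bar> \<bar>snd x\<bar> < real n" using reals_Archimedean2 by blast
      then show "x \<in> (\<Union>n::nat. box (- real n, - real n) (real n, real n))"
        by (intro UN_I[of n]) (auto simp: box_prod mem_Times_iff abs_less_iff)
    qed
    show "emeasure (N 1) (box (- real n, - real n) (real n, real n)) \<noteq> \<infinity>" for n :: nat
      by (subst N_int) auto
    fix X assume "X \<in> range (\<lambda>(a, b). box a b :: (real \<times> real) set)"
    then obtain a b where X: "X = box a b" by auto
    have Xb: "X \<in> sets borel" by (simp add: X)
    \<comment> \<open>An arbitrary box is clipped to the ranges of z and of the energy in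
      \<open>D\<close>, where \<open>boxes\<close> applies; an empty clip contributes
      nothing.\<close>
    define p q h1 h2 where "p = max (fst a) (-1)" and "q = min (fst b) z0"
      and "h1 = max (snd a) c" and "h2 = min (snd b) d"
    have "(\<integral>x. k 1 x * indicator X (T x) \<partial>lborel) - (\<integral>x. k (-1) x * indicator X (T x) \<partial>lborel)
       = (\<integral>x. k 1 x * indicator X (T x) - k (-1) x * indicator X (T x) \<partial>lborel)"
      using ikX Xb by (intro Bochner_Integration.integral_diff[symmetric]) auto
    also have "\<dots> = (\<integral>x. \<sigma> * (f x * (snd x * indicator {p<..<q} (fst x) *
      indicator {h1<..<h2} (H x) * indicator {v. 0 < \<sigma> * v} (snd x))) \<partial>lborel)"
    proof (rule Bochner_Integration.integral_cong[OF refl])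
      fix x :: "real \<times> real"
      have "k 1 x * indicator X (T x) - k (-1) x * indicator X (T x) = f x * \<bar>snd x\<bar> * (indicator D x * indicator X (T x))"
        by (simp add: k_def max_def left_diff_distrib)
      also have "indicat_real D x * indicat_real X (T x) = indicator {p<..<q} (fst x) *
         indicator {h1<..<h2} (H x) * indicator {v. 0 < \<sigma> * v} (snd x)"
        by (auto simp: D_def X T_def box_prod mem_Times_iff p_def q_def h1_def h2_def indicator_def)
      also have "f x * \<bar>snd x\<bar> * \<dots> = \<sigma> * (f x * (snd x * indicator {p<..<q} (fst x) *
         indicator {h1<..<h2} (H x) * indicator {v. 0 < \<sigma> * v} (snd x)))"
        using \<sigma> by (auto simp: indicator_def)
      finally show "k 1 x * indicator X (T x) - k (-1) x * indicator X (T x) = \<sigma> * (f x * (snd x * indicator {p<..<q} (fst x) *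
         indicator {h1<..<h2} (H x) * indicator {v. 0 < \<sigma> * v} (snd x)))" .
    qed
    also have "\<dots> = 0"
    proof (cases "p < q \<and> h1 < h2")
      case True
      then show ?thesis
        using boxes[of p q h1 h2] by (simp add: p_def q_def h1_def h2_def H_def)
    next
      case False
      then have "{p<..<q} = {} \<or> {h1<..<h2} = {}" by auto
      then show ?thesis by (elim disjE) simp_all
    qed
    finally show "emeasure (N 1) X = emeasure (N (-1)) X"
      using N_int[OF _ Xb] by simp
  qed simp
  have "AE x in lborel. k s x = 0" if s: "s = 1 \<or> s = -1" for s
  proof -
    \<comment> \<open>On \<open>D\<close> the map \<open>T\<close> has the inverse that appears
      here, so on \<open>D\<close> the set where s f > 0 is the preimage of a Borel set
      \<open>W\<close>. The part of sign s has its whole mass there and the other part has none, so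
      equality of the two images forces the mass to be zero.\<close>
    define W where "W = {y. 0 < s * f (fst y, \<sigma> * sqrt (2 * (snd y - \<alpha> (fst y))))}"
    have "{y \<in> space (borel \<Otimes>\<^sub>M borel). 0 < s * f (fst y, \<sigma> * sqrt (2 * (snd y - \<alpha> (fst y))))} \<in> sets (borel \<Otimes>\<^sub>M borel)"
      by measurable
    then have W: "W \<in> sets borel" by (simp add: W_def space_pair_measure borel_prod)
    have TW: "T x \<in> W \<longleftrightarrow> 0 < s * f x" if "x \<in> D" for x
    proof -
      have "\<sigma> * sqrt (2 * (H x - \<alpha> (fst x))) = snd x"
        using that \<sigma> by (auto simp: H_def D_def)
      then show ?thesis by (simp add: W_def T_def)
    qed
    have "(\<integral>\<^sup>+x. ennreal (k s x) \<partial>lborel) = emeasure (N s) W"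
      unfolding N_eq[OF W] using TW by (intro nn_integral_cong) (auto simp: k_def indicator_def max_def)
    also have "\<dots> = emeasure (N (-s)) W" using s NN by auto
    also have "\<dots> = 0"
    proof -
      have "k (-s) x * indicator W (T x) = 0" for x
        using TW[of x] by (auto simp: k_def indicator_def max_def)
      then show ?thesis unfolding N_eq[OF W] by (simp only: ennreal_0 nn_integral_const mult_zero_left)
    qed
    finally have "AE x in lborel. ennreal (k s x) = 0" by (subst (asm) nn_integral_0_iff_AE) auto
    then show ?thesis using k0 by (auto elim!: eventually_mono simp: ennreal_eq_0_iff intro: antisym)
  qed
  from this[of 1] this[of "-1"] have "AE x in lborel. k 1 x = 0" "AE x in lborel. k (-1) x = 0" by auto
  then show ?thesis
  proof eventually_elim
    case (elim x)
    show ?case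
    proof
      assume "-1 < fst x \<and> fst x < z0 \<and> 0 < \<sigma> * snd x \<and>
       c < (snd x)\<^sup>2 / 2 + \<alpha> (fst x) \<and> (snd x)\<^sup>2 / 2 + \<alpha> (fst x) < d"
      then have "x \<in> D" "snd x \<noteq> 0" by (auto simp: D_def H_def)
      with elim have "max 0 (f x) = 0" "max 0 (- f x) = 0" by (auto simp: k_def)
      then show "f x = 0" by linarith
    qed
  qed
qed

text \<open>Each vertical line meets an energy level in at most two points, so levels are null sets
  by Fubini. With \<alpha> = 0 and h = 0 this also disposes of the line v = 0.\<close>

lemma AE_energy_ne:
  fixes \<alpha> :: "real \<Rightarrow> real"
  assumes [measurable]: "\<alpha> \<in> borel_measurable borel"
  shows "AE x in (lborel :: (real \<times> real) measure). (snd x)\<^sup>2 / 2 + \<alpha> (fst x) \<noteq> h"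
proof -
  have "AE x in lborel \<Otimes>\<^sub>M lborel. (snd x)\<^sup>2 / 2 + \<alpha> (fst x) \<noteq> h"
  proof (rule lborel_pair.AE_pair_measure[where P="\<lambda>x. (snd x)\<^sup>2 / 2 + \<alpha> (fst x) \<noteq> h"])
    show "{x \<in> space (lborel \<Otimes>\<^sub>M lborel). (snd x)\<^sup>2 / 2 + \<alpha> (fst x) \<noteq> h} \<in> sets (lborel \<Otimes>\<^sub>M lborel)"
      by measurable
    show "AE z in lborel. AE v in lborel. (snd (z, v))\<^sup>2 / 2 + \<alpha> (fst (z, v)) \<noteq> h"
    proof (rule always_eventually, rule allI)
      fix z
      define r where "r = sqrt (2 * (h - \<alpha> z))"
      have "AE v in lborel. v \<noteq> r" "AE v in lborel. v \<noteq> -r" by (rule AE_lborel_singleton)+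
      then show "AE v in lborel. (snd (z, v))\<^sup>2 / 2 + \<alpha> (fst (z, v)) \<noteq> h"
      proof eventually_elim
        case (elim v)
        show ?case
        proof
          assume "(snd (z, v))\<^sup>2 / 2 + \<alpha> (fst (z, v)) = h"
          then have "v\<^sup>2 = 2 * (h - \<alpha> z)" by simp
          then have "r = \<bar>v\<bar>" by (simp add: r_def flip: real_sqrt_abs)
          with elim show False by (auto simp: abs_if split: if_splits)
        qed
      qed
    qed
  qed
  then show ?thesis unfolding lborel_prod .
qed

text \<open>Each point is traced back to the boundary. Where v > 0 the speed does not decrease
  towards z = -1, since \<alpha> is increasing, so the data at z = -1 decide. Where v < 0 and the
  energy exceeds \<alpha>(1), the particle came from z = 1. Where v < 0 and the energy is smaller,
  it was reflected and had v > 0 before. In weak form, tracing back to an end means letting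
  \<open>A\<close> live between the box and that end.\<close>

lemma homogeneous_transport_zero:
  fixes \<alpha> :: "real \<Rightarrow> real" and f :: "real \<times> real \<Rightarrow> real"
  assumes P: "bounded_primitive M E \<alpha>" and ca: "continuous_on UNIV \<alpha>"
    and mono: "\<And>x y. -1 \<le> x \<Longrightarrow> x \<le> y \<Longrightarrow> y \<le> 1 \<Longrightarrow> \<alpha> x \<le> \<alpha> y"
    and f[measurable]: "f \<in> borel_measurable borel" and C: "\<And>p. \<bar>f p\<bar> \<le> C"
    and hom: "\<And>\<phi> \<phi>z \<phi>v. kinetic_test \<phi> \<phi>z \<phi>v \<Longrightarrow>
      (LINT p:({-1..1} \<times> UNIV)|lborel. f p * (snd p * \<phi>z p - E (fst p) * \<phi>v p)) = 0"
  shows "AE x in lborel. fst x \<in> {-1..1} \<longrightarrow> f x = 0"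
proof -
  have \<alpha>: "\<alpha> \<in> borel_measurable borel" using ca by (rule borel_measurable_continuous_onI)
  define H where "H x = (snd x)\<^sup>2 / 2 + \<alpha> (fst x)" for x :: "real \<times> real"
  \<comment> \<open>A smoothed indicator of \<sigma> v > 0 that is exact once v^2/2 \<ge>
    \<delta>.\<close>
  have step: "\<exists>S S'. (\<forall>x. (S has_real_derivative S' x) (at x)) \<and> continuous_on UNIV S' \<and>
     (\<forall>v. \<bar>S v\<bar> \<le> 1) \<and> (\<forall>v. \<sigma> * v \<le> 0 \<longrightarrow> S v = 0 \<and> S' v = 0) \<and> (\<forall>v. 2 * \<delta> \<le> v\<^sup>2 \<longrightarrow> 0 < \<sigma> * v \<longrightarrow> S v = 1) \<and>
     (\<forall>v. 2 * \<delta> \<le> v\<^sup>2 \<longrightarrow> S' v = 0)"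
    if \<delta>: "0 < \<delta>" and \<sigma>: "\<sigma> = 1 \<or> \<sigma> = -1" for \<delta> \<sigma> :: real
  proof -
    define \<epsilon> where "\<epsilon> = sqrt (2 * \<delta>)"
    have \<epsilon>: "0 < \<epsilon>" using \<delta> by (simp add: \<epsilon>_def)
    obtain S S' :: "real \<Rightarrow> real" where S: "\<And>x. (S has_real_derivative S' x) (at x)" "continuous_on UNIV S'"
      "\<And>x. x \<le> 0 \<Longrightarrow> S x = 0 \<and> S' x = 0" "\<And>x. \<epsilon> \<le> x \<Longrightarrow> S x = 1 \<and> S' x = 0" "\<And>x. \<bar>S x\<bar> \<le> 1"
      using C1_step[OF \<epsilon>] by metis
    have big: "\<epsilon> \<le> \<sigma> * v" if "2 * \<delta> \<le> v\<^sup>2" "0 < \<sigma> * v" for v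
    proof -
      have "\<epsilon> \<le> \<bar>v\<bar>" using that(1) unfolding \<epsilon>_def by (metis real_sqrt_abs real_sqrt_le_iff)
      then show ?thesis using that(2) \<sigma> by auto
    qed
    have "((\<lambda>v. S (\<sigma> * v)) has_real_derivative S' (\<sigma> * v) * \<sigma>) (at v)" for v
      by (rule DERIV_chain2[OF S(1)]) (auto intro!: derivative_eq_intros)
    moreover have "continuous_on UNIV (\<lambda>v. S' (\<sigma> * v) * \<sigma>)"
      by (intro continuous_intros continuous_on_compose2[OF S(2)]) auto
    moreover have "S' (\<sigma> * v) = 0" if "2 * \<delta> \<le> v\<^sup>2" for v
      using S(3)[of "\<sigma> * v"] S(4)[of "\<sigma> * v"] big[OF that] by (cases "0 < \<sigma> * v") auto
    ultimately show ?thesis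
      using S(3,4,5) big
      by (intro exI[of _ "\<lambda>v. S (\<sigma> * v)"] exI[of _ "\<lambda>v. S' (\<sigma> * v) * \<sigma>"]) auto
  qed
  \<comment> \<open>An energy at least \<delta> above \<open>\<alpha> z0\<close> keeps |v| away from
    0 for all z \<le> z0 in the slab, so the smoothed sign is exact on the whole path back. For
    \<sigma> = -1 this path reaches z = 1, hence the restriction to z0 = 1 there.\<close>
  have high: "AE x in lborel. -1 < fst x \<and> fst x < z0 \<and> 0 < \<sigma> * snd x \<and>
      \<alpha> z0 + \<delta> < (snd x)\<^sup>2 / 2 + \<alpha> (fst x) \<and> (snd x)\<^sup>2 / 2 + \<alpha> (fst x) < d \<longrightarrow> f x = 0"
    if \<delta>: "0 < \<delta>" and \<sigma>: "\<sigma> = 1 \<or> \<sigma> = -1 \<and> z0 = 1" and z0: "-1 \<le> z0" "z0 \<le> 1" for \<delta> \<sigma> z0 d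
  proof (rule AE_zero_of_energy_boxes[OF ca _ f C z0(2)])
    show \<sigma>': "\<sigma> = 1 \<or> \<sigma> = -1" using \<sigma> by auto
    fix p q h1 h2 :: real assume pq: "-1 \<le> p" "p < q" "q \<le> z0" and h: "\<alpha> z0 + \<delta> \<le> h1" "h1 < h2" "h2 \<le> d"
    obtain S S' where S: "\<And>x. (S has_real_derivative S' x) (at x)" "continuous_on UNIV S'"
      "\<And>v. \<bar>S v\<bar> \<le> 1" "\<And>v. \<sigma> * v \<le> 0 \<Longrightarrow> S v = 0 \<and> S' v = 0" "\<And>v. 2 * \<delta> \<le> v\<^sup>2 \<Longrightarrow> 0 < \<sigma> * v \<Longrightarrow> S v = 1"
      "\<And>v. 2 * \<delta> \<le> v\<^sup>2 \<Longrightarrow> S' v = 0"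
      using step[OF \<delta> \<sigma>'] by blast
    have vb: "2 * \<delta> \<le> v\<^sup>2" if "h1 < v\<^sup>2 / 2 + \<alpha> z" "-1 \<le> z" "z \<le> z0" for z v
      using mono[of z z0] that z0 h(1) by linarith
    have "(LINT x:({-1..1} \<times> UNIV)|lborel. f x * (snd x * indicator {p<..<q} (fst x) *
      indicator {h1<..<h2} ((snd x)\<^sup>2 / 2 + \<alpha> (fst x)) * S (snd x))) = 0"
    proof (rule energy_box_integral[OF P \<alpha> f C hom S(1,2,3) pq(1,2) _ h(2), where e="if \<sigma> = 1 then q else p"])
      show "S' v = 0" if "z \<in> {-1..1}" "(if \<sigma> = 1 then q else p) = q \<Longrightarrow> z < q" "h1 < v\<^sup>2 / 2 + \<alpha> z" for z v
        using that pq \<sigma> by (intro S(6) vb[of v z]) (auto split: if_splits)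
    qed (use pq z0 \<sigma> S(4) in \<open>auto split: if_splits\<close>)
    also have "(LINT x:({-1..1} \<times> UNIV)|lborel. f x * (snd x * indicator {p<..<q} (fst x) *
      indicator {h1<..<h2} ((snd x)\<^sup>2 / 2 + \<alpha> (fst x)) * S (snd x))) =
      (LINT x|lborel. f x * (snd x * indicator {p<..<q} (fst x) *
      indicator {h1<..<h2} ((snd x)\<^sup>2 / 2 + \<alpha> (fst x)) * indicator {v. 0 < \<sigma> * v} (snd x)))"
      unfolding set_lebesgue_integral_def
    proof (rule Bochner_Integration.integral_cong[OF refl])
      fix x :: "real \<times> real"
      have "S (snd x) = indicator {v. 0 < \<sigma> * v} (snd x)"
        if "fst x \<in> {p<..<q}" "(snd x)\<^sup>2 / 2 + \<alpha> (fst x) \<in> {h1<..<h2}"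
        using S(4)[of "snd x"] S(5)[of "snd x"] vb[of "snd x" "fst x"] that pq by (auto simp: indicator_def)
      then show "indicat_real ({-1..1} \<times> UNIV) x *\<^sub>R (f x * (snd x * indicator {p<..<q} (fst x) *
        indicator {h1<..<h2} ((snd x)\<^sup>2 / 2 + \<alpha> (fst x)) * S (snd x))) =
        f x * (snd x * indicator {p<..<q} (fst x) *
        indicator {h1<..<h2} ((snd x)\<^sup>2 / 2 + \<alpha> (fst x)) * indicator {v. 0 < \<sigma> * v} (snd x))"
        using pq z0 by (auto simp: indicator_def mem_Times_iff)
    qed
    finally show "(LINT x|lborel. f x * (snd x * indicator {p<..<q} (fst x) *
      indicator {h1<..<h2} ((snd x)\<^sup>2 / 2 + \<alpha> (fst x)) * indicator {v. 0 < \<sigma> * v} (snd x))) = 0" .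
  qed
  have pos: "AE x in lborel. fst x \<in> {-1<..<1} \<and> 0 < snd x \<longrightarrow> f x = 0"
  proof -
    have "AE x in lborel. \<forall>z0\<in>\<rat> \<inter> {-1..1}. \<forall>k::nat. \<forall>d::nat. -1 < fst x \<and> fst x < z0 \<and> 0 < 1 * snd x \<and>
        \<alpha> z0 + 1 / real (Suc k) < (snd x)\<^sup>2 / 2 + \<alpha> (fst x) \<and> (snd x)\<^sup>2 / 2 + \<alpha> (fst x) < real d \<longrightarrow> f x = 0"
      by (subst AE_ball_countable, intro countable_Int1 countable_rat, intro ballI, unfold AE_all_countable, intro allI high) simp_all
    then show ?thesis
    proof eventually_elim
      case (elim x)
      show ?case
      proof
        assume x: "fst x \<in> {-1<..<1} \<and> 0 < snd x"
        define z where "z = fst x"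
        define hh where "hh = (snd x)\<^sup>2 / 2 + \<alpha> (fst x)"
        have hz: "\<alpha> z < hh" using x by (simp add: hh_def z_def)
        have "isCont \<alpha> z" using ca by (simp add: continuous_on_eq_continuous_at)
        then have "\<forall>\<^sub>F y in at z. \<alpha> y < hh" using hz by (simp add: isCont_def order_tendstoD)
        then obtain d where d: "d > 0" "\<And>y. y \<noteq> z \<Longrightarrow> dist y z < d \<Longrightarrow> \<alpha> y < hh"
          by (auto simp: eventually_at)
        \<comment> \<open>Only countably many exceptional null sets can be united, hence a rational
          z0. It lies slightly to the right of z, where \<alpha> is still below the energy because v
          > 0 leaves a gap at z.\<close>
        obtain z0 where z0: "z0 \<in> \<rat>" "z < z0" "z0 < min 1 (z + d)"
          using Rats_dense_in_real[of z "min 1 (z + d)"] x d(1) by (auto simp: z_def)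
        then have a0: "\<alpha> z0 < hh" by (intro d(2)) (auto simp: dist_real_def)
        obtain k where k: "inverse (real (Suc k)) < hh - \<alpha> z0" using reals_Archimedean[of "hh - \<alpha> z0"] a0 by auto
        obtain N where N: "hh < real N" using reals_Archimedean2 by blast
        have "-1 < z" using x by (simp add: z_def)
        then show "f x = 0"
          using elim[rule_format, of z0 k N] z0 x k N unfolding hh_def z_def by (simp add: inverse_eq_divide)
      qed
    qed
  qed
  have neg_high: "AE x in lborel. fst x \<in> {-1<..<1} \<and> snd x < 0 \<and> \<alpha> 1 < H x \<longrightarrow> f x = 0"
  proof -
    have "AE x in lborel. \<forall>k::nat. \<forall>d::nat. -1 < fst x \<and> fst x < 1 \<and> 0 < -1 * snd x \<and>
        \<alpha> 1 + 1 / real (Suc k) < (snd x)\<^sup>2 / 2 + \<alpha> (fst x) \<and> (snd x)\<^sup>2 / 2 + \<alpha> (fst x) < real d \<longrightarrow> f x = 0"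
      unfolding AE_all_countable by (intro allI high) simp_all
    then show ?thesis
    proof eventually_elim
      case (elim x)
      show ?case
      proof
        assume x: "fst x \<in> {-1<..<1} \<and> snd x < 0 \<and> \<alpha> 1 < H x"
        obtain k where k: "inverse (real (Suc k)) < H x - \<alpha> 1" using reals_Archimedean[of "H x - \<alpha> 1"] x by auto
        obtain N where N: "H x < real N" using reals_Archimedean2 by blast
        show "f x = 0"
          using elim[rule_format, of k N] x k N unfolding H_def by (simp add: inverse_eq_divide)
      qed
    qed
  qed
  \<comment> \<open>Characteristics of energy below \<open>\<alpha> 1\<close> turn around inside the slab: here \<open>S = 1\<close>, and the contribution
    of \<open>v > 0\<close> vanishes by \<open>pos\<close>.\<close>
  have neg_low: "AE x in lborel. fst x \<in> {-1<..<1} \<and> snd x < 0 \<and> H x < \<alpha> 1 \<longrightarrow> f x = 0"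
  proof -
    have "AE x in lborel. -1 < fst x \<and> fst x < 1 \<and> 0 < -1 * snd x \<and>
        c < (snd x)\<^sup>2 / 2 + \<alpha> (fst x) \<and> (snd x)\<^sup>2 / 2 + \<alpha> (fst x) < \<alpha> 1 \<longrightarrow> f x = 0" for c
    proof (rule AE_zero_of_energy_boxes[OF ca _ f C order_refl])
      show "-1 = (1::real) \<or> -1 = (-1::real)" by simp
      fix p q h1 h2 :: real assume pq: "-1 \<le> p" "p < q" "q \<le> 1" and h: "c \<le> h1" "h1 < h2" "h2 \<le> \<alpha> 1"
      have "(LINT x:({-1..1} \<times> UNIV)|lborel. f x * (snd x * indicator {p<..<q} (fst x) *
        indicator {h1<..<h2} ((snd x)\<^sup>2 / 2 + \<alpha> (fst x)) * (\<lambda>_. 1) (snd x))) = 0"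
      proof (rule energy_box_integral[OF P \<alpha> f C hom _ _ _ pq h(2), where e=p and S'="\<lambda>_. 0"])
        show "(1::real) = 0" if "v\<^sup>2 / 2 + \<alpha> 1 < h2" for v
          using that h(3) zero_le_power2[of v] by linarith
      qed (use pq in auto)
      also have "(LINT x:({-1..1} \<times> UNIV)|lborel. f x * (snd x * indicator {p<..<q} (fst x) *
        indicator {h1<..<h2} ((snd x)\<^sup>2 / 2 + \<alpha> (fst x)) * (\<lambda>_. 1) (snd x))) =
        (LINT x|lborel. f x * (snd x * indicator {p<..<q} (fst x) *
        indicator {h1<..<h2} ((snd x)\<^sup>2 / 2 + \<alpha> (fst x)) * indicator {v. 0 < -1 * v} (snd x)))"
        unfolding set_lebesgue_integral_def
      proof (rule Bochner_Integration.integral_cong_AE)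
        have [measurable]: "f \<in> borel_measurable (borel \<Otimes>\<^sub>M borel)" using f by (simp add: borel_prod)
        have [measurable]: "indicat_real ({-1..1::real} \<times> (UNIV :: real set)) \<in> borel_measurable (borel \<Otimes>\<^sub>M borel)"
          by (intro borel_measurable_indicator pair_measureI) auto
        note [measurable] = \<alpha>
        show "(\<lambda>x. indicat_real ({-1..1} \<times> UNIV) x *\<^sub>R (f x * (snd x * indicator {p<..<q} (fst x) *
          indicator {h1<..<h2} ((snd x)\<^sup>2 / 2 + \<alpha> (fst x)) * (\<lambda>_. 1) (snd x)))) \<in> borel_measurable lborel"
          "(\<lambda>x. f x * (snd x * indicator {p<..<q} (fst x) *
          indicator {h1<..<h2} ((snd x)\<^sup>2 / 2 + \<alpha> (fst x)) * indicator {v. 0 < -1 * v} (snd x))) \<in> borel_measurable lborel"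
          unfolding measurable_lborel2 borel_prod[symmetric] by measurable
        show "AE x in lborel. indicat_real ({-1..1} \<times> UNIV) x *\<^sub>R (f x * (snd x * indicator {p<..<q} (fst x) *
          indicator {h1<..<h2} ((snd x)\<^sup>2 / 2 + \<alpha> (fst x)) * (\<lambda>_. 1) (snd x))) =
          f x * (snd x * indicator {p<..<q} (fst x) *
          indicator {h1<..<h2} ((snd x)\<^sup>2 / 2 + \<alpha> (fst x)) * indicator {v. 0 < -1 * v} (snd x))"
          using pos
        proof eventually_elim
          case (elim x)
          then show ?case using pq by (cases "snd x" "0::real" rule: linorder_cases) (auto simp: indicator_def mem_Times_iff)
        qed
      qed
      finally show "(LINT x|lborel. f x * (snd x * indicator {p<..<q} (fst x) *
        indicator {h1<..<h2} ((snd x)\<^sup>2 / 2 + \<alpha> (fst x)) * indicator {v. 0 < -1 * v} (snd x))) = 0" .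
    qed
    then have "AE x in lborel. \<forall>c::nat. -1 < fst x \<and> fst x < 1 \<and> 0 < -1 * snd x \<and>
        - real c < (snd x)\<^sup>2 / 2 + \<alpha> (fst x) \<and> (snd x)\<^sup>2 / 2 + \<alpha> (fst x) < \<alpha> 1 \<longrightarrow> f x = 0"
      unfolding AE_all_countable by (intro allI) simp
    then show ?thesis
    proof eventually_elim
      case (elim x)
      show ?case
      proof
        assume x: "fst x \<in> {-1<..<1} \<and> snd x < 0 \<and> H x < \<alpha> 1"
        obtain N where N: "- H x < real N" using reals_Archimedean2 by blast
        show "f x = 0"
          using elim[rule_format, of N] x N unfolding H_def by simp
      qed
    qed
  qed
  have "AE z in lborel. z \<noteq> (-1::real)" "AE z in lborel. z \<noteq> (1::real)"
    by (rule AE_lborel_singleton)+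
  note ends = this[THEN AE_lborel_fst]
  have "AE x in (lborel :: (real \<times> real) measure). snd x \<noteq> 0"
    using AE_energy_ne[of "\<lambda>_. 0" 0] by simp
  with pos neg_high neg_low ends AE_energy_ne[OF \<alpha>, of "\<alpha> 1"] show ?thesis
  proof eventually_elim
    case (elim x)
    then show ?case
      by (cases "snd x" "0::real" rule: linorder_cases; cases "H x" "\<alpha> 1" rule: linorder_cases) (auto simp: H_def)
  qed
qed

section \<open>Representatives, weak derivatives and Lipschitz functions\<close>

lemma AE_restrict_lborel:
  assumes "A \<in> sets borel"
  shows "(AE x in restrict_space lborel A. P x) \<longleftrightarrow> (AE x in lborel. x \<in> A \<longrightarrow> P x)"
  using assms by (simp add: AE_restrict_space_iff)

text \<open>Elements of L-infinity are only measurable on A and bounded almost everywhere, while the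
  preceding analysis concerns Borel functions on the whole space with a bound everywhere. Resetting
  to 0 the values outside A and those beyond the essential supremum achieves both and keeps
  nonnegativity.\<close>

lemma Linf_representative:
  fixes A :: "'a::euclidean_space set"
  assumes A[measurable]: "A \<in> sets borel" and g: "Linf (restrict_space lborel A) g"
  obtains g0 M where "g0 \<in> borel_measurable borel" "0 \<le> M" "\<And>x. \<bar>g0 x\<bar> \<le> M"
    "AE x in lborel. x \<in> A \<longrightarrow> g x = g0 x" "\<And>x. x \<notin> A \<Longrightarrow> g0 x = 0" "M = max 0 (Linf_norm (restrict_space lborel A) g)"
    "\<And>x. (x \<in> A \<Longrightarrow> 0 \<le> g x) \<Longrightarrow> 0 \<le> g0 x"
proof -
  let ?N = "esssup (restrict_space lborel A) (\<lambda>x. ereal \<bar>g x\<bar>)"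
  define M where "M = max 0 (Linf_norm (restrict_space lborel A) g)"
  define g0 where "g0 x = (if x \<in> A \<and> \<bar>g x\<bar> \<le> M then g x else 0)" for x
  have gm: "g \<in> borel_measurable (restrict_space lborel A)" and fin: "?N < \<infinity>"
    using g by (auto simp: Linf_def)
  have gA: "(\<lambda>x. indicator A x * g x) \<in> borel_measurable borel"
    using gm by (subst (asm) borel_measurable_restrict_space_iff) auto
  have "g0 = (\<lambda>x. if \<bar>indicator A x * g x\<bar> \<le> M then indicator A x * g x else 0)"
    by (auto simp: g0_def indicator_def)
  also have "\<dots> \<in> borel_measurable borel" using gA by measurable
  finally have m: "g0 \<in> borel_measurable borel" .
  have "AE x in restrict_space lborel A. ereal \<bar>g x\<bar> \<le> ?N" by (rule esssup_AE)
  then have "AE x in restrict_space lborel A. \<bar>g x\<bar> \<le> M"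
  proof eventually_elim
    case (elim x)
    then have "?N \<noteq> -\<infinity>" by auto
    with fin have "?N = ereal (real_of_ereal ?N)" by (cases ?N) auto
    with elim have "\<bar>g x\<bar> \<le> real_of_ereal ?N" by (metis ereal_less_eq(3))
    then show ?case by (simp add: M_def Linf_norm_def)
  qed
  then have "AE x in lborel. x \<in> A \<longrightarrow> \<bar>g x\<bar> \<le> M" by (simp add: AE_restrict_lborel A)
  then have "AE x in lborel. x \<in> A \<longrightarrow> g x = g0 x"
    by eventually_elim (auto simp: g0_def)
  with m show thesis by (intro that[of g0 M]) (auto simp: g0_def M_def)
qed

lemma Linf_bounded:
  assumes "g \<in> borel_measurable borel" "\<And>x. x \<in> A \<Longrightarrow> \<bar>g x\<bar> \<le> M" "A \<in> sets borel"
  shows "Linf (restrict_space lborel A) g"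
proof -
  have "g \<in> borel_measurable (restrict_space lborel A)"
    using assms(1) by (intro measurable_restrict_space1) simp
  moreover have "esssup (restrict_space lborel A) (\<lambda>x. ereal \<bar>g x\<bar>) \<le> ereal M"
    using assms calculation by (intro esssup_I) (auto simp: AE_restrict_lborel)
  ultimately show ?thesis by (auto simp: Linf_def intro: le_less_trans)
qed

text \<open>Local integrability gives measurability on each compact subinterval, and these exhaust
  the open interval.\<close>

lemma locally_integrable_on_measurable:
  assumes "locally_integrable_on {-1<..<1} u"
  shows "(\<lambda>x. indicator {-1<..<1} x * u x) \<in> borel_measurable borel"
proof (rule borel_measurable_LIMSEQ_real)
  define e where "e k = 1 / real (Suc k)" for k
  define K where "K k = {-1 + e k..1 - e k}" for k
  have e: "0 < e k" for k by (simp add: e_def)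
  have KS: "K k \<subseteq> {-1<..<1}" for k using e[of k] by (auto simp: K_def)
  show "(\<lambda>x. indicator (K k) x * u x) \<in> borel_measurable borel" for k
  proof -
    have "compact (K k)" by (simp add: K_def)
    then have "set_integrable lborel (K k) u"
      using assms KS unfolding locally_integrable_on_def by blast
    then have "(\<lambda>x. indicator (K k) x *\<^sub>R u x) \<in> borel_measurable lborel"
      unfolding set_integrable_def by (rule borel_measurable_integrable)
    then show ?thesis by simp
  qed
  show "(\<lambda>k. indicator (K k) x * u x) \<longlonglongrightarrow> indicator {-1<..<1} x * u x" for x
  proof (cases "x \<in> {-1<..<1}")
    case True
    then have "0 < 1 - \<bar>x\<bar>" by auto
    then obtain k0 where k0: "inverse (real (Suc k0)) < 1 - \<bar>x\<bar>" using reals_Archimedean by blast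
    have "x \<in> K k" if "k \<ge> k0" for k
    proof -
      have "e k \<le> inverse (real (Suc k0))" using that by (simp add: field_simps e_def)
      then have "\<bar>x\<bar> < 1 - e k" using k0 by linarith
      then show ?thesis by (simp add: K_def abs_less_iff)
    qed
    then have "\<forall>\<^sub>F k in sequentially. indicator (K k) x * u x = indicator {-1<..<1} x * u x"
      using True by (auto simp: eventually_sequentially intro!: exI[of _ k0])
    then show ?thesis by (rule tendsto_eventually)
  next
    case False
    then have "x \<notin> K k" for k using KS by blast
    then have "indicator (K k) x = (0::real)" for k by simp
    then show ?thesis using False by simp
  qed
qed

lemma weak_deriv_cong:
  assumes wd: "weak_deriv {-1<..<1} u g"
    and u: "AE x in lborel. x \<in> {-1<..<1} \<longrightarrow> u x = u' x" and g: "AE x in lborel. x \<in> {-1<..<1} \<longrightarrow> g x = g' x"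
    and [measurable]: "u' \<in> borel_measurable borel" "g' \<in> borel_measurable borel"
  shows "weak_deriv {-1<..<1} u' g'"
proof -
  have loc: "locally_integrable_on {-1<..<1} w'"
    if l: "locally_integrable_on {-1<..<1} w" and [measurable]: "w' \<in> borel_measurable borel"
      and ae: "AE x in lborel. x \<in> {-1<..<1} \<longrightarrow> w x = w' x" for w w' :: "real \<Rightarrow> real"
    unfolding locally_integrable_on_def
  proof (intro allI impI)
    fix K :: "real set" assume K: "compact K \<and> K \<subseteq> {-1<..<1}"
    then have [measurable]: "K \<in> sets borel" by (auto intro: borel_compact)
    have i: "integrable lborel (\<lambda>x. indicator K x *\<^sub>R w x)"
      using l K by (auto simp: locally_integrable_on_def set_integrable_def)
    have "AE x in lborel. indicator K x *\<^sub>R w x = indicator K x *\<^sub>R w' x"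
      using ae by eventually_elim (use K in \<open>auto simp: indicator_def\<close>)
    with i show "set_integrable lborel K w'"
      unfolding set_integrable_def
      by (subst integrable_cong_AE[symmetric, OF borel_measurable_integrable[OF i]]) auto
  qed
  have int: "(LINT x:{-1<..<1}|lborel. w x * \<phi> x) = (LINT x:{-1<..<1}|lborel. w' x * \<phi> x)"
    if l: "locally_integrable_on {-1<..<1} w" and [measurable]: "w' \<in> borel_measurable borel" "\<phi> \<in> borel_measurable borel"
      and ae: "AE x in lborel. x \<in> {-1<..<1} \<longrightarrow> w x = w' x" for w w' \<phi> :: "real \<Rightarrow> real"
  proof -
    have "(\<lambda>x. (indicator {-1<..<1} x * w x) * \<phi> x) \<in> borel_measurable borel"
      using locally_integrable_on_measurable[OF l] by measurable
    then have m: "(\<lambda>x. indicator {-1<..<1} x *\<^sub>R (w x * \<phi> x)) \<in> borel_measurable lborel"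
      by (simp add: mult.assoc)
    show ?thesis
      unfolding set_lebesgue_integral_def
      by (rule Bochner_Integration.integral_cong_AE[OF m]) (use ae in \<open>auto elim!: eventually_mono simp: indicator_def\<close>)
  qed
  have lu: "locally_integrable_on {-1<..<1} u" and lg: "locally_integrable_on {-1<..<1} g"
    using wd by (auto simp: weak_deriv_def)
  show ?thesis
    unfolding weak_deriv_def
  proof (intro conjI allI impI)
    show "locally_integrable_on {-1<..<1} u'" by (rule loc[OF lu _ u]) measurable
    show "locally_integrable_on {-1<..<1} g'" by (rule loc[OF lg _ g]) measurable
    fix \<phi> assume \<phi>: "C1_test {-1<..<1} \<phi>"
    then obtain D where D: "\<And>x. (\<phi> has_vector_derivative D x) (at x)" "continuous_on UNIV D"
      by (auto simp: C1_test_def C1_differentiable_on_def)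
    then have r: "(\<phi> has_real_derivative D x) (at x)" for x
      by (simp add: has_real_derivative_iff_has_vector_derivative)
    then have "deriv \<phi> = D" by (intro ext DERIV_imp_deriv)
    then have m: "deriv \<phi> \<in> borel_measurable borel" "\<phi> \<in> borel_measurable borel"
      using D(2) has_real_derivative_imp_continuous_on[OF r] by (auto intro: borel_measurable_continuous_onI)
    have "(LINT x:{-1<..<1}|lborel. u x * deriv \<phi> x) = - (LINT x:{-1<..<1}|lborel. g x * \<phi> x)"
      using wd \<phi> unfolding weak_deriv_def by blast
    then show "(LINT x:{-1<..<1}|lborel. u' x * deriv \<phi> x) = - (LINT x:{-1<..<1}|lborel. g' x * \<phi> x)"
      using int[OF lu _ m(1) u] int[OF lg _ m(2) g] by simp
  qed
qed

text \<open>Absolute continuity through Radon-Nikodym: \<alpha> and C z - \<alpha> are both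
  nondecreasing, and their Stieltjes measures add up to C times Lebesgue measure on (-1, 1]. Each is
  therefore absolutely continuous, and the density of the first lies between 0 and C.\<close>

lemma mono_lipschitz_imp_bounded_primitive:
  assumes \<alpha>: "\<And>x y. -1 \<le> x \<Longrightarrow> x \<le> y \<Longrightarrow> y \<le> 1 \<Longrightarrow> 0 \<le> \<alpha> y - \<alpha> x \<and> \<alpha> y - \<alpha> x \<le> C * (y - x)"
  shows "\<exists>E. bounded_primitive C E \<alpha> \<and> (\<forall>x. 0 \<le> E x)"
proof -
  have C0: "0 \<le> C" using \<alpha>[of "-1" 1] by auto
  define cl where "cl x = max (-1) (min 1 x)" for x :: real
  define a1 where "a1 x = \<alpha> (cl x)" for x
  define a2 where "a2 x = C * cl x - \<alpha> (cl x)" for x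
  have cl: "-1 \<le> cl x" "cl x \<le> 1" "x \<le> y \<Longrightarrow> cl x \<le> cl y" "x \<le> y \<Longrightarrow> cl y - cl x \<le> y - x" for x y
    by (auto simp: cl_def)
  have m1: "a1 x \<le> a1 y" and m2: "a2 x \<le> a2 y" if "x \<le> y" for x y
    using \<alpha>[OF cl(1) cl(3)[OF that] cl(2)] by (auto simp: a1_def a2_def algebra_simps)
  have l1: "a1 y - a1 x \<le> C * (y - x)" and l2: "a2 y - a2 x \<le> C * (y - x)" if "x \<le> y" for x y
    using \<alpha>[OF cl(1) cl(3)[OF that] cl(2)] mult_left_mono[OF cl(4)[OF that] C0]
    by (auto simp: a1_def a2_def algebra_simps)
  have cont: "continuous (at_right a) F" if "\<And>x y. x \<le> y \<Longrightarrow> F x \<le> F y" "\<And>x y. x \<le> y \<Longrightarrow> F y - F x \<le> C * (y - x)" for F a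
  proof -
    have "continuous_on UNIV F" by (rule mono_slope_imp_continuous_on[OF C0]) (use that in auto)
    then have "isCont F a" by (simp add: continuous_on_eq_continuous_at)
    then show ?thesis by (rule continuous_at_imp_continuous_at_within)
  qed
  define N1 where "N1 = interval_measure a1"
  define N2 where "N2 = interval_measure a2"
  have e1: "emeasure N1 {a<..b} = ennreal (a1 b - a1 a)" and e2: "emeasure N2 {a<..b} = ennreal (a2 b - a2 a)" if "a \<le> b" for a b
    unfolding N1_def N2_def using that m1 m2 cont[OF m1 l1] cont[OF m2 l2]
    by (auto intro!: emeasure_interval_measure_Ioc)
  have s: "sets N1 = sets borel" "sets N2 = sets borel" by (simp_all add: N1_def N2_def)
  define N where "N = measure_of UNIV (sets borel) (\<lambda>A. emeasure N1 A + emeasure N2 A)"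
  have sN: "sets N = sets borel"
    unfolding N_def using sets.sigma_sets_eq[of "borel :: real measure"] by (simp add: sets_measure_of)
  have N: "emeasure N A = emeasure N1 A + emeasure N2 A" if "A \<in> sets borel" for A
  proof (rule emeasure_measure_of[OF N_def])
    show "positive (sets N) (\<lambda>A. emeasure N1 A + emeasure N2 A)" by (simp add: positive_def)
    show "countably_additive (sets N) (\<lambda>A. emeasure N1 A + emeasure N2 A)"
    proof (rule countably_additiveI)
      fix A :: "nat \<Rightarrow> real set" assume A: "range A \<subseteq> sets N" "disjoint_family A"
      then show "(\<Sum>i. emeasure N1 (A i) + emeasure N2 (A i)) = emeasure N1 (\<Union> (range A)) + emeasure N2 (\<Union> (range A))"
        using suminf_emeasure[of A N1] suminf_emeasure[of A N2] by (simp add: suminf_add[symmetric] s sN)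
    qed
  qed (use that sN in auto)
  define L where "L = density lborel (\<lambda>x. ennreal C * indicator {-1<..1::real} x)"
  have NL: "N = L"
  proof (rule measure_eqI_generator_eq[where \<Omega>=UNIV and E="range (\<lambda>(a, b). {a<..b::real})"])
    show "Int_stable (range (\<lambda>(a, b). {a<..b::real}))"
      by (auto simp: Int_stable_def)
    show "sets N = sigma_sets UNIV (range (\<lambda>(a, b). {a<..b::real}))"
      "sets L = sigma_sets UNIV (range (\<lambda>(a, b). {a<..b::real}))"
      by (simp_all add: sN L_def borel_sigma_sets_Ioc)
    show "range (\<lambda>n::nat. {- real n<..real n}) \<subseteq> range (\<lambda>(a, b). {a<..b::real})" by auto
    show "(\<Union>n::nat. {- real n<..real n}) = UNIV"
    proof (intro set_eqI iffI UNIV_I)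
      fix x :: real
      obtain n where "\<bar>x\<bar> < real n" using reals_Archimedean2 by blast
      then show "x \<in> (\<Union>n::nat. {- real n<..real n})" by (intro UN_I[of n]) auto
    qed
    show "emeasure N {- real n<..real n} \<noteq> \<infinity>" for n :: nat
      by (subst N) (auto simp: e1 e2)
    fix X assume "X \<in> range (\<lambda>(a, b). {a<..b::real})"
    then obtain a b where X: "X = {a<..b}" by auto
    show "emeasure N X = emeasure L X"
    proof (cases "a \<le> b")
      case True
      have "emeasure N X = ennreal (a1 b - a1 a) + ennreal (a2 b - a2 a)"
        using True by (simp add: X N e1 e2)
      also have "\<dots> = ennreal (C * (cl b - cl a))"
        using m1[OF True] m2[OF True] by (subst ennreal_plus[symmetric]) (auto simp: a1_def a2_def algebra_simps)
      also have "\<dots> = ennreal C * emeasure lborel {cl a<..cl b}"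
        using C0 cl(3)[OF True] by (simp add: ennreal_mult)
      also have "{cl a<..cl b} = {a<..b} \<inter> {-1<..1}"
        using True by (auto simp: cl_def)
      also have "ennreal C * emeasure lborel ({a<..b} \<inter> {-1<..1}) = emeasure L X"
        unfolding X L_def
        by (subst emeasure_density) (auto simp: mult.assoc indicator_inter_arith[symmetric] nn_integral_cmult Int_commute)
      finally show ?thesis .
    qed (simp add: X)
  qed simp
  have null: "emeasure N1 A = 0 \<and> emeasure N2 A = 0" if "A \<in> null_sets lborel" for A
  proof -
    have "emeasure L A = 0"
      using that absolutely_continuousI_density[of "\<lambda>x. ennreal C * indicator {-1<..1::real} x" lborel]
      by (auto simp: absolutely_continuous_def L_def null_sets_def)
    moreover have "A \<in> sets borel" using that by auto
    ultimately show ?thesis using N[of A] by (simp add: NL)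
  qed
  have ac: "absolutely_continuous lborel N1" "absolutely_continuous lborel N2"
    using null by (auto simp: absolutely_continuous_def null_sets_def s)
  obtain h1 where h1: "h1 \<in> borel_measurable lborel" "density lborel h1 = N1"
    using sigma_finite_measure.Radon_Nikodym[OF sigma_finite_lborel ac(1)] s by (metis sets_lborel)
  obtain h2 where h2: "h2 \<in> borel_measurable lborel" "density lborel h2 = N2"
    using sigma_finite_measure.Radon_Nikodym[OF sigma_finite_lborel ac(2)] s by (metis sets_lborel)
  note [measurable] = h1(1) h2(1)
  have "density lborel (\<lambda>x. h1 x + h2 x) = L"
  proof (rule measure_eqI)
    fix A assume "A \<in> sets (density lborel (\<lambda>x. h1 x + h2 x))"
    then have A[measurable]: "A \<in> sets borel" by simp
    have "emeasure (density lborel (\<lambda>x. h1 x + h2 x)) A = emeasure (density lborel h1) A + emeasure (density lborel h2) A"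
      by (simp add: emeasure_density distrib_right nn_integral_add)
    then show "emeasure (density lborel (\<lambda>x. h1 x + h2 x)) A = emeasure L A"
      using N[OF A] by (simp add: h1 h2 NL)
  qed (simp add: L_def)
  then have "AE x in lborel. h1 x + h2 x = ennreal C * indicator {-1<..1::real} x"
    unfolding L_def by (intro sigma_finite_measure.density_unique[OF sigma_finite_lborel]) auto
  then have hC: "AE x in lborel. h1 x \<le> ennreal C"
  proof eventually_elim
    case (elim x)
    have "h1 x \<le> h1 x + h2 x" by simp
    also have "\<dots> \<le> ennreal C" unfolding elim by (auto simp: indicator_def)
    finally show ?case .
  qed
  \<comment> \<open>The truncation changes the density on a null set only and makes the bound hold
    everywhere, as \<open>bounded_primitive\<close> asks.\<close>
  define E where "E x = min C (enn2real (h1 x))" for x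
  have Em[measurable]: "E \<in> borel_measurable borel"
    unfolding E_def using h1(1) by measurable
  have E0: "0 \<le> E x" and EC: "\<bar>E x\<bar> \<le> C" for x
    using C0 by (auto simp: E_def)
  have Eh: "AE x in lborel. h1 x = ennreal (E x)"
    using hC
  proof eventually_elim
    case (elim x)
    then have "h1 x < top" by (simp add: le_less_trans)
    then have "h1 x = ennreal (enn2real (h1 x))" by simp
    moreover have "enn2real (h1 x) \<le> C" using elim C0 enn2real_leI by blast
    ultimately show ?case by (simp add: E_def min_absorb2)
  qed
  have "\<alpha> y - \<alpha> x = (LINT t:{x..y}|lborel. E t)" if xy: "-1 \<le> x" "x \<le> y" "y \<le> 1" for x y
  proof -
    have "ennreal (\<alpha> y - \<alpha> x) = emeasure N1 {x<..y}"
      using xy by (simp add: e1 a1_def cl_def)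
    also have "\<dots> = (\<integral>\<^sup>+t. h1 t * indicator {x<..y} t \<partial>lborel)"
      unfolding h1(2)[symmetric] by (subst emeasure_density) auto
    also have "\<dots> = (\<integral>\<^sup>+t. ennreal (indicator {x<..y} t * E t) \<partial>lborel)"
      using Eh by (intro nn_integral_cong_AE) (auto elim!: eventually_mono simp: indicator_def)
    also have "\<dots> = ennreal (\<integral>t. indicator {x<..y} t * E t \<partial>lborel)"
    proof (rule nn_integral_eq_integral)
      have "set_integrable lborel {x<..y} E"
        by (rule set_integrable_subset[OF set_integrable_bounded[OF Em EC, of x y]]) auto
      then show "integrable lborel (\<lambda>t. indicator {x<..y} t * E t)" by (simp add: set_integrable_def)
    qed (auto simp: E0)
    finally have "\<alpha> y - \<alpha> x = (\<integral>t. indicator {x<..y} t * E t \<partial>lborel)"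
      using \<alpha>[OF xy] E0 by (subst (asm) ennreal_inj) (auto intro!: Bochner_Integration.integral_nonneg)
    then show ?thesis using set_integral_Ioc[of x y E] by (simp add: set_lebesgue_integral_def)
  qed
  then have "bounded_primitive C E \<alpha>" using EC Em by (auto simp: bounded_primitive_def)
  with E0 show ?thesis by blast
qed

section \<open>The scalar fixed-point problem\<close>

text \<open>Suppose the total increments satisfy d' < d. As both slopes are at most n(1)/4,
  \<alpha>(1) exceeds \<beta>(1) by at most (d - d')/4, and \<alpha>(-1) falls below \<beta>(-1) by
  at most as much, hence d - d' \<le> (d - d')/2, which is impossible. Equal increments give equal
  end values, and then at each z the map s -> n(z) s minus the two fluxes grows at rate at least
  n(z) - n(1)/2 > 0.\<close>

lemma density_profile_unique:
  fixes A B n \<alpha> \<beta> :: "real \<Rightarrow> real"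
  assumes n1: "0 < n 1" and nm: "\<And>z. z \<in> {-1..1} \<Longrightarrow> n 1 \<le> n z"
    and A: "\<And>x y. 0 \<le> x \<Longrightarrow> x \<le> y \<Longrightarrow> y \<le> D \<Longrightarrow> A y - A x \<le> n 1 / 4 * (y - x)"
    and B: "\<And>x y. -D \<le> x \<Longrightarrow> x \<le> y \<Longrightarrow> y \<le> 0 \<Longrightarrow> B y - B x \<le> n 1 / 4 * (y - x)"
    and \<alpha>: "\<And>z. z \<in> {-1..1} \<Longrightarrow> n z * \<alpha> z = A (\<alpha> z - \<alpha> (-1)) + B (\<alpha> z - \<alpha> 1)"
      "\<And>z. z \<in> {-1..1} \<Longrightarrow> \<alpha> (-1) \<le> \<alpha> z \<and> \<alpha> z \<le> \<alpha> 1" "\<alpha> 1 - \<alpha> (-1) \<le> D"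
    and \<beta>: "\<And>z. z \<in> {-1..1} \<Longrightarrow> n z * \<beta> z = A (\<beta> z - \<beta> (-1)) + B (\<beta> z - \<beta> 1)"
      "\<And>z. z \<in> {-1..1} \<Longrightarrow> \<beta> (-1) \<le> \<beta> z \<and> \<beta> z \<le> \<beta> 1" "\<beta> 1 - \<beta> (-1) \<le> D"
    and z: "z \<in> {-1..1}"
  shows "\<alpha> z = \<beta> z"
proof -
  have le: "\<alpha>1 - \<alpha>m \<le> \<beta>1 - \<beta>m"
    if a1: "n 1 * \<alpha>1 = A (\<alpha>1 - \<alpha>m) + B 0" and am: "n (-1) * \<alpha>m = A 0 + B (\<alpha>m - \<alpha>1)"
      and aD: "\<alpha>m \<le> \<alpha>1" "\<alpha>1 - \<alpha>m \<le> D"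
      and b1: "n 1 * \<beta>1 = A (\<beta>1 - \<beta>m) + B 0" and bm: "n (-1) * \<beta>m = A 0 + B (\<beta>m - \<beta>1)"
      and bD: "\<beta>m \<le> \<beta>1" "\<beta>1 - \<beta>m \<le> D" for \<alpha>1 \<alpha>m \<beta>1 \<beta>m
  proof (rule ccontr)
    define d d' where "d = \<alpha>1 - \<alpha>m" and "d' = \<beta>1 - \<beta>m"
    assume "\<not> ?thesis"
    then have d: "d' < d" by (simp add: d_def d'_def)
    have dD: "0 \<le> d'" "d \<le> D" using aD bD by (simp_all add: d_def d'_def)
    have "A d - A d' \<le> n 1 / 4 * (d - d')" using A[of d' d] d dD by simp
    then have "n 1 * (\<alpha>1 - \<beta>1) \<le> n 1 * ((d - d') / 4)"
      using a1 b1 by (simp add: d_def d'_def algebra_simps)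
    then have 1: "\<alpha>1 - \<beta>1 \<le> (d - d') / 4" using n1 by (simp only: mult_le_cancel_left_pos)
    have "B (-d') - B (-d) \<le> n 1 / 4 * (d - d')" using B[of "-d" "-d'"] d dD by simp
    also have "\<dots> \<le> n (-1) / 4 * (d - d')" using nm[of "-1"] d by (intro mult_right_mono) auto
    finally have "n (-1) * (\<beta>m - \<alpha>m) \<le> n (-1) * ((d - d') / 4)"
      using am bm by (simp add: d_def d'_def algebra_simps)
    then have 2: "\<beta>m - \<alpha>m \<le> (d - d') / 4" using nm[of "-1"] n1 by (simp add: mult_le_cancel_left_pos)
    have "d - d' = (\<alpha>1 - \<beta>1) + (\<beta>m - \<alpha>m)" by (simp add: d_def d'_def)
    also have "\<dots> \<le> (d - d') / 4 + (d - d') / 4" using 1 2 by (rule add_mono)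
    finally show False using d by simp
  qed
  have a: "n 1 * \<alpha> 1 = A (\<alpha> 1 - \<alpha> (-1)) + B 0" "n (-1) * \<alpha> (-1) = A 0 + B (\<alpha> (-1) - \<alpha> 1)" "\<alpha> (-1) \<le> \<alpha> 1"
    and b: "n 1 * \<beta> 1 = A (\<beta> 1 - \<beta> (-1)) + B 0" "n (-1) * \<beta> (-1) = A 0 + B (\<beta> (-1) - \<beta> 1)" "\<beta> (-1) \<le> \<beta> 1"
    using \<alpha>(1)[of 1] \<alpha>(1)[of "-1"] \<alpha>(2)[of 1] \<beta>(1)[of 1] \<beta>(1)[of "-1"] \<beta>(2)[of 1] by auto
  have d: "\<alpha> 1 - \<alpha> (-1) = \<beta> 1 - \<beta> (-1)"
    using le[OF a \<alpha>(3) b \<beta>(3)] le[OF b \<beta>(3) a \<alpha>(3)] by linarith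
  then have "n 1 * \<alpha> 1 = n 1 * \<beta> 1" using a b by simp
  then have e1: "\<alpha> 1 = \<beta> 1" using n1 by simp
  then have em: "\<alpha> (-1) = \<beta> (-1)" using d by simp
  have le2: "s \<le> t" if s: "n z * s = A (s - \<beta> (-1)) + B (s - \<beta> 1)" "\<beta> (-1) \<le> s" "s \<le> \<beta> 1"
    and t: "n z * t = A (t - \<beta> (-1)) + B (t - \<beta> 1)" "\<beta> (-1) \<le> t" "t \<le> \<beta> 1" for s t
  proof (rule ccontr)
    assume "\<not> s \<le> t"
    then have ts: "t < s" by simp
    have "A (s - \<beta> (-1)) - A (t - \<beta> (-1)) \<le> n 1 / 4 * (s - t)"
      using A[of "t - \<beta> (-1)" "s - \<beta> (-1)"] ts s t \<beta>(3) by simp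
    moreover have "B (s - \<beta> 1) - B (t - \<beta> 1) \<le> n 1 / 4 * (s - t)"
      using B[of "t - \<beta> 1" "s - \<beta> 1"] ts s t \<beta>(3) by simp
    ultimately have "n z * (s - t) \<le> n 1 / 2 * (s - t)" using s t by (simp add: algebra_simps)
    then have "n z \<le> n 1 / 2" using ts by (simp add: mult_le_cancel_right)
    with nm[OF z] n1 show False by linarith
  qed
  show ?thesis
    using le2[of "\<alpha> z" "\<beta> z"] le2[of "\<beta> z" "\<alpha> z"] \<alpha>(1)[OF z] \<alpha>(2)[OF z] \<beta>(1)[OF z] \<beta>(2)[OF z] e1 em by force
qed

text \<open>The total increment d is found as a zero of a scalar function; the end values are then
  explicit, and the intermediate value theorem gives every value between them. Nothing is assumed
  about how the chosen value varies with z: the bound on increments follows from the equation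
  itself.\<close>

lemma density_profile_exists:
  fixes A B n :: "real \<Rightarrow> real"
  assumes n1: "0 < n 1" and dec: "\<And>x y. -1 \<le> x \<Longrightarrow> x \<le> y \<Longrightarrow> y \<le> 1 \<Longrightarrow> n y \<le> n x"
    and \<mu>: "0 < \<mu>" and D: "D = 2 * \<mu> / n 1"
    and A: "\<And>x y. 0 \<le> x \<Longrightarrow> x \<le> y \<Longrightarrow> y \<le> D \<Longrightarrow> A x \<le> A y \<and> A y - A x \<le> n 1 / 4 * (y - x)"
    and B: "\<And>x y. -D \<le> x \<Longrightarrow> x \<le> y \<Longrightarrow> y \<le> 0 \<Longrightarrow> B x \<le> B y \<and> B y - B x \<le> n 1 / 4 * (y - x)"
    and A0: "\<And>x. 0 \<le> x \<Longrightarrow> x \<le> D \<Longrightarrow> 0 \<le> A x" and B0: "\<And>x. -D \<le> x \<Longrightarrow> x \<le> 0 \<Longrightarrow> 0 \<le> B x"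
    and AB: "\<And>x y. 0 \<le> x \<Longrightarrow> x \<le> D \<Longrightarrow> -D \<le> y \<Longrightarrow> y \<le> 0 \<Longrightarrow> A x + B y \<le> \<mu>"
  shows "\<exists>\<alpha>. (\<forall>z\<in>{-1..1}. n z * \<alpha> z = A (\<alpha> z - \<alpha> (-1)) + B (\<alpha> z - \<alpha> 1)) \<and>
     (\<forall>z\<in>{-1..1}. 0 \<le> \<alpha> z \<and> \<alpha> (-1) \<le> \<alpha> z \<and> \<alpha> z \<le> \<alpha> 1) \<and> \<alpha> 1 - \<alpha> (-1) \<le> D \<and>
     (\<forall>x y. -1 \<le> x \<and> x \<le> y \<and> y \<le> 1 \<longrightarrow> 0 \<le> \<alpha> y - \<alpha> x \<and> \<alpha> y - \<alpha> x \<le> 2 * \<mu> * ((n x - n y) / (n x * n y)))"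
proof -
  have nm: "n 1 \<le> n z" "n z \<le> n (-1)" "0 < n z" if "z \<in> {-1..1}" for z
    using dec[of z 1] dec[of "-1" z] that n1 by auto
  have D0: "0 < D" using D \<mu> n1 by simp
  have cA: "continuous_on {0..D} A" by (rule mono_slope_imp_continuous_on[of "n 1 / 4"]) (use A n1 in auto)
  have cB: "continuous_on {-D..0} B" by (rule mono_slope_imp_continuous_on[of "n 1 / 4"]) (use B n1 in auto)
  \<comment> \<open>A zero of \<open>G\<close> is a d for which the upper and lower end values
    computed from d differ by exactly d. The sign at 0 comes from n(1) \<le> n(-1), the sign at
    \<open>D\<close> from \<mu>/n(1) \<le> D.\<close>
  define G where "G d = d - (A d + B 0) / n 1 + (A 0 + B (-d)) / n (-1)" for d
  have cG: "continuous_on {0..D} G"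
    unfolding G_def using n1 nm(3)[of "-1"]
    by (intro continuous_intros cA continuous_on_compose2[OF cB]) auto
  have "G 0 \<le> 0"
  proof -
    have "(A 0 + B 0) / n (-1) \<le> (A 0 + B 0) / n 1"
      using A0[of 0] B0[of 0] D0 n1 nm(2)[of 1] by (intro divide_left_mono) auto
    then show ?thesis by (simp add: G_def)
  qed
  moreover have "0 \<le> G D"
  proof -
    have "(A D + B 0) / n 1 \<le> \<mu> / n 1" using AB[of D 0] D0 n1 by (intro divide_right_mono) auto
    also have "\<dots> \<le> D" using D \<mu> n1 by (simp add: divide_right_mono)
    finally have "(A D + B 0) / n 1 \<le> D" .
    moreover have "0 \<le> (A 0 + B (-D)) / n (-1)" using A0[of 0] B0[of "-D"] D0 nm(3)[of "-1"] by simp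
    ultimately show ?thesis by (simp add: G_def)
  qed
  ultimately obtain d where d: "0 \<le> d" "d \<le> D" "G d = 0"
    using IVT'[of G 0 0 D] cG D0 by force
  define a b where "a = (A 0 + B (-d)) / n (-1)" and "b = (A d + B 0) / n 1"
  have ba: "b - a = d" using d(3) by (simp add: G_def a_def b_def)
  have na: "n (-1) * a = A 0 + B (-d)" and nb: "n 1 * b = A d + B 0"
    using nm(3)[of "-1"] n1 by (simp_all add: a_def b_def)
  have a0: "0 \<le> a" using A0[of 0] B0[of "-d"] d D0 nm(3)[of "-1"] by (simp add: a_def)
  have "\<exists>s. a \<le> s \<and> s \<le> b \<and> n z * s = A (s - a) + B (s - b) \<and> (z = -1 \<longrightarrow> s = a) \<and> (z = 1 \<longrightarrow> s = b)"
    if z: "z \<in> {-1..1}" for z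
  proof -
    \<comment> \<open>The end points are treated apart so that the values chosen there are
      \<open>a\<close> and \<open>b\<close> themselves; inside, the sign change on [a, b] comes from
      n(1) \<le> n(z) \<le> n(-1) and a \<ge> 0.\<close>
    consider "z = -1" | "z = 1" | "z \<noteq> -1" "z \<noteq> 1" by blast
    then show ?thesis
    proof cases
      case 1
      have ab: "a - b = - d" using ba by simp
      have "n z * a = A (a - a) + B (a - b)" by (simp only: 1 ab diff_self na)
      moreover have "a \<le> b" using ba d by simp
      ultimately show ?thesis using 1 by (intro exI[of _ a]) auto
    next
      case 2
      then show ?thesis using nb ba d by (intro exI[of _ b]) auto
    next
      case 3
      define g where "g s = n z * s - A (s - a) - B (s - b)" for s
      have "continuous_on {a..b} g"
        unfolding g_def using ba d
        by (intro continuous_intros continuous_on_compose2[OF cA] continuous_on_compose2[OF cB]) auto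
      moreover have "g a \<le> 0"
      proof -
        have ab: "a - b = - d" using ba by simp
        have "g a = (n z - n (-1)) * a" unfolding g_def ab left_diff_distrib na by simp
        also have "\<dots> \<le> 0" using nm(2)[OF z] a0 by (intro mult_nonpos_nonneg) auto
        finally show ?thesis .
      qed
      moreover have "0 \<le> g b"
      proof -
        have "g b = (n z - n 1) * b" unfolding g_def ba left_diff_distrib nb by simp
        moreover have "0 \<le> (n z - n 1) * b" using nm(1)[OF z] a0 ba d by (intro mult_nonneg_nonneg) auto
        ultimately show ?thesis by simp
      qed
      ultimately obtain s where "a \<le> s" "s \<le> b" "g s = 0"
        using IVT'[of g a 0 b] ba d by force
      then show ?thesis using 3 by (intro exI[of _ s]) (auto simp: g_def)
    qed
  qed
  then obtain \<alpha> where \<alpha>: "\<And>z. z \<in> {-1..1} \<Longrightarrow> a \<le> \<alpha> z \<and> \<alpha> z \<le> b \<and> n z * \<alpha> z = A (\<alpha> z - a) + B (\<alpha> z - b) \<and>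
     (z = -1 \<longrightarrow> \<alpha> z = a) \<and> (z = 1 \<longrightarrow> \<alpha> z = b)"
    by metis
  have ends: "\<alpha> (-1) = a" "\<alpha> 1 = b" using \<alpha>[of "-1"] \<alpha>[of 1] by auto
  have incr: "0 \<le> \<alpha> y - \<alpha> x \<and> \<alpha> y - \<alpha> x \<le> 2 * \<mu> * ((n x - n y) / (n x * n y))" if xy: "-1 \<le> x" "x \<le> y" "y \<le> 1" for x y
  proof -
    have x: "x \<in> {-1..1}" and y: "y \<in> {-1..1}" using xy by auto
    have nx: "0 < n x" "0 < n y" "n 1 \<le> n y" "n y \<le> n x" using nm x y dec xy by auto
    define \<delta> where "\<delta> = \<alpha> y - \<alpha> x"
    define \<Delta> where "\<Delta> = (A (\<alpha> y - a) - A (\<alpha> x - a)) + (B (\<alpha> y - b) - B (\<alpha> x - b))"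
    \<comment> \<open>Difference of the equations at y and x. For \<delta> \<ge> 0 the flux
      difference is at most half of n(y) \<delta> and is absorbed, which costs a factor 2; what
      remains is driven by n(x) - n(y), with \<alpha>(x) bounded through n(x) \<alpha>(x) \<le>
      \<mu>.\<close>
    have eq: "n y * \<delta> = \<Delta> + (n x - n y) * \<alpha> x"
      using \<alpha>[OF x] \<alpha>[OF y] by (simp add: \<delta>_def \<Delta>_def algebra_simps)
    have \<alpha>x0: "0 \<le> \<alpha> x" using \<alpha>[OF x] a0 by linarith
    have \<delta>0: "0 \<le> \<delta>"
    proof (rule ccontr)
      assume "\<not> 0 \<le> \<delta>"
      then have neg: "\<delta> < 0" by simp
      have "A (\<alpha> x - a) - A (\<alpha> y - a) \<le> n 1 / 4 * (- \<delta>)" "B (\<alpha> x - b) - B (\<alpha> y - b) \<le> n 1 / 4 * (- \<delta>)"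
        using A[of "\<alpha> y - a" "\<alpha> x - a"] B[of "\<alpha> y - b" "\<alpha> x - b"] \<alpha>[OF x] \<alpha>[OF y] neg ba d by (auto simp: \<delta>_def)
      then have "n 1 / 2 * \<delta> \<le> \<Delta>" by (simp add: \<Delta>_def algebra_simps)
      moreover have "0 \<le> (n x - n y) * \<alpha> x" using nx \<alpha>x0 by simp
      ultimately have "n 1 / 2 * \<delta> \<le> n y * \<delta>" using eq by linarith
      then have "n y \<le> n 1 / 2" using neg by (simp add: mult_le_cancel_right)
      with nx n1 show False by linarith
    qed
    have "A (\<alpha> y - a) - A (\<alpha> x - a) \<le> n 1 / 4 * \<delta>" "B (\<alpha> y - b) - B (\<alpha> x - b) \<le> n 1 / 4 * \<delta>"
      using A[of "\<alpha> x - a" "\<alpha> y - a"] B[of "\<alpha> x - b" "\<alpha> y - b"] \<alpha>[OF x] \<alpha>[OF y] \<delta>0 ba d by (auto simp: \<delta>_def)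
    then have "\<Delta> \<le> n 1 / 2 * \<delta>" by (simp add: \<Delta>_def)
    also have "\<dots> \<le> n y / 2 * \<delta>" using nx \<delta>0 by (intro mult_right_mono) auto
    finally have "\<Delta> \<le> (n y * \<delta>) / 2" by simp
    then have "n y * \<delta> \<le> 2 * ((n x - n y) * \<alpha> x)" using eq by linarith
    moreover have "n x * \<alpha> x \<le> \<mu>"
      using AB[of "\<alpha> x - a" "\<alpha> x - b"] \<alpha>[OF x] ba d by auto
    then have "\<alpha> x \<le> \<mu> / n x" using nx by (simp add: pos_le_divide_eq mult.commute)
    then have "2 * ((n x - n y) * \<alpha> x) \<le> 2 * ((n x - n y) * (\<mu> / n x))"
      using nx by (intro mult_left_mono) auto
    ultimately have "n y * \<delta> \<le> 2 * ((n x - n y) * (\<mu> / n x))" by linarith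
    then have "\<delta> \<le> 2 * ((n x - n y) * (\<mu> / n x)) / n y"
      unfolding pos_le_divide_eq[OF nx(2)] by (metis mult.commute)
    then show ?thesis using \<delta>0 by (simp add: \<delta>_def mult_ac)
  qed
  show ?thesis
    using \<alpha> ends ba d a0 incr by (intro exI[of _ \<alpha>]) force
qed

text \<open>Summation over finitely many equal short steps. The constant is the local one, so
  estimates that require y close to x lose nothing.\<close>

lemma local_lipschitz_imp_lipschitz:
  fixes g :: "real \<Rightarrow> real"
  assumes \<delta>: "0 < \<delta>" and loc: "\<And>x y. a \<le> x \<Longrightarrow> x \<le> y \<Longrightarrow> y \<le> b \<Longrightarrow> y - x < \<delta> \<Longrightarrow> g y - g x \<le> C * (y - x)"
    and xy: "a \<le> x" "x \<le> y" "y \<le> b"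
  shows "g y - g x \<le> C * (y - x)"
proof -
  have *: "g y - g x \<le> C * (y - x)" if "a \<le> x" "x \<le> y" "y \<le> b" "y - x < real (Suc m) * \<delta>" for m x y
    using that
  proof (induction m arbitrary: x y)
    case 0
    then show ?case using loc by simp
  next
    case (Suc m)
    show ?case
    proof (cases "y - x < \<delta>")
      case True
      then show ?thesis using loc Suc by simp
    next
      case False
      define t where "t = y - (y - x) / real (Suc (Suc m))"
      have "(y - x) / real (Suc (Suc m)) < \<delta>"
        using Suc.prems(4) by (simp add: divide_less_eq mult.commute)
      moreover have "0 \<le> (y - x) / real (Suc (Suc m))" using Suc.prems by simp
      moreover have "t - x = (y - x) * (real (Suc m) / real (Suc (Suc m)))"
        by (simp add: t_def field_simps)
      moreover have "(y - x) * (real (Suc m) / real (Suc (Suc m))) < real (Suc m) * \<delta>"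
      proof -
        have "real (Suc m) * ((y - x) / real (Suc (Suc m))) < real (Suc m) * \<delta>"
          using Suc.prems(4) by (intro mult_strict_left_mono) (simp_all add: divide_less_eq mult.commute)
        then show ?thesis by (simp add: mult.commute)
      qed
      moreover have "0 \<le> (y - x) * (real (Suc m) / real (Suc (Suc m)))" using Suc.prems by simp
      ultimately have t: "x \<le> t" "t \<le> y" "y - t < \<delta>" "t - x < real (Suc m) * \<delta>"
        by (auto simp: t_def)
      have "g t - g x \<le> C * (t - x)" using Suc.IH[of x t] Suc.prems t by simp
      moreover have "g y - g t \<le> C * (y - t)" using loc[of t y] Suc.prems t by simp
      ultimately show ?thesis by (simp add: right_diff_distrib)
    qed
  qed
  obtain m where "(y - x) / \<delta> < real m" using reals_Archimedean2 by blast
  then have "y - x < real m * \<delta>" using \<delta> by (simp add: divide_less_eq)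
  also have "\<dots> \<le> real (Suc m) * \<delta>" using \<delta> by simp
  finally show ?thesis using *[OF xy] by blast
qed

section \<open>Fluxes of the incoming beams\<close>

text \<open>Only used when \<open>F u = 0\<close> for \<open>u\<^sup>2 \<le> 2 * y\<close>; the value of the square root of a negative number is irrelevant.\<close>

definition flux :: "(real \<Rightarrow> real) \<Rightarrow> real \<Rightarrow> real" where
  "flux F y = (LINT u:{0<..}|lborel. F u * u / sqrt (u\<^sup>2 - 2 * y))"

text \<open>The function p^(-1/2) is convex with slope -1/(2 p^(3/2)) at the smaller point p, and
  its graph stays above the tangent there.\<close>

lemma inverse_sqrt_diff_le:
  fixes p q :: real
  assumes "0 < p" "p \<le> q"
  shows "1 / sqrt q \<le> 1 / sqrt p" "1 / sqrt p - 1 / sqrt q \<le> (q - p) / (2 * (p * sqrt p))"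
proof -
  define a b where "a = sqrt p" and "b = sqrt q"
  have a: "0 < a" "a \<le> b" using assms by (simp_all add: a_def b_def)
  show "1 / sqrt q \<le> 1 / sqrt p" using a unfolding a_def[symmetric] b_def[symmetric] by (simp add: frac_le)
  have pa: "p = a * a" "q = b * b" using assms by (simp_all add: a_def b_def)
  have "a * a \<le> b * a" "a * a \<le> b * b" using a by (auto intro!: mult_mono)
  then have "2 * (a * a) \<le> b * (a + b)" by (simp add: distrib_left)
  then have "(b - a) * (2 * (a * a)) \<le> (b - a) * (b * (a + b))" using a by (intro mult_left_mono) auto
  then have "1 / a - 1 / b \<le> (b * b - a * a) / (2 * (a * a * a))"
    using a by (simp add: divide_simps) (simp add: algebra_simps)
  then show "1 / sqrt p - 1 / sqrt q \<le> (q - p) / (2 * (p * sqrt p))"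
    using assms by (simp add: pa[symmetric] a_def[symmetric] b_def[symmetric])
qed

text \<open>Passage from the nonnegative integral, in which the hypotheses are phrased, to the
  Bochner integral defining \<open>flux\<close>. Since \<open>F\<close> vanishes where the radicand
  is not positive, the integrand is nonnegative.\<close>

lemma nn_integral_flux:
  assumes [measurable]: "F \<in> borel_measurable borel" and F0: "\<And>u. 0 \<le> F u"
    and nz: "\<And>u. 0 < u \<Longrightarrow> u\<^sup>2 \<le> 2 * y \<Longrightarrow> F u = 0"
    and bd: "(\<integral>\<^sup>+u. ennreal (F u * u / sqrt (u\<^sup>2 - 2 * y)) * indicator {0<..} u \<partial>lborel) \<le> ennreal m" and m: "0 \<le> m"
  shows "set_integrable lborel {0<..} (\<lambda>u. F u * u / sqrt (u\<^sup>2 - 2 * y))"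
    "(\<integral>\<^sup>+u. ennreal (F u * u / sqrt (u\<^sup>2 - 2 * y)) * indicator {0<..} u \<partial>lborel) = ennreal (flux F y)"
    "0 \<le> flux F y" "flux F y \<le> m"
proof -
  have nn: "0 \<le> indicat_real {0<..} u *\<^sub>R (F u * u / sqrt (u\<^sup>2 - 2 * y))" for u
  proof (cases "0 < u \<and> F u \<noteq> 0")
    case True
    then have "2 * y < u\<^sup>2" using nz[of u] by force
    then show ?thesis using True F0[of u] by simp
  next
    case False
    then show ?thesis by (auto simp: indicator_def)
  qed
  have eq: "ennreal (F u * u / sqrt (u\<^sup>2 - 2 * y)) * indicator {0<..} u = ennreal (indicat_real {0<..} u *\<^sub>R (F u * u / sqrt (u\<^sup>2 - 2 * y)))" for u
    by (auto simp: indicator_def)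
  have bd': "(\<integral>\<^sup>+u. ennreal (indicat_real {0<..} u *\<^sub>R (F u * u / sqrt (u\<^sup>2 - 2 * y))) \<partial>lborel) \<le> ennreal m"
    using bd unfolding eq .
  have i: "integrable lborel (\<lambda>u. indicat_real {0<..} u *\<^sub>R (F u * u / sqrt (u\<^sup>2 - 2 * y)))"
    using nn bd' by (intro integrableI_nonneg) (auto intro: le_less_trans)
  then show "set_integrable lborel {0<..} (\<lambda>u. F u * u / sqrt (u\<^sup>2 - 2 * y))"
    by (simp add: set_integrable_def)
  show *: "(\<integral>\<^sup>+u. ennreal (F u * u / sqrt (u\<^sup>2 - 2 * y)) * indicator {0<..} u \<partial>lborel) = ennreal (flux F y)"
    unfolding eq flux_def set_lebesgue_integral_def using i nn by (intro nn_integral_eq_integral) auto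
  show f0: "0 \<le> flux F y"
    unfolding flux_def set_lebesgue_integral_def using nn by (intro Bochner_Integration.integral_nonneg) auto
  show "flux F y \<le> m" using bd m unfolding * by simp
qed

text \<open>Pointwise in u, the increment of 1/sqrt(u^2 - 2y) is at most (y - x) times its
  derivative in y at the larger argument. The weight \<open>w\<close> dominates F(u) u times that
  derivative; the two beams supply different weights.\<close>

lemma flux_mono_lipschitz:
  assumes F0: "\<And>u. 0 \<le> F u" and xy: "x \<le> y"
    and i1: "set_integrable lborel {0<..} (\<lambda>u. F u * u / sqrt (u\<^sup>2 - 2 * x))"
    and i2: "set_integrable lborel {0<..} (\<lambda>u. F u * u / sqrt (u\<^sup>2 - 2 * y))"
    and iw: "set_integrable lborel {0<..} w" and k: "(LINT u:{0<..}|lborel. w u) \<le> k"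
    and nz: "\<And>u. 0 < u \<Longrightarrow> u\<^sup>2 \<le> 2 * y \<Longrightarrow> F u = 0"
    and w: "\<And>u. 0 < u \<Longrightarrow> F u \<noteq> 0 \<Longrightarrow> F u * (u / ((u\<^sup>2 - 2 * y) * sqrt (u\<^sup>2 - 2 * y))) \<le> w u"
    and w0: "\<And>u. 0 < u \<Longrightarrow> 0 \<le> w u"
  shows "flux F x \<le> flux F y \<and> flux F y - flux F x \<le> k * (y - x)"
proof -
  have *: "F u * u / sqrt (u\<^sup>2 - 2 * x) \<le> F u * u / sqrt (u\<^sup>2 - 2 * y) \<and>
     F u * u / sqrt (u\<^sup>2 - 2 * y) - F u * u / sqrt (u\<^sup>2 - 2 * x) \<le> (y - x) * w u" if u: "u \<in> {0<..}" for u
  proof (cases "F u = 0")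
    case True
    then show ?thesis using w0[of u] u xy by simp
  next
    case False
    define p q where "p = u\<^sup>2 - 2 * y" and "q = u\<^sup>2 - 2 * x"
    have pq: "0 < p" "p \<le> q" using nz[of u] False u xy by (force simp: p_def q_def)+
    have Fu: "0 \<le> F u * u" using F0[of u] u by simp
    have qp: "q - p = 2 * (y - x)" by (simp add: p_def q_def)
    have "F u * u * (1 / sqrt q) \<le> F u * u * (1 / sqrt p)"
      using inverse_sqrt_diff_le(1)[OF pq] Fu by (rule mult_left_mono)
    moreover have "F u * u * (1 / sqrt p - 1 / sqrt q) \<le> F u * u * ((q - p) / (2 * (p * sqrt p)))"
      using inverse_sqrt_diff_le(2)[OF pq] Fu by (rule mult_left_mono)
    moreover have "F u * u * ((q - p) / (2 * (p * sqrt p))) = (y - x) * (F u * (u / (p * sqrt p)))"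
    proof -
      have "(q - p) / (2 * (p * sqrt p)) = (y - x) / (p * sqrt p)"
        unfolding qp by (rule mult_divide_mult_cancel_left) simp
      then show ?thesis by simp
    qed
    moreover have "(y - x) * (F u * (u / (p * sqrt p))) \<le> (y - x) * w u"
      using w[of u] False u xy by (intro mult_left_mono) (auto simp: p_def)
    ultimately have "F u * u * (1 / sqrt q) \<le> F u * u * (1 / sqrt p)"
      "F u * u * (1 / sqrt p - 1 / sqrt q) \<le> (y - x) * w u" by linarith+
    then show ?thesis by (simp add: p_def q_def right_diff_distrib)
  qed
  have "flux F x \<le> flux F y"
    unfolding flux_def using * by (intro set_integral_mono i1 i2) auto
  moreover have "flux F y - flux F x = (LINT u:{0<..}|lborel. F u * u / sqrt (u\<^sup>2 - 2 * y) - F u * u / sqrt (u\<^sup>2 - 2 * x))"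
    unfolding flux_def by (rule set_integral_diff(2)[OF i2 i1, symmetric])
  moreover have "\<dots> \<le> (LINT u:{0<..}|lborel. (y - x) * w u)"
    using * iw by (intro set_integral_mono set_integral_diff(1) i1 i2 set_integrable_mult_right) auto
  moreover have "\<dots> = (y - x) * (LINT u:{0<..}|lborel. w u)" by simp
  moreover have "\<dots> \<le> (y - x) * k" using k xy by (intro mult_left_mono) auto
  ultimately show ?thesis by (simp add: mult.commute)
qed

text \<open>For u^2 \<ge> 4D and y \<le> D one has u^2 - 2y \<ge> 2D, so differentiating in y costs
  a factor of at most 1/(2D) and leaves an integral already bounded by \<Lambda>.\<close>

lemma left_flux:
  assumes F[measurable]: "F \<in> borel_measurable borel" and F0: "\<And>u. 0 \<le> F u" and D: "0 < D"
    and z: "\<And>u. 0 < u \<Longrightarrow> u\<^sup>2 < 4 * D \<Longrightarrow> F u = 0"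
    and bd: "\<And>y. 0 \<le> y \<Longrightarrow> y \<le> D \<Longrightarrow> (\<integral>\<^sup>+u. ennreal (F u * u / sqrt (u\<^sup>2 - 2 * y)) * indicator {0<..} u \<partial>lborel) \<le> ennreal \<Lambda>"
    and \<Lambda>: "0 \<le> \<Lambda>" and k: "\<Lambda> / (2 * D) \<le> k"
  shows "\<And>y. 0 \<le> y \<Longrightarrow> y \<le> D \<Longrightarrow> 0 \<le> flux F y \<and> flux F y \<le> \<Lambda>"
    "\<And>x y. 0 \<le> x \<Longrightarrow> x \<le> y \<Longrightarrow> y \<le> D \<Longrightarrow> flux F x \<le> flux F y \<and> flux F y - flux F x \<le> k * (y - x)"
    "\<And>y. 0 \<le> y \<Longrightarrow> y \<le> D \<Longrightarrow> (\<integral>\<^sup>+u. ennreal (F u * u / sqrt (u\<^sup>2 - 2 * y)) * indicator {0<..} u \<partial>lborel) = ennreal (flux F y)"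
proof -
  have nz: "F u = 0" if "0 < u" "u\<^sup>2 \<le> 2 * y" "y \<le> D" for u y
    using z[of u] that D by linarith
  show "0 \<le> flux F y \<and> flux F y \<le> \<Lambda>" if "0 \<le> y" "y \<le> D" for y
    using nn_integral_flux(3,4)[OF F F0 _ bd[OF that] \<Lambda>] nz that by blast
  show "(\<integral>\<^sup>+u. ennreal (F u * u / sqrt (u\<^sup>2 - 2 * y)) * indicator {0<..} u \<partial>lborel) = ennreal (flux F y)" if "0 \<le> y" "y \<le> D" for y
    using nn_integral_flux(2)[OF F F0 _ bd[OF that] \<Lambda>] nz that by blast
  show "flux F x \<le> flux F y \<and> flux F y - flux F x \<le> k * (y - x)" if xy: "0 \<le> x" "x \<le> y" "y \<le> D" for x y
  proof (rule flux_mono_lipschitz[OF F0 xy(2)])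
    show "set_integrable lborel {0<..} (\<lambda>u. F u * u / sqrt (u\<^sup>2 - 2 * x))"
      by (rule nn_integral_flux(1)[OF F F0 _ bd \<Lambda>]) (use nz xy in auto)
    show i: "set_integrable lborel {0<..} (\<lambda>u. F u * u / sqrt (u\<^sup>2 - 2 * y))"
      by (rule nn_integral_flux(1)[OF F F0 _ bd \<Lambda>]) (use nz xy in auto)
    show "set_integrable lborel {0<..} (\<lambda>u. 1 / (2 * D) * (F u * u / sqrt (u\<^sup>2 - 2 * y)))"
      using i by (rule set_integrable_mult_right)
    have "(LINT u:{0<..}|lborel. 1 / (2 * D) * (F u * u / sqrt (u\<^sup>2 - 2 * y))) = 1 / (2 * D) * flux F y"
      unfolding flux_def by (rule set_integral_mult_right)
    also have "\<dots> \<le> 1 / (2 * D) * \<Lambda>"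
      by (intro mult_left_mono nn_integral_flux(4)[OF F F0 _ bd \<Lambda>]) (use nz xy D in auto)
    also have "\<dots> \<le> k" using k by simp
    finally show "(LINT u:{0<..}|lborel. 1 / (2 * D) * (F u * u / sqrt (u\<^sup>2 - 2 * y))) \<le> k" .
    show "F u = 0" if "0 < u" "u\<^sup>2 \<le> 2 * y" for u using nz that xy by blast
    fix u :: real assume u: "0 < u"
    {
      assume "F u \<noteq> 0"
      then have "4 * D \<le> u\<^sup>2" using z[OF u] by force
      then have p: "2 * D \<le> u\<^sup>2 - 2 * y" using xy by linarith
      define p where "p = u\<^sup>2 - 2 * y"
      have p: "2 * D \<le> p" "0 < p" using p D by (auto simp: p_def)
      have "u / (p * sqrt p) = (1 / p) * (u / sqrt p)" by simp
      also have "\<dots> \<le> 1 / (2 * D) * (u / sqrt p)"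
        using p D u by (intro mult_right_mono) (auto simp: frac_le)
      finally have "F u * (u / (p * sqrt p)) \<le> F u * (1 / (2 * D) * (u / sqrt p))"
        using F0[of u] by (rule mult_left_mono)
      then show "F u * (u / ((u\<^sup>2 - 2 * y) * sqrt (u\<^sup>2 - 2 * y))) \<le> 1 / (2 * D) * (F u * u / sqrt (u\<^sup>2 - 2 * y))"
        by (simp add: p_def mult_ac)
    }
    show "0 \<le> 1 / (2 * D) * (F u * u / sqrt (u\<^sup>2 - 2 * y))"
    proof (cases "F u = 0")
      case False
      then have "4 * D \<le> u\<^sup>2" using z[OF u] by force
      then have "0 \<le> sqrt (u\<^sup>2 - 2 * y)" using xy D by simp
      then show ?thesis using F0[of u] u D by simp
    qed simp
  qed
qed

text \<open>For y \<le> 0 the radicand is at least u^2, hence the kernel is at most 1 and its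
  derivative in y at most 1/u^2; this is how the mass and the singular moment of the incoming data
  become the two bounds.\<close>

lemma right_flux:
  assumes F[measurable]: "F \<in> borel_measurable borel" and F0: "\<And>u. 0 \<le> F u"
    and m: "(\<integral>\<^sup>+u. ennreal (F u) * indicator {0<..} u \<partial>lborel) \<le> ennreal m" "0 \<le> m"
    and k: "(\<integral>\<^sup>+u. ennreal (F u / u\<^sup>2) * indicator {0<..} u \<partial>lborel) \<le> ennreal k" "0 \<le> k"
  shows "\<And>y. y \<le> 0 \<Longrightarrow> 0 \<le> flux F y \<and> flux F y \<le> m"
    "\<And>x y. x \<le> y \<Longrightarrow> y \<le> 0 \<Longrightarrow> flux F x \<le> flux F y \<and> flux F y - flux F x \<le> k * (y - x)"
    "\<And>y. y \<le> 0 \<Longrightarrow> (\<integral>\<^sup>+u. ennreal (F u * u / sqrt (u\<^sup>2 - 2 * y)) * indicator {0<..} u \<partial>lborel) = ennreal (flux F y)"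
proof -
  have nz: "F u = 0" if "0 < u" "u\<^sup>2 \<le> 2 * y" "y \<le> 0" for u y
    using that zero_less_power2[of u] by linarith
  have bd: "(\<integral>\<^sup>+u. ennreal (F u * u / sqrt (u\<^sup>2 - 2 * y)) * indicator {0<..} u \<partial>lborel) \<le> ennreal m" if y: "y \<le> 0" for y
  proof (rule order_trans[OF nn_integral_mono m(1)])
    fix u :: real
    have "u / sqrt (u\<^sup>2 - 2 * y) \<le> 1" if "0 < u"
    proof -
      have "u \<le> sqrt (u\<^sup>2 - 2 * y)" using y that by (intro real_le_rsqrt) auto
      moreover from this have "0 < sqrt (u\<^sup>2 - 2 * y)" using that by linarith
      ultimately show ?thesis by (simp only: divide_le_eq_1) simp
    qed
    then have "F u * (u / sqrt (u\<^sup>2 - 2 * y)) \<le> F u * 1" if "0 < u"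
      using F0[of u] that by (intro mult_left_mono) auto
    then show "ennreal (F u * u / sqrt (u\<^sup>2 - 2 * y)) * indicator {0<..} u \<le> ennreal (F u) * indicator {0<..} u"
      by (auto simp: indicator_def intro!: ennreal_leI)
  qed
  show "0 \<le> flux F y \<and> flux F y \<le> m" if y: "y \<le> 0" for y
    using nn_integral_flux(3,4)[OF F F0 _ bd[OF y] m(2)] nz y by blast
  show "(\<integral>\<^sup>+u. ennreal (F u * u / sqrt (u\<^sup>2 - 2 * y)) * indicator {0<..} u \<partial>lborel) = ennreal (flux F y)" if y: "y \<le> 0" for y
    using nn_integral_flux(2)[OF F F0 _ bd[OF y] m(2)] nz y by blast
  have iw: "integrable lborel (\<lambda>u. indicat_real {0<..} u *\<^sub>R (F u / u\<^sup>2))"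
  proof (rule integrableI_nonneg)
    have "(\<integral>\<^sup>+u. ennreal (indicat_real {0<..} u *\<^sub>R (F u / u\<^sup>2)) \<partial>lborel) = (\<integral>\<^sup>+u. ennreal (F u / u\<^sup>2) * indicator {0<..} u \<partial>lborel)"
      by (intro nn_integral_cong) (auto simp: indicator_def)
    also have "\<dots> < \<infinity>" using k(1) by (rule le_less_trans) simp
    finally show "(\<integral>\<^sup>+u. ennreal (indicat_real {0<..} u *\<^sub>R (F u / u\<^sup>2)) \<partial>lborel) < \<infinity>" .
  qed (use F0 in auto)
  have "ennreal (LINT u:{0<..}|lborel. F u / u\<^sup>2) = (\<integral>\<^sup>+u. ennreal (indicat_real {0<..} u *\<^sub>R (F u / u\<^sup>2)) \<partial>lborel)"
    unfolding set_lebesgue_integral_def using iw F0 by (intro nn_integral_eq_integral[symmetric]) auto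
  also have "\<dots> = (\<integral>\<^sup>+u. ennreal (F u / u\<^sup>2) * indicator {0<..} u \<partial>lborel)"
    by (intro nn_integral_cong) (auto simp: indicator_def)
  also note k(1)
  finally have wk: "(LINT u:{0<..}|lborel. F u / u\<^sup>2) \<le> k" by (subst (asm) ennreal_le_iff[OF k(2)])
  show "flux F x \<le> flux F y \<and> flux F y - flux F x \<le> k * (y - x)" if xy: "x \<le> y" "y \<le> 0" for x y
  proof (rule flux_mono_lipschitz[OF F0 xy(1) _ _ _ wk])
    show "set_integrable lborel {0<..} (\<lambda>u. F u * u / sqrt (u\<^sup>2 - 2 * x))"
      by (rule nn_integral_flux(1)[OF F F0 _ bd m(2)]) (use nz xy in auto)
    show "set_integrable lborel {0<..} (\<lambda>u. F u * u / sqrt (u\<^sup>2 - 2 * y))"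
      by (rule nn_integral_flux(1)[OF F F0 _ bd m(2)]) (use nz xy in auto)
    show "set_integrable lborel {0<..} (\<lambda>u. F u / u\<^sup>2)" using iw by (simp add: set_integrable_def)
    show "F u = 0" if "0 < u" "u\<^sup>2 \<le> 2 * y" for u using nz that xy by blast
    fix u :: real assume u: "0 < u"
    {
      define p where "p = u\<^sup>2 - 2 * y"
      have "0 < u\<^sup>2" using u by simp
      then have p: "u\<^sup>2 \<le> p" "0 < p" using xy unfolding p_def by linarith+
      then have "u \<le> sqrt p" using u by (intro real_le_rsqrt) auto
      then have "u\<^sup>2 * u \<le> p * sqrt p" using p u by (intro mult_mono) auto
      then have "u / (p * sqrt p) \<le> u / (u\<^sup>2 * u)" using u p by (intro divide_left_mono) auto
      also have "\<dots> = 1 / u\<^sup>2" using u by simp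
      finally have "F u * (u / (p * sqrt p)) \<le> F u * (1 / u\<^sup>2)"
        using F0[of u] by (rule mult_left_mono)
      then show "F u * (u / ((u\<^sup>2 - 2 * y) * sqrt (u\<^sup>2 - 2 * y))) \<le> F u / u\<^sup>2" by (simp add: p_def)
    }
    show "0 \<le> F u / u\<^sup>2" using F0[of u] by simp
  qed
qed

section \<open>Solutions of the nonlinear problem\<close>

lemma AE_zero_imp_zero_continuous:
  fixes F :: "real \<Rightarrow> real"
  assumes c: "continuous_on {-1..1} F" and ae: "AE x in lborel. x \<in> {-1..1} \<longrightarrow> F x = 0"
    and x: "x \<in> {-1..1}"
  shows "F x = 0"
proof -
  have ca: "continuous_on {-1..1} (\<lambda>x. \<bar>F x\<bar>)" by (intro continuous_intros c)
  have i: "set_integrable lborel {-1..1} (\<lambda>x. \<bar>F x\<bar>)"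
    unfolding set_integrable_def by (rule borel_integrable_compact[OF compact_Icc ca])
  have "(LINT x:{-1..1}|lborel. \<bar>F x\<bar>) = (LINT x:{-1..1::real}|lborel. (0::real))"
    unfolding set_lebesgue_integral_def
    using borel_measurable_integrable[OF i[unfolded set_integrable_def]] ae
    by (intro Bochner_Integration.integral_cong_AE) (auto elim!: eventually_mono simp: indicator_def)
  then have "integral {-1..1} (\<lambda>x. \<bar>F x\<bar>) = 0"
    using set_borel_integral_eq_integral(2)[OF i] by (simp add: set_lebesgue_integral_def)
  then have hi: "((\<lambda>x. \<bar>F x\<bar>) has_integral 0) (cbox (-1) 1)"
    using integrable_continuous_interval[OF ca] by (simp add: has_integral_iff)
  have "\<bar>F x\<bar> = 0"
    by (rule has_integral_0_cbox_imp_0[OF _ _ hi]) (use ca x in auto)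
  then show ?thesis by simp
qed

lemma Linf_norm_slab_nonneg: "0 \<le> Linf_norm slab g"
proof (rule ccontr)
  assume neg: "\<not> 0 \<le> Linf_norm slab g"
  let ?N = "esssup slab (\<lambda>x. ereal \<bar>g x\<bar>)"
  have N: "?N < 0"
    using neg by (cases ?N) (auto simp: Linf_norm_def)
  have "AE x in slab. ereal \<bar>g x\<bar> \<le> ?N" by (rule esssup_AE)
  then have "AE x in slab. False"
  proof eventually_elim
    case (elim x)
    then have "ereal \<bar>g x\<bar> < 0" using N by (rule le_less_trans)
    then show ?case by simp
  qed
  then have "AE x in lborel. x \<notin> {-1..1::real}" by (simp add: AE_restrict_lborel)
  then have "emeasure lborel {-1..1::real} = 0" by (subst (asm) AE_iff_measurable[of "{-1..1}"]) auto
  then show False by simp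
qed

text \<open>Almost everywhere n' = q n^2 with |q| \<le> m and n' \<le> 0. Once n is known to
  decrease, n \<le> n(x) on [x, y] turns the bound m n^2 on -n' into the constant m n(x)^2.\<close>

lemma equilibrium_density_facts:
  fixes n n' :: "real \<Rightarrow> real"
  assumes n_pos: "\<forall>z\<in>{-1..1}. 0 < n z"
    and n_cont: "continuous_on {-1..1} n"
    and n_deriv: "weak_deriv {-1<..<1} n n'"
    and n_Linf: "Linf slab (\<lambda>z. n' z / (n z)\<^sup>2)"
    and neg: "AE z in slab. n' z \<le> 0"
    and xy: "-1 \<le> x" "x \<le> y" "y \<le> 1"
  defines "m \<equiv> Linf_norm slab (\<lambda>z. n' z / (n z)\<^sup>2)"
  shows "n y \<le> n x" "n x - n y \<le> m * (n x)\<^sup>2 * (y - x)"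
proof -
  have m0: "0 \<le> m" unfolding m_def by (rule Linf_norm_slab_nonneg)
  have I: "{-1..1::real} \<in> sets borel" by simp
  obtain q M where q[measurable]: "q \<in> borel_measurable borel" and qM: "\<And>x. \<bar>q x\<bar> \<le> M"
    and qe: "AE x in lborel. x \<in> {-1..1} \<longrightarrow> n' x / (n x)\<^sup>2 = q x"
    and M: "M = max 0 (Linf_norm slab (\<lambda>z. n' z / (n z)\<^sup>2))"
    by (rule Linf_representative[OF I n_Linf]) blast
  have qm: "\<bar>q x\<bar> \<le> m" for x using qM[of x] M m0 by (simp add: m_def)
  define cl where "cl x = max (-1) (min 1 x)" for x :: real
  define nc where "nc x = n (cl x)" for x
  have cl: "cl x \<in> {-1..1}" "x \<in> {-1..1} \<Longrightarrow> cl x = x" for x by (auto simp: cl_def)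
  have ncc: "continuous_on UNIV nc"
    unfolding nc_def cl_def by (rule continuous_on_compose2[OF n_cont]) (auto intro!: continuous_intros)
  then have [measurable]: "nc \<in> borel_measurable borel" by (rule borel_measurable_continuous_onI)
  obtain K where K: "\<And>z. z \<in> {-1..1} \<Longrightarrow> \<bar>n z\<bar> \<le> K"
    using continuous_on_interval_bounded[OF n_cont] by blast
  \<comment> \<open>The hypothesis controls n'/n^2 and not n' itself; boundedness of n on the slab
    turns the bounded representative of the quotient into one of n'.\<close>
  define E where "E z = q z * (nc z)\<^sup>2" for z
  have [measurable]: "E \<in> borel_measurable borel" unfolding E_def by measurable
  have EM: "\<bar>E z\<bar> \<le> m * K\<^sup>2" for z
  proof -
    have "(nc z)\<^sup>2 \<le> K\<^sup>2" using K[OF cl(1)[of z]] unfolding nc_def by (metis abs_ge_zero power2_abs power_mono)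
    then show ?thesis unfolding E_def abs_mult using qm[of z] m0 by (intro mult_mono) auto
  qed
  have nE: "AE x in lborel. x \<in> {-1..1} \<longrightarrow> n' x = E x"
    using qe
  proof eventually_elim
    case (elim x)
    show ?case
    proof
      assume x: "x \<in> {-1..1}"
      then have "n x \<noteq> 0" using n_pos by force
      then show "n' x = E x" using elim x cl(2)[OF x] by (simp add: E_def nc_def field_simps)
    qed
  qed
  have E0: "AE x in lborel. x \<in> {-1..1} \<longrightarrow> E x \<le> 0"
    using nE neg[unfolded AE_restrict_lborel[OF I]] by eventually_elim auto
  have "weak_deriv {-1<..<1} nc E"
  proof (rule weak_deriv_cong[OF n_deriv])
    show "AE x in lborel. x \<in> {-1<..<1} \<longrightarrow> n x = nc x"
      by (intro always_eventually allI) (auto simp: nc_def cl_def)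
    show "AE x in lborel. x \<in> {-1<..<1} \<longrightarrow> n' x = E x" using nE by eventually_elim auto
  qed measurable
  then have bp: "bounded_primitive (m * K\<^sup>2) E nc"
    using ncc EM by (intro weak_deriv_imp_bounded_primitive) (auto intro: continuous_on_subset)
  have eqI: "n b - n a = (LINT t:{a..b}|lborel. E t)" if "-1 \<le> a" "a \<le> b" "b \<le> 1" for a b
  proof -
    have "nc b - nc a = (LINT t:{a..b}|lborel. E t)"
      using bp that unfolding bounded_primitive_def by blast
    then show ?thesis using cl(2)[of a] cl(2)[of b] that by (simp add: nc_def)
  qed
  have dec: "n b \<le> n a" if "-1 \<le> a" "a \<le> b" "b \<le> 1" for a b
  proof -
    have "0 \<le> (\<integral>t. - (indicator {a..b} t *\<^sub>R E t) \<partial>lborel)"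
      using E0 by (intro integral_nonneg_AE) (use that in \<open>auto elim!: eventually_mono simp: indicator_def\<close>)
    then show ?thesis using eqI[OF that] by (simp add: set_lebesgue_integral_def)
  qed
  show "n y \<le> n x" by (rule dec[OF xy])
  have "n x - n y = (\<integral>t. - (indicator {x..y} t *\<^sub>R E t) \<partial>lborel)"
    using eqI[OF xy] by (simp add: set_lebesgue_integral_def)
  also have "\<dots> \<le> (\<integral>t. indicator {x..y} t *\<^sub>R (m * (n x)\<^sup>2) \<partial>lborel)"
  proof (rule integral_mono)
    show "integrable lborel (\<lambda>t. - (indicator {x..y} t *\<^sub>R E t))"
      using set_integrable_bounded[of E "m * K\<^sup>2" x y] EM by (simp add: set_integrable_def)
    show "integrable lborel (\<lambda>t. indicator {x..y} t *\<^sub>R (m * (n x)\<^sup>2))"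
      by (simp add: emeasure_lborel_Icc_eq)
    show "- (indicator {x..y} t *\<^sub>R E t) \<le> indicator {x..y} t *\<^sub>R (m * (n x)\<^sup>2)" for t
    proof (cases "t \<in> {x..y}")
      case True
      then have t: "t \<in> {-1..1}" using xy by auto
      have "nc t = n t" using cl(2)[OF t] by (simp add: nc_def)
      moreover have "0 < n t" "n t \<le> n x" using n_pos t dec[of x t] True xy by auto
      then have "(n t)\<^sup>2 \<le> (n x)\<^sup>2" by (intro power_mono) auto
      moreover have "- q t \<le> m" using qm[of t] by linarith
      ultimately have "- q t * (n t)\<^sup>2 \<le> m * (n x)\<^sup>2" using m0 by (intro mult_mono) auto
      then show ?thesis using True \<open>nc t = n t\<close> by (simp add: E_def)
    qed simp
  qed
  also have "\<dots> = m * (n x)\<^sup>2 * (y - x)"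
    using xy by (simp add: measure_def)
  finally show "n x - n y \<le> m * (n x)\<^sup>2 * (y - x)" .
qed

text \<open>Origin of the 4: the increment estimate contributes 2, and the bound of (n(x) -
  n(y))/(n(x) n(y)) by m (y - x) n(x)/n(y) contributes n(x)/n(y) \<le> 2. The latter holds when n(x)
  - n(y) < n(1) \<le> n(y), that is for y close to x by uniform continuity, which suffices by
  subdivision.\<close>

lemma profile_lipschitz:
  fixes n :: "real \<Rightarrow> real"
  assumes n_pos: "\<forall>z\<in>{-1..1}. 0 < n z" and n_cont: "continuous_on {-1..1} n"
    and dec: "\<And>x y. -1 \<le> x \<Longrightarrow> x \<le> y \<Longrightarrow> y \<le> 1 \<Longrightarrow> n y \<le> n x \<and> n x - n y \<le> m * (n x)\<^sup>2 * (y - x)"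
    and \<mu>: "0 \<le> \<mu>" and m: "0 \<le> m"
    and \<alpha>: "\<And>x y. -1 \<le> x \<Longrightarrow> x \<le> y \<Longrightarrow> y \<le> 1 \<Longrightarrow> \<alpha> y - \<alpha> x \<le> 2 * \<mu> * ((n x - n y) / (n x * n y))"
    and xy: "-1 \<le> x" "x \<le> y" "y \<le> 1"
  shows "\<alpha> y - \<alpha> x \<le> 4 * \<mu> * m * (y - x)"
proof -
  have n1: "0 < n 1" using n_pos by simp
  have "uniformly_continuous_on {-1..1} n"
    using n_cont by (intro compact_uniformly_continuous) auto
  then obtain \<delta> where \<delta>: "0 < \<delta>" "\<And>x y. x \<in> {-1..1} \<Longrightarrow> y \<in> {-1..1} \<Longrightarrow> dist y x < \<delta> \<Longrightarrow> dist (n y) (n x) < n 1"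
    using n1 unfolding uniformly_continuous_on_def by metis
  show ?thesis
  proof (rule local_lipschitz_imp_lipschitz[OF \<delta>(1) _ xy])
    fix x y assume xy: "-1 \<le> x" "x \<le> y" "y \<le> 1" and d: "y - x < \<delta>"
    have x: "x \<in> {-1..1}" "y \<in> {-1..1}" using xy by auto
    have p: "0 < n x" "0 < n y" using n_pos x by auto
    have "dist (n y) (n x) < n 1" using \<delta>(2)[OF x] d xy by (simp add: dist_real_def)
    moreover have "n 1 \<le> n y" using dec[of y 1] xy by simp
    ultimately have r: "n x \<le> 2 * n y" by (simp add: dist_real_def abs_less_iff)
    have "(n x - n y) / (n x * n y) \<le> (m * (n x)\<^sup>2 * (y - x)) / (n x * n y)"
      using dec[OF xy] p by (intro divide_right_mono) auto
    also have "\<dots> = (m * (y - x)) * (n x / n y)" using p by (simp add: power2_eq_square)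
    also have "\<dots> \<le> (m * (y - x)) * 2"
      using r p m xy by (intro mult_left_mono) (auto simp: divide_le_eq)
    finally have "2 * \<mu> * ((n x - n y) / (n x * n y)) \<le> 2 * \<mu> * ((m * (y - x)) * 2)"
      using \<mu> by (intro mult_left_mono) auto
    with \<alpha>[OF xy] show "\<alpha> y - \<alpha> x \<le> 4 * \<mu> * m * (y - x)" by (simp add: mult_ac)
  qed
qed

definition flow_density :: "(real \<Rightarrow> real) \<Rightarrow> (real \<Rightarrow> real) \<Rightarrow> (real \<Rightarrow> real) \<Rightarrow> real \<times> real \<Rightarrow> real" where
  "flow_density \<alpha> Fm Fp p = beam 1 (\<alpha> (-1)) \<alpha> Fm p + beam (-1) (\<alpha> 1) \<alpha> Fp p"

lemma beam_bounded:
  assumes "\<And>u. \<bar>F u\<bar> \<le> C"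
  shows "\<bar>beam \<sigma> e \<alpha> F p\<bar> \<le> C"
  using assms order_trans[OF abs_ge_zero assms] by (auto simp: beam_def)

text \<open>Each beam contributes a term at both ends. Where it leaves the slab its speed is
  nonzero, because u^2 \<ge> 4D on the support of \<open>Fm\<close> and because \<alpha>(-1) \<le>
  \<alpha>(1) for the other beam, so the test function vanishes there; where it enters, the radicand
  reduces to u^2.\<close>

lemma flow_density_weak_form:
  assumes P: "bounded_primitive M E \<alpha>" and \<alpha>: "\<alpha> \<in> borel_measurable borel"
    and ord: "\<And>z. z \<in> {-1..1} \<Longrightarrow> \<alpha> (-1) \<le> \<alpha> z \<and> \<alpha> z \<le> \<alpha> 1" and D: "0 < D" "\<alpha> 1 - \<alpha> (-1) \<le> D"
    and Fm: "Fm \<in> borel_measurable borel" "\<And>u. \<bar>Fm u\<bar> \<le> C" "\<And>u. 0 < u \<Longrightarrow> u\<^sup>2 < 4 * D \<Longrightarrow> Fm u = 0"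
    and Fp: "Fp \<in> borel_measurable borel" "\<And>u. \<bar>Fp u\<bar> \<le> C"
    and t: "kinetic_test \<phi> \<phi>z \<phi>v"
  shows "(LINT p:({-1..1} \<times> UNIV)|lborel. flow_density \<alpha> Fm Fp p * (snd p * \<phi>z p - E (fst p) * \<phi>v p)) =
    (LINT u:{0<..}|lborel. - u * Fp u * \<phi> (1, -u)) - (LINT u:{0<..}|lborel. u * Fm u * \<phi> (-1, u))"
proof -
  have E: "E \<in> borel_measurable borel" "\<And>x. \<bar>E x\<bar> \<le> M" using P by (auto simp: bounded_primitive_def)
  have \<phi>1: "\<phi> (1, v) = 0" if "0 < v" for v using t that by (auto simp: kinetic_test_def)
  have \<phi>2: "\<phi> (-1, v) = 0" if "v < 0" for v using t that by (auto simp: kinetic_test_def)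
  have i: "set_integrable lborel ({-1..1} \<times> UNIV) (\<lambda>p. beam \<sigma> e \<alpha> F p * (snd p * \<phi>z p - E (fst p) * \<phi>v p))"
    if "F \<in> borel_measurable borel" "\<And>u. \<bar>F u\<bar> \<le> C" for \<sigma> e F
    using kinetic_test_integrable[OF t beam_measurable[OF \<alpha> that(1)] E(1) beam_bounded[OF that(2)] E(2)]
    by (simp add: set_integrable_def)
  have 1: "(LINT p:({-1..1} \<times> UNIV)|lborel. beam 1 (\<alpha> (-1)) \<alpha> Fm p * (snd p * \<phi>z p - E (fst p) * \<phi>v p)) =
     (LINT u:{0<..}|lborel. - (u * Fm u * \<phi> (-1, u)))"
  proof (subst beam_weak_form[OF P \<alpha> t _ Fm(1,2)])
    show "Fm u = 0" if "0 < u" "z \<in> {-1..1}" "u\<^sup>2 \<le> 2 * (\<alpha> z - \<alpha> (-1))" for u z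
      using Fm(3)[OF that(1)] ord[OF that(2)] that(3) D by force
    show "(LINT u:{0<..}|lborel. 1 * u * Fm u * (\<phi> (1, 1 * sqrt (u\<^sup>2 - 2 * (\<alpha> 1 - \<alpha> (-1)))) -
        \<phi> (-1, 1 * sqrt (u\<^sup>2 - 2 * (\<alpha> (-1) - \<alpha> (-1)))))) = (LINT u:{0<..}|lborel. - (u * Fm u * \<phi> (-1, u)))"
    proof (rule set_lebesgue_integral_cong)
      show "\<forall>u. u \<in> {0<..} \<longrightarrow> 1 * u * Fm u * (\<phi> (1, 1 * sqrt (u\<^sup>2 - 2 * (\<alpha> 1 - \<alpha> (-1)))) -
        \<phi> (-1, 1 * sqrt (u\<^sup>2 - 2 * (\<alpha> (-1) - \<alpha> (-1))))) = - (u * Fm u * \<phi> (-1, u))"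
      proof (intro allI impI)
        fix u :: real assume u: "u \<in> {0<..}"
        show "1 * u * Fm u * (\<phi> (1, 1 * sqrt (u\<^sup>2 - 2 * (\<alpha> 1 - \<alpha> (-1)))) -
          \<phi> (-1, 1 * sqrt (u\<^sup>2 - 2 * (\<alpha> (-1) - \<alpha> (-1))))) = - (u * Fm u * \<phi> (-1, u))"
        proof (cases "Fm u = 0")
          case False
          then have "4 * D \<le> u\<^sup>2" using Fm(3)[of u] u by force
          then have "0 < sqrt (u\<^sup>2 - 2 * (\<alpha> 1 - \<alpha> (-1)))" using D by simp
          then show ?thesis using \<phi>1 u by simp
        qed simp
      qed
    qed simp
  qed simp
  have 2: "(LINT p:({-1..1} \<times> UNIV)|lborel. beam (-1) (\<alpha> 1) \<alpha> Fp p * (snd p * \<phi>z p - E (fst p) * \<phi>v p)) =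
     (LINT u:{0<..}|lborel. - u * Fp u * \<phi> (1, -u))"
  proof (subst beam_weak_form[OF P \<alpha> t _ Fp])
    show "Fp u = 0" if "0 < u" "z \<in> {-1..1}" "u\<^sup>2 \<le> 2 * (\<alpha> z - \<alpha> 1)" for u z
    proof -
      have "2 * (\<alpha> z - \<alpha> 1) \<le> 0" using ord[OF that(2)] by simp
      from order_trans[OF that(3) this] have "u = 0" by simp
      with that(1) show ?thesis by simp
    qed
    show "(LINT u:{0<..}|lborel. -1 * u * Fp u * (\<phi> (1, -1 * sqrt (u\<^sup>2 - 2 * (\<alpha> 1 - \<alpha> 1))) -
        \<phi> (-1, -1 * sqrt (u\<^sup>2 - 2 * (\<alpha> (-1) - \<alpha> 1))))) = (LINT u:{0<..}|lborel. - u * Fp u * \<phi> (1, -u))"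
    proof (rule set_lebesgue_integral_cong)
      show "\<forall>u. u \<in> {0<..} \<longrightarrow> -1 * u * Fp u * (\<phi> (1, -1 * sqrt (u\<^sup>2 - 2 * (\<alpha> 1 - \<alpha> 1))) -
        \<phi> (-1, -1 * sqrt (u\<^sup>2 - 2 * (\<alpha> (-1) - \<alpha> 1)))) = - u * Fp u * \<phi> (1, -u)"
      proof (intro allI impI)
        fix u :: real assume u: "u \<in> {0<..}"
        have "2 * (\<alpha> (-1) - \<alpha> 1) \<le> 0" "0 < u\<^sup>2" using ord[of 1] u by auto
        then have "2 * (\<alpha> (-1) - \<alpha> 1) < u\<^sup>2" by (rule le_less_trans)
        then have "0 < u\<^sup>2 - 2 * (\<alpha> (-1) - \<alpha> 1)" by simp
        then have "- sqrt (u\<^sup>2 - 2 * (\<alpha> (-1) - \<alpha> 1)) < 0" by simp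
        from \<phi>2[OF this] show "-1 * u * Fp u * (\<phi> (1, -1 * sqrt (u\<^sup>2 - 2 * (\<alpha> 1 - \<alpha> 1))) -
          \<phi> (-1, -1 * sqrt (u\<^sup>2 - 2 * (\<alpha> (-1) - \<alpha> 1)))) = - u * Fp u * \<phi> (1, -u)"
          using u by simp
      qed
    qed simp
  qed simp
  have "(LINT p:({-1..1} \<times> UNIV)|lborel. flow_density \<alpha> Fm Fp p * (snd p * \<phi>z p - E (fst p) * \<phi>v p)) =
    (LINT p:({-1..1} \<times> UNIV)|lborel. beam 1 (\<alpha> (-1)) \<alpha> Fm p * (snd p * \<phi>z p - E (fst p) * \<phi>v p)) +
    (LINT p:({-1..1} \<times> UNIV)|lborel. beam (-1) (\<alpha> 1) \<alpha> Fp p * (snd p * \<phi>z p - E (fst p) * \<phi>v p))"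
    unfolding flow_density_def distrib_right by (rule set_integral_add(2)[OF i[OF Fm(1,2)] i[OF Fp]])
  also have "\<dots> = (LINT u:{0<..}|lborel. - u * Fp u * \<phi> (1, -u)) - (LINT u:{0<..}|lborel. u * Fm u * \<phi> (-1, u))"
    unfolding 1 2 by (simp add: set_lebesgue_integral_def)
  finally show ?thesis .
qed

section \<open>Replacement of data, field and solution by representatives\<close>

lemma Linf_indicator_measurable:
  fixes A :: "'a::euclidean_space set"
  assumes "A \<in> sets borel" "Linf (restrict_space lborel A) g"
  shows "(\<lambda>x. indicator A x * g x) \<in> borel_measurable borel"
  using assms by (auto simp: Linf_def borel_measurable_restrict_space_iff)

lemma incoming_integral_cong:
  fixes g g0 h :: "real \<Rightarrow> real"
  assumes A[measurable]: "A \<in> sets borel" and g: "Linf (restrict_space lborel A) g"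
    and [measurable]: "g0 \<in> borel_measurable borel" "h \<in> borel_measurable borel"
    and ae: "AE x in lborel. x \<in> A \<longrightarrow> g x = g0 x"
  shows "(LINT v:A|lborel. v * g v * h v) = (LINT v:A|lborel. v * g0 v * h v)"
  unfolding set_lebesgue_integral_def
proof (rule Bochner_Integration.integral_cong_AE)
  have "(\<lambda>v. v * (indicator A v * g v) * h v) \<in> borel_measurable borel"
    using Linf_indicator_measurable[OF A g] by measurable
  then show "(\<lambda>v. indicat_real A v *\<^sub>R (v * g v * h v)) \<in> borel_measurable lborel"
    by (simp add: mult_ac)
  show "AE v in lborel. indicat_real A v *\<^sub>R (v * g v * h v) = indicat_real A v *\<^sub>R (v * g0 v * h v)"
    using ae by eventually_elim (auto simp: indicator_def)
qed measurable

lemma beam_integral: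
  assumes F[measurable]: "F \<in> borel_measurable borel" and F0: "\<And>u. 0 \<le> F u" and \<sigma>: "\<sigma> = 1 \<or> \<sigma> = -1"
    and nz: "\<And>u. 0 < u \<Longrightarrow> u\<^sup>2 \<le> 2 * (\<alpha> z - e) \<Longrightarrow> F u = 0"
    and fl: "(\<integral>\<^sup>+u. ennreal (F u * u / sqrt (u\<^sup>2 - 2 * (\<alpha> z - e))) * indicator {0<..} u \<partial>lborel) = ennreal (flux F (\<alpha> z - e))"
      "0 \<le> flux F (\<alpha> z - e)"
  shows "has_bochner_integral lborel (\<lambda>v. beam \<sigma> e \<alpha> F (z, v)) (flux F (\<alpha> z - e))"
proof (rule has_bochner_integral_nn_integral)
  show "(\<lambda>v. beam \<sigma> e \<alpha> F (z, v)) \<in> borel_measurable lborel"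
    unfolding beam_def fst_conv snd_conv by measurable
  show "AE v in lborel. 0 \<le> beam \<sigma> e \<alpha> F (z, v)" using F0 by (simp add: beam_def)
  have "(\<integral>\<^sup>+v. ennreal (beam \<sigma> e \<alpha> F (z, v)) \<partial>lborel) =
     (\<integral>\<^sup>+u. ennreal (F u * u / sqrt (u\<^sup>2 - 2 * (\<alpha> z - e))) * indicator {u. 0 < u \<and> 2 * (\<alpha> z - e) < u\<^sup>2} u \<partial>lborel)"
    by (rule nn_integral_beam[OF F \<sigma> F0])
  also have "\<dots> = (\<integral>\<^sup>+u. ennreal (F u * u / sqrt (u\<^sup>2 - 2 * (\<alpha> z - e))) * indicator {0<..} u \<partial>lborel)"
    using nz by (intro nn_integral_cong) (auto simp: indicator_def not_less)
  finally show "(\<integral>\<^sup>+v. ennreal (beam \<sigma> e \<alpha> F (z, v)) \<partial>lborel) = ennreal (flux F (\<alpha> z - e))"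
    using fl(1) by simp
qed (rule fl)

lemma nn_integral_reflect:
  assumes [measurable]: "h \<in> borel_measurable borel"
  shows "(\<integral>\<^sup>+u. h u * indicator {..<0} u \<partial>lborel) = (\<integral>\<^sup>+u. h (-u) * indicator {0<..} u \<partial>(lborel :: real measure))"
  by (subst nn_integral_real_affine[where c="-1" and t=0]) (auto intro!: nn_integral_cong simp: indicator_def)

text \<open>A null set of z on which the fields differ is a null strip in the plane, so almost
  everywhere equal fields give equal integrals.\<close>

lemma transport_AE_cong:
  fixes g g0 :: "real \<times> real \<Rightarrow> real"
  assumes t: "kinetic_test \<phi> \<phi>z \<phi>v"
    and g: "Linf phase_space g" and g0: "g0 \<in> borel_measurable borel"
    and ge: "AE p in lborel. p \<in> {-1..1} \<times> UNIV \<longrightarrow> g p = g0 p"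
    and E: "Linf slab E" and E0: "E0 \<in> borel_measurable borel" and Ee: "AE z in lborel. z \<in> {-1..1} \<longrightarrow> E z = E0 z"
  shows "(LINT p:({-1..1} \<times> UNIV)|lborel. g p * (snd p * \<phi>z p - E (fst p) * \<phi>v p)) =
    (LINT p:({-1..1} \<times> UNIV)|lborel. g0 p * (snd p * \<phi>z p - E0 (fst p) * \<phi>v p))"
  unfolding set_lebesgue_integral_def
proof (rule Bochner_Integration.integral_cong_AE)
  have A: "({-1..1} \<times> UNIV :: (real \<times> real) set) \<in> sets borel" by (intro borel_Times) auto
  note m = kinetic_test_measurable[OF t] Linf_indicator_measurable[OF A g]
    measurable_compose[OF continuous_fst_borel Linf_indicator_measurable[OF _ E]]
    measurable_compose[OF continuous_fst_borel E0]
  have "(\<lambda>p. (indicat_real ({-1..1} \<times> UNIV) p * g p) *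
      (snd p * \<phi>z p - (indicat_real {-1..1} (fst p) * E (fst p)) * \<phi>v p)) \<in> borel_measurable borel"
    by (intro borel_measurable_times borel_measurable_diff m continuous_snd_borel) auto
  also have "(\<lambda>p. (indicat_real ({-1..1} \<times> UNIV) p * g p) *
      (snd p * \<phi>z p - (indicat_real {-1..1} (fst p) * E (fst p)) * \<phi>v p)) =
      (\<lambda>p. indicat_real ({-1..1} \<times> UNIV) p *\<^sub>R (g p * (snd p * \<phi>z p - E (fst p) * \<phi>v p)))"
    by (auto simp: indicator_def mem_Times_iff)
  finally show "(\<lambda>p. indicat_real ({-1..1} \<times> UNIV) p *\<^sub>R (g p * (snd p * \<phi>z p - E (fst p) * \<phi>v p))) \<in> borel_measurable lborel"
    by simp
  have "(\<lambda>p. indicat_real ({-1..1} \<times> UNIV) p * (g0 p * (snd p * \<phi>z p - E0 (fst p) * \<phi>v p))) \<in> borel_measurable borel"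
    by (intro borel_measurable_times borel_measurable_diff m continuous_snd_borel g0 borel_measurable_indicator A)
  then show "(\<lambda>p. indicat_real ({-1..1} \<times> UNIV) p *\<^sub>R (g0 p * (snd p * \<phi>z p - E0 (fst p) * \<phi>v p))) \<in> borel_measurable lborel"
    by simp
  show "AE p in lborel. indicat_real ({-1..1} \<times> UNIV) p *\<^sub>R (g p * (snd p * \<phi>z p - E (fst p) * \<phi>v p)) =
     indicat_real ({-1..1} \<times> UNIV) p *\<^sub>R (g0 p * (snd p * \<phi>z p - E0 (fst p) * \<phi>v p))"
    using ge AE_lborel_fst[OF Ee] by eventually_elim (auto simp: indicator_def mem_Times_iff)
qed

text \<open>Agreement at every point of the open interval transfers measurability along with
  integrability. This suits \<open>rho f z / n z\<close>, which is controlled only inside the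
  slab.\<close>

lemma weak_deriv_cong_on:
  assumes "weak_deriv {-1<..<1} u g" "\<And>x. x \<in> {-1<..<1} \<Longrightarrow> u x = u' x"
  shows "weak_deriv {-1<..<1} u' g"
proof -
  have eq: "indicat_real K x *\<^sub>R u' x = indicat_real K x *\<^sub>R u x" if "K \<subseteq> {-1<..<1}" for K x
    using assms(2)[of x] that by (auto simp: indicator_def)
  have "locally_integrable_on {-1<..<1} u'"
    unfolding locally_integrable_on_def
  proof (intro allI impI)
    fix K :: "real set" assume K: "compact K \<and> K \<subseteq> {-1<..<1}"
    then have "set_integrable lborel K u"
      using assms(1) unfolding weak_deriv_def locally_integrable_on_def by blast
    moreover have "(\<lambda>x. indicat_real K x *\<^sub>R u' x) = (\<lambda>x. indicat_real K x *\<^sub>R u x)"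
      using eq K by blast
    ultimately show "set_integrable lborel K u'" by (simp only: set_integrable_def)
  qed
  moreover have "(LINT x:{-1<..<1}|lborel. u' x * h x) = (LINT x:{-1<..<1}|lborel. u x * h x)" for h
    by (rule set_lebesgue_integral_cong) (auto simp: assms(2))
  ultimately show ?thesis using assms(1) by (simp add: weak_deriv_def)
qed

text \<open>The reflection u = -v turns the boundary term at z = 1 into an integral over speeds, and
  the data may be exchanged for their representatives under the integral.\<close>

lemma flow_density_transport:
  assumes P: "bounded_primitive M E \<alpha>" and \<alpha>: "\<alpha> \<in> borel_measurable borel"
    and ord: "\<And>z. z \<in> {-1..1} \<Longrightarrow> \<alpha> (-1) \<le> \<alpha> z \<and> \<alpha> z \<le> \<alpha> 1" and D: "0 < D" "\<alpha> 1 - \<alpha> (-1) \<le> D"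
    and Fm: "Fm \<in> borel_measurable borel" "\<And>u. \<bar>Fm u\<bar> \<le> C" "\<And>u. 0 < u \<Longrightarrow> u\<^sup>2 < 4 * D \<Longrightarrow> Fm u = 0"
    and Fp: "Fp \<in> borel_measurable borel" "\<And>u. \<bar>Fp u\<bar> \<le> C"
    and fm: "Linf (restrict_space lborel {0<..}) fm" "AE u in lborel. u \<in> {0<..} \<longrightarrow> fm u = Fm u"
    and fp: "Linf (restrict_space lborel {..<0}) fp" "AE u in lborel. u \<in> {..<0} \<longrightarrow> fp u = Fp (-u)"
  shows "weak_transport_solution E fm fp (flow_density \<alpha> Fm Fp)"
  unfolding weak_transport_solution_def
proof (intro allI impI)
  fix \<phi> \<phi>z \<phi>v assume t: "kinetic_test \<phi> \<phi>z \<phi>v"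
  have m\<phi>: "(\<lambda>v. \<phi> (a, v)) \<in> borel_measurable borel" for a :: real
  proof -
    have "(\<lambda>v. (a, v)) \<in> borel \<rightarrow>\<^sub>M borel" by (intro borel_measurable_continuous_onI continuous_intros)
    from measurable_compose[OF this kinetic_test_measurable(1)[OF t]] show ?thesis .
  qed
  have mFp: "(\<lambda>u. Fp (- u)) \<in> borel_measurable borel" using Fp(1) by measurable
  have "(LINT v:{0<..}|lborel. v * fm v * \<phi> (-1, v)) = (LINT v:{0<..}|lborel. v * Fm v * \<phi> (-1, v))"
    by (rule incoming_integral_cong[OF _ fm(1) Fm(1) m\<phi> fm(2)]) simp
  moreover have "(LINT v:{..<0}|lborel. v * fp v * \<phi> (1, v)) = (LINT v:{..<0}|lborel. v * Fp (-v) * \<phi> (1, v))"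
    by (rule incoming_integral_cong[OF _ fp(1) mFp m\<phi> fp(2)]) simp
  moreover have "\<dots> = (LINT u:{0<..}|lborel. - u * Fp u * \<phi> (1, -u))"
    unfolding set_lebesgue_integral_def
    by (subst lborel_integral_real_affine[where c="-1" and t=0])
       (auto intro!: Bochner_Integration.integral_cong simp: indicator_def)
  ultimately show "(LINT p:({-1..1} \<times> UNIV)|lborel. flow_density \<alpha> Fm Fp p * (snd p * \<phi>z p - E (fst p) * \<phi>v p)) =
    (LINT v:{..<0}|lborel. v * fp v * \<phi> (1, v)) - (LINT v:{0<..}|lborel. v * fm v * \<phi> (-1, v))"
    using flow_density_weak_form[OF P \<alpha> ord D Fm Fp t] by simp
qed

lemma flow_density_measurable:
  assumes "\<alpha> \<in> borel_measurable borel" "Fm \<in> borel_measurable borel" "Fp \<in> borel_measurable borel"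
  shows "flow_density \<alpha> Fm Fp \<in> borel_measurable borel"
  using assms unfolding flow_density_def[abs_def] by (intro borel_measurable_add beam_measurable)

lemma flow_density_bounded:
  assumes "\<And>u. \<bar>Fm u\<bar> \<le> C" "\<And>u. \<bar>Fp u\<bar> \<le> C"
  shows "\<bar>flow_density \<alpha> Fm Fp p\<bar> \<le> 2 * C"
  unfolding flow_density_def
  using abs_triangle_ineq[of "beam 1 (\<alpha> (-1)) \<alpha> Fm p" "beam (-1) (\<alpha> 1) \<alpha> Fp p"]
    beam_bounded[where C=C and F=Fm and \<sigma>=1 and e="\<alpha> (-1)" and \<alpha>=\<alpha> and p=p, OF assms(1)]
    beam_bounded[where C=C and F=Fp and \<sigma>="-1" and e="\<alpha> 1" and \<alpha>=\<alpha> and p=p, OF assms(2)] by linarith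

text \<open>After passage to representatives, the difference from the explicit solution satisfies
  the same weak equation with zero boundary data.\<close>

lemma transport_solution_unique:
  fixes \<alpha> :: "real \<Rightarrow> real"
  assumes P: "bounded_primitive M E0 \<alpha>" and ca: "continuous_on UNIV \<alpha>"
    and mono: "\<And>x y. -1 \<le> x \<Longrightarrow> x \<le> y \<Longrightarrow> y \<le> 1 \<Longrightarrow> \<alpha> x \<le> \<alpha> y"
    and D: "0 < D" "\<alpha> 1 - \<alpha> (-1) \<le> D"
    and Fm: "Fm \<in> borel_measurable borel" "\<And>u. \<bar>Fm u\<bar> \<le> C" "\<And>u. 0 < u \<Longrightarrow> u\<^sup>2 < 4 * D \<Longrightarrow> Fm u = 0"
    and Fp: "Fp \<in> borel_measurable borel" "\<And>u. \<bar>Fp u\<bar> \<le> C"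
    and fm: "Linf (restrict_space lborel {0<..}) fm" "AE u in lborel. u \<in> {0<..} \<longrightarrow> fm u = Fm u"
    and fp: "Linf (restrict_space lborel {..<0}) fp" "AE u in lborel. u \<in> {..<0} \<longrightarrow> fp u = Fp (-u)"
    and E: "Linf slab E" and Ee: "AE z in lborel. z \<in> {-1..1} \<longrightarrow> E z = E0 z"
    and g: "Linf phase_space g" and sol: "weak_transport_solution E fm fp g"
  shows "AE p in lborel. p \<in> {-1..1} \<times> UNIV \<longrightarrow> g p = flow_density \<alpha> Fm Fp p"
proof -
  have A: "({-1..1} \<times> UNIV :: (real \<times> real) set) \<in> sets borel" by (intro borel_Times) auto
  have \<alpha>: "\<alpha> \<in> borel_measurable borel" using ca by (rule borel_measurable_continuous_onI)
  have E0: "E0 \<in> borel_measurable borel" "\<And>x. \<bar>E0 x\<bar> \<le> M" using P by (auto simp: bounded_primitive_def)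
  have ord: "\<alpha> (-1) \<le> \<alpha> z \<and> \<alpha> z \<le> \<alpha> 1" if "z \<in> {-1..1}" for z using mono[of "-1" z] mono[of z 1] that by auto
  obtain g0 N where g0: "g0 \<in> borel_measurable borel" "\<And>p. \<bar>g0 p\<bar> \<le> N"
    and ge: "AE p in lborel. p \<in> {-1..1} \<times> UNIV \<longrightarrow> g p = g0 p"
    by (rule Linf_representative[OF A g]) blast
  let ?f = "flow_density \<alpha> Fm Fp"
  have fb: "?f \<in> borel_measurable borel" "\<And>p. \<bar>?f p\<bar> \<le> 2 * C"
    using flow_density_measurable[OF \<alpha> Fm(1) Fp(1)] flow_density_bounded[OF Fm(2) Fp(2)] by auto
  have fs: "weak_transport_solution E0 fm fp ?f"
    by (rule flow_density_transport[OF P \<alpha> ord D Fm Fp fm fp])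
  have "AE p in lborel. fst p \<in> {-1..1} \<longrightarrow> g0 p - ?f p = 0"
  proof (rule homogeneous_transport_zero[OF P ca mono])
    show "(\<lambda>p. g0 p - ?f p) \<in> borel_measurable borel" using g0(1) fb(1) by (rule borel_measurable_diff)
    show "\<bar>g0 p - ?f p\<bar> \<le> N + 2 * C" for p using g0(2)[of p] fb(2)[of p] by linarith
    fix \<phi> \<phi>z \<phi>v assume t: "kinetic_test \<phi> \<phi>z \<phi>v"
    have i: "set_integrable lborel ({-1..1} \<times> UNIV) (\<lambda>p. h p * (snd p * \<phi>z p - E0 (fst p) * \<phi>v p))"
      if "h \<in> borel_measurable borel" "\<And>p. \<bar>h p\<bar> \<le> K" for h K
      using kinetic_test_integrable[OF t that(1) E0(1) that(2) E0(2)] by (simp add: set_integrable_def)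
    have "(LINT p:({-1..1} \<times> UNIV)|lborel. g0 p * (snd p * \<phi>z p - E0 (fst p) * \<phi>v p)) =
       (LINT p:({-1..1} \<times> UNIV)|lborel. g p * (snd p * \<phi>z p - E (fst p) * \<phi>v p))"
      by (rule transport_AE_cong[OF t g g0(1) ge E E0(1) Ee, symmetric])
    also have "\<dots> = (LINT v:{..<0}|lborel. v * fp v * \<phi> (1, v)) - (LINT v:{0<..}|lborel. v * fm v * \<phi> (-1, v))"
      by (rule sol[unfolded weak_transport_solution_def, rule_format, OF t])
    also have "\<dots> = (LINT p:({-1..1} \<times> UNIV)|lborel. ?f p * (snd p * \<phi>z p - E0 (fst p) * \<phi>v p))"
      by (rule fs[unfolded weak_transport_solution_def, rule_format, OF t, symmetric])
    finally show "(LINT p:({-1..1} \<times> UNIV)|lborel. (g0 p - ?f p) * (snd p * \<phi>z p - E0 (fst p) * \<phi>v p)) = 0"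
      unfolding left_diff_distrib[of "g0 _"] by (subst set_integral_diff(2)[OF i[OF g0] i[OF fb]]) simp
  qed
  with ge show ?thesis by eventually_elim auto
qed

theorem theorem2p3:
  fixes n n' fm fp :: "real \<Rightarrow> real"
  assumes n_pos: "\<forall>z\<in>{-1..1}. 0 < n z"
    and n_cont: "continuous_on {-1..1} n"
    and n_deriv: "weak_deriv {-1<..<1} n n'"
    and n_Linf: "Linf slab (\<lambda>z. n' z / (n z)\<^sup>2)"
    and fm_nonneg: "\<forall>u>0. 0 \<le> fm u"
    and fm_Linf: "Linf (restrict_space lborel {0<..}) fm"
    and fp_nonneg: "\<forall>u<0. 0 \<le> fp u"
    and fp_Linf: "Linf (restrict_space lborel {..<0}) fp"
    and fp_finite: "(\<integral>\<^sup>+u\<in>{..<0}. ennreal (fp u) \<partial>lborel) < \<infinity>"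
    and i: "AE z in slab. n' z \<le> 0"
    and ii: "lambda_const fm < \<infinity>"
    and iii: "AE u in lborel. 0 < u \<and> u < 2 * sqrt (2 * mu_const fm fp / n 1) \<longrightarrow> fm u = 0"
    and iv_mass: "(\<integral>\<^sup>+u\<in>{0<..}. ennreal (fm u) \<partial>lborel) < (\<integral>\<^sup>+u\<in>{..<0}. ennreal (fp u) \<partial>lborel)"
    and iv_sing: "(\<integral>\<^sup>+u\<in>{..<0}. ennreal (fp u / u\<^sup>2) \<partial>lborel) < ennreal (n 1 / 4)"
  shows "\<exists>f. (kinetic_solution n fm fp f \<and>
              AE_represents (K_set n n' (mu_const fm fp)) (\<lambda>z. rho f z / n z)) \<and>
             (\<forall>g. kinetic_solution n fm fp g \<and>
                  AE_represents (K_set n n' (mu_const fm fp)) (\<lambda>z. rho g z / n z) \<longrightarrow>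
                  (AE p in phase_space. g p = f p))"
proof -

  \<comment> \<open>Constants and monotonicity of n\<close>
  have A: "({-1..1} \<times> UNIV :: (real \<times> real) set) \<in> sets borel" by (intro borel_Times) auto
  have I: "{-1..1::real} \<in> sets borel" by simp
  have n1: "0 < n 1" using n_pos by simp
  define \<mu> where "\<mu> = mu_const fm fp"
  define m where "m = Linf_norm slab (\<lambda>z. n' z / (n z)\<^sup>2)"
  have m0: "0 \<le> m" unfolding m_def by (rule Linf_norm_slab_nonneg)
  have dec: "n y \<le> n x \<and> n x - n y \<le> m * (n x)\<^sup>2 * (y - x)" if "-1 \<le> x" "x \<le> y" "y \<le> 1" for x y
    unfolding m_def using equilibrium_density_facts[OF n_pos n_cont n_deriv n_Linf i that] by blast
  have nm: "n 1 \<le> n z" if "z \<in> {-1..1}" for z using dec[of z 1] that by simp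

  define \<Lambda> where "\<Lambda> = enn2real (lambda_const fm)"
  define P where "P = enn2real (\<integral>\<^sup>+u\<in>{..<0}. ennreal (fp u) \<partial>lborel)"
  have lam: "lambda_const fm = ennreal \<Lambda>" and \<Lambda>0: "0 \<le> \<Lambda>" using ii by (simp_all add: \<Lambda>_def)
  have fpP: "(\<integral>\<^sup>+u\<in>{..<0}. ennreal (fp u) \<partial>lborel) = ennreal P" and P0: "0 \<le> P"
    using fp_finite by (simp_all add: P_def)
  \<comment> \<open>The strict mass inequality makes the mass of \<open>fp\<close> positive; hence
    \<mu> and \<open>D\<close> are positive.\<close>
  have "0 < (\<integral>\<^sup>+u\<in>{..<0}. ennreal (fp u) \<partial>lborel)" using iv_mass by (rule le_less_trans[rotated]) simp
  then have Ppos: "0 < P" unfolding fpP by (simp add: ennreal_less_zero_iff)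
  have \<mu>: "\<mu> = P + \<Lambda>"
    unfolding \<mu>_def mu_const_def lam fpP using P0 \<Lambda>0 by (simp flip: ennreal_plus)
  have \<mu>0: "0 < \<mu>" using \<mu> Ppos \<Lambda>0 by simp
  \<comment> \<open>The bound on \<alpha>(1) - \<alpha>(-1) in \<open>K_set\<close>. In these terms
    (iii) reads fm(u) = 0 for 0 < u < 2 sqrt(D), that is u^2 < 4D.\<close>
  define D where "D = 2 * \<mu> / n 1"
  have D0: "0 < D" using \<mu>0 n1 by (simp add: D_def)

  \<comment> \<open>Borel representatives of the incoming data\<close>
  obtain gm Cm where gm: "gm \<in> borel_measurable borel" "0 \<le> Cm" "\<And>u. \<bar>gm u\<bar> \<le> Cm"
    "AE u in lborel. u \<in> {0<..} \<longrightarrow> fm u = gm u" "\<And>u. (u \<in> {0<..} \<Longrightarrow> 0 \<le> fm u) \<Longrightarrow> 0 \<le> gm u"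
    by (rule Linf_representative[OF _ fm_Linf]) (simp, blast)
  obtain gp Cp where gp: "gp \<in> borel_measurable borel" "0 \<le> Cp" "\<And>u. \<bar>gp u\<bar> \<le> Cp"
    "AE u in lborel. u \<in> {..<0} \<longrightarrow> fp u = gp u" "\<And>u. (u \<in> {..<0} \<Longrightarrow> 0 \<le> fp u) \<Longrightarrow> 0 \<le> gp u"
    by (rule Linf_representative[OF _ fp_Linf]) (simp, blast)
  define C where "C = max Cm Cp"
  \<comment> \<open>(iii) holds almost everywhere; resetting the representative makes it hold at
    every u > 0. \<open>Fp\<close> is reflected so that both profiles are functions of the
    speed.\<close>
  define Fm where "Fm u = (if 0 < u \<and> u\<^sup>2 < 4 * D then 0 else gm u)" for u
  define Fp where "Fp u = gp (- u)" for u
  have Fm: "Fm \<in> borel_measurable borel" "\<And>u. \<bar>Fm u\<bar> \<le> C" "\<And>u. 0 < u \<Longrightarrow> u\<^sup>2 < 4 * D \<Longrightarrow> Fm u = 0"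
    and Fm0: "\<And>u. 0 \<le> Fm u"
  proof -
    note [measurable] = gm(1)
    show "Fm \<in> borel_measurable borel" unfolding Fm_def by measurable
    show "\<bar>Fm u\<bar> \<le> C" for u using gm(2) gm(3)[of u] by (auto simp: Fm_def C_def)
    show "0 \<le> Fm u" for u using gm(5) fm_nonneg by (auto simp: Fm_def)
  qed (simp add: Fm_def)
  have Fp: "Fp \<in> borel_measurable borel" "\<And>u. \<bar>Fp u\<bar> \<le> C" and Fp0: "\<And>u. 0 \<le> Fp u"
  proof -
    note [measurable] = gp(1)
    show "Fp \<in> borel_measurable borel" unfolding Fp_def by measurable
    show "\<bar>Fp u\<bar> \<le> C" for u using gp(3)[of "-u"] by (auto simp: Fp_def C_def)
    show "0 \<le> Fp u" for u using gp(5) fp_nonneg by (auto simp: Fp_def)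
  qed
  have fmF: "AE u in lborel. u \<in> {0<..} \<longrightarrow> fm u = Fm u"
    using gm(4) iii
  proof eventually_elim
    case (elim u)
    show ?case
    proof
      assume u: "u \<in> {0<..}"
      show "fm u = Fm u"
      proof (cases "u\<^sup>2 < 4 * D")
        case True
        have "u\<^sup>2 < (2 * sqrt D)\<^sup>2" using True D0 by (simp add: power_mult_distrib)
        then have "u < 2 * sqrt D" using D0 by (intro power_less_imp_less_base[of u 2]) auto
        then show ?thesis using elim(2) u True by (simp add: Fm_def D_def \<mu>_def)
      next
        case False
        then show ?thesis using elim(1) u by (simp add: Fm_def)
      qed
    qed
  qed
  have fpF: "AE u in lborel. u \<in> {..<0} \<longrightarrow> fp u = Fp (-u)"
    using gp(4) by (simp add: Fp_def)

  \<comment> \<open>Bounds and slopes of the two fluxes\<close>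
  have bd_left: "(\<integral>\<^sup>+u. ennreal (Fm u * u / sqrt (u\<^sup>2 - 2 * y)) * indicator {0<..} u \<partial>lborel) \<le> ennreal \<Lambda>"
    if y: "0 \<le> y" "y \<le> D" for y
  proof -
    \<comment> \<open>This is (ii) at x = 2y. The integral in (ii) starts at sqrt(2y); the range
      below contributes nothing because \<open>Fm\<close> vanishes up to 2 sqrt(D).\<close>
    have "(\<integral>\<^sup>+u. ennreal (Fm u * u / sqrt (u\<^sup>2 - 2 * y)) * indicator {0<..} u \<partial>lborel) \<le>
      (\<integral>\<^sup>+u. ennreal (u * fm u / sqrt (u\<^sup>2 - 2 * y)) * indicator {sqrt (2 * y)<..} u \<partial>lborel)"
    proof (rule nn_integral_mono_AE)
      show "AE u in lborel. ennreal (Fm u * u / sqrt (u\<^sup>2 - 2 * y)) * indicator {0<..} u \<le>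
        ennreal (u * fm u / sqrt (u\<^sup>2 - 2 * y)) * indicator {sqrt (2 * y)<..} u"
        using fmF
      proof eventually_elim
        case (elim u)
        consider "u \<le> 0" | "0 < u" "u \<le> sqrt (2 * y)" | "0 < u" "sqrt (2 * y) < u" by linarith
        then show ?case
        proof cases
          case 2
          then have "u\<^sup>2 \<le> (sqrt (2 * y))\<^sup>2" by (intro power_mono) auto
          then have "u\<^sup>2 < 4 * D" using y D0 by simp
          then have "Fm u = 0" using Fm(3) 2 by blast
          then show ?thesis by simp
        next
          case 3
          then show ?thesis using elim by (simp add: mult.commute)
        qed simp
      qed
    qed
    also have "\<dots> \<le> lambda_const fm"
      unfolding lambda_const_def using y by (intro SUP_upper2[of "2 * y"]) auto
    finally show ?thesis by (simp add: lam)
  qed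
  \<comment> \<open>The threshold in (iii) is tuned to this: 1/(2D) = n(1)/(4\<mu>), and \<Lambda>
    \<le> \<mu>.\<close>
  have \<Lambda>k: "\<Lambda> / (2 * D) \<le> n 1 / 4"
  proof -
    have "\<Lambda> / (2 * D) = (n 1 / 4) * (\<Lambda> / \<mu>)" using n1 \<mu>0 by (simp add: D_def)
    also have "\<dots> \<le> (n 1 / 4) * 1" using n1 \<mu> \<mu>0 P0 by (intro mult_left_mono) auto
    finally show ?thesis by simp
  qed
  have left: "\<And>y. 0 \<le> y \<Longrightarrow> y \<le> D \<Longrightarrow> 0 \<le> flux Fm y \<and> flux Fm y \<le> \<Lambda>"
    "\<And>x y. 0 \<le> x \<Longrightarrow> x \<le> y \<Longrightarrow> y \<le> D \<Longrightarrow> flux Fm x \<le> flux Fm y \<and> flux Fm y - flux Fm x \<le> n 1 / 4 * (y - x)"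
    "\<And>y. 0 \<le> y \<Longrightarrow> y \<le> D \<Longrightarrow> (\<integral>\<^sup>+u. ennreal (Fm u * u / sqrt (u\<^sup>2 - 2 * y)) * indicator {0<..} u \<partial>lborel) = ennreal (flux Fm y)"
    by (rule left_flux[OF Fm(1) Fm0 D0 Fm(3) bd_left \<Lambda>0 \<Lambda>k]; assumption)+
  have [measurable]: "gp \<in> borel_measurable borel" by (rule gp(1))
  have bd_right: "(\<integral>\<^sup>+u. ennreal (Fp u) * indicator {0<..} u \<partial>lborel) \<le> ennreal P"
  proof -
    have "(\<integral>\<^sup>+u. ennreal (Fp u) * indicator {0<..} u \<partial>lborel) = (\<integral>\<^sup>+u. ennreal (gp u) * indicator {..<0} u \<partial>lborel)"
      unfolding Fp_def by (rule nn_integral_reflect[symmetric]) measurable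
    also have "\<dots> = (\<integral>\<^sup>+u\<in>{..<0}. ennreal (fp u) \<partial>lborel)"
      using gp(4) by (intro nn_integral_cong_AE) (auto elim!: eventually_mono simp: indicator_def)
    finally show ?thesis by (simp add: fpP)
  qed
  have sing_right: "(\<integral>\<^sup>+u. ennreal (Fp u / u\<^sup>2) * indicator {0<..} u \<partial>lborel) \<le> ennreal (n 1 / 4)"
  proof -
    have "(\<integral>\<^sup>+u. ennreal (Fp u / u\<^sup>2) * indicator {0<..} u \<partial>lborel) =
        (\<integral>\<^sup>+u. ennreal (gp (-u) / (-u)\<^sup>2) * indicator {0<..} u \<partial>lborel)" by (simp add: Fp_def)
    also have "\<dots> = (\<integral>\<^sup>+u. ennreal (gp u / u\<^sup>2) * indicator {..<0} u \<partial>lborel)"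
      by (rule nn_integral_reflect[symmetric]) measurable
    also have "\<dots> = (\<integral>\<^sup>+u\<in>{..<0}. ennreal (fp u / u\<^sup>2) \<partial>lborel)"
      using gp(4) by (intro nn_integral_cong_AE) (auto elim!: eventually_mono simp: indicator_def)
    finally show ?thesis using iv_sing by simp
  qed
  have n14: "0 \<le> n 1 / 4" using n1 by simp
  note right = right_flux[OF Fp(1) Fp0 bd_right P0 sing_right n14]

  \<comment> \<open>Density of the explicit solution\<close>
  have flow: "integrable lborel (\<lambda>v. flow_density \<alpha> Fm Fp (z, v)) \<and>
      rho (flow_density \<alpha> Fm Fp) z = flux Fm (\<alpha> z - \<alpha> (-1)) + flux Fp (\<alpha> z - \<alpha> 1)"
    if z: "\<alpha> (-1) \<le> \<alpha> z" "\<alpha> z \<le> \<alpha> 1" "\<alpha> 1 - \<alpha> (-1) \<le> D" for \<alpha> z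
  proof -
    have y: "0 \<le> \<alpha> z - \<alpha> (-1)" "\<alpha> z - \<alpha> (-1) \<le> D" "\<alpha> z - \<alpha> 1 \<le> 0" using z by linarith+
    have nz: "Fm u = 0" if "0 < u" "u\<^sup>2 \<le> 2 * (\<alpha> z - \<alpha> (-1))" for u
      using Fm(3)[OF that(1)] that(2) y(2) D0 by simp
    have nz': "Fp u = 0" if "0 < u" "u\<^sup>2 \<le> 2 * (\<alpha> z - \<alpha> 1)" for u
    proof -
      have "u\<^sup>2 \<le> 0" using order_trans[OF that(2), of 0] y(3) by simp
      then show ?thesis using that(1) by simp
    qed
    have "has_bochner_integral lborel (\<lambda>v. beam 1 (\<alpha> (-1)) \<alpha> Fm (z, v)) (flux Fm (\<alpha> z - \<alpha> (-1)))"
      by (rule beam_integral[where F=Fm and \<alpha>=\<alpha> and z=z and e="\<alpha> (-1)" and \<sigma>=1, OF Fm(1) Fm0 _ nz left(3)[OF y(1,2)]]) (use left(1)[OF y(1,2)] in auto)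
    moreover have "has_bochner_integral lborel (\<lambda>v. beam (-1) (\<alpha> 1) \<alpha> Fp (z, v)) (flux Fp (\<alpha> z - \<alpha> 1))"
      by (rule beam_integral[where F=Fp and \<alpha>=\<alpha> and z=z and e="\<alpha> 1" and \<sigma>="-1", OF Fp(1) Fp0 _ nz' right(3)[OF y(3)]]) (use right(1)[OF y(3)] in auto)
    ultimately have "has_bochner_integral lborel (\<lambda>v. flow_density \<alpha> Fm Fp (z, v))
        (flux Fm (\<alpha> z - \<alpha> (-1)) + flux Fp (\<alpha> z - \<alpha> 1))"
      unfolding flow_density_def by (rule has_bochner_integral_add)
    then show ?thesis by (simp add: has_bochner_integral_iff rho_def)
  qed

  \<comment> \<open>Existence of a profile and of a solution\<close>
  have "\<exists>a. (\<forall>z\<in>{-1..1}. n z * a z = flux Fm (a z - a (-1)) + flux Fp (a z - a 1)) \<and>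
     (\<forall>z\<in>{-1..1}. 0 \<le> a z \<and> a (-1) \<le> a z \<and> a z \<le> a 1) \<and> a 1 - a (-1) \<le> D \<and>
     (\<forall>x y. -1 \<le> x \<and> x \<le> y \<and> y \<le> 1 \<longrightarrow> 0 \<le> a y - a x \<and> a y - a x \<le> 2 * \<mu> * ((n x - n y) / (n x * n y)))"
  proof (rule density_profile_exists[of n \<mu> D, OF n1 _ \<mu>0 D_def])
    show "n y \<le> n x" if "-1 \<le> x" "x \<le> y" "y \<le> 1" for x y using dec[OF that] by blast
    show "flux Fm x + flux Fp y \<le> \<mu>" if "0 \<le> x" "x \<le> D" "-D \<le> y" "y \<le> 0" for x y
      using left(1)[OF that(1,2)] right(1)[OF that(4)] \<mu> by linarith
  qed (use left(1,2) right(1,2) in auto)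
  then obtain a where a: "(\<forall>z\<in>{-1..1}. n z * a z = flux Fm (a z - a (-1)) + flux Fp (a z - a 1)) \<and>
     (\<forall>z\<in>{-1..1}. 0 \<le> a z \<and> a (-1) \<le> a z \<and> a z \<le> a 1) \<and> a 1 - a (-1) \<le> D \<and>
     (\<forall>x y. -1 \<le> x \<and> x \<le> y \<and> y \<le> 1 \<longrightarrow> 0 \<le> a y - a x \<and> a y - a x \<le> 2 * \<mu> * ((n x - n y) / (n x * n y)))"
    by (rule exE)
  from a have a_eq: "\<And>z. z \<in> {-1..1} \<Longrightarrow> n z * a z = flux Fm (a z - a (-1)) + flux Fp (a z - a 1)"
    and a_ord: "\<And>z. z \<in> {-1..1} \<Longrightarrow> 0 \<le> a z \<and> a (-1) \<le> a z \<and> a z \<le> a 1" and aD: "a 1 - a (-1) \<le> D"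
    and a_inc: "\<And>x y. -1 \<le> x \<Longrightarrow> x \<le> y \<Longrightarrow> y \<le> 1 \<Longrightarrow> 0 \<le> a y - a x \<and> a y - a x \<le> 2 * \<mu> * ((n x - n y) / (n x * n y))"
    by blast+
  \<comment> \<open>The profile is extended by its end values, so that it is a continuous, hence
    Borel, potential on the whole line.\<close>
  define cl where "cl x = max (-1) (min 1 x)" for x :: real
  have cl: "cl x \<in> {-1..1}" "x \<in> {-1..1} \<Longrightarrow> cl x = x" for x by (auto simp: cl_def)
  define \<alpha> where "\<alpha> x = a (cl x)" for x
  have \<alpha>a: "\<alpha> x = a x" if "x \<in> {-1..1}" for x using cl(2)[OF that] by (simp add: \<alpha>_def)
  have \<alpha>_ends: "\<alpha> (-1) = a (-1)" "\<alpha> 1 = a 1" by (simp_all add: \<alpha>a)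
  have \<alpha>_eq: "n z * \<alpha> z = flux Fm (\<alpha> z - \<alpha> (-1)) + flux Fp (\<alpha> z - \<alpha> 1)" if "z \<in> {-1..1}" for z
    using a_eq[OF that] by (simp only: \<alpha>a[OF that] \<alpha>_ends)
  have \<alpha>_ord: "0 \<le> \<alpha> z" "\<alpha> (-1) \<le> \<alpha> z \<and> \<alpha> z \<le> \<alpha> 1" if "z \<in> {-1..1}" for z
    using a_ord[OF that] by (simp_all only: \<alpha>a[OF that] \<alpha>_ends)
  have \<alpha>D: "\<alpha> 1 - \<alpha> (-1) \<le> D" using aD by (simp add: \<alpha>_ends)
  have \<alpha>_inc: "0 \<le> \<alpha> y - \<alpha> x \<and> \<alpha> y - \<alpha> x \<le> 4 * \<mu> * m * (y - x)" if "-1 \<le> x" "x \<le> y" "y \<le> 1" for x y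
  proof -
    have "a y - a x \<le> 4 * \<mu> * m * (y - x)"
      by (rule profile_lipschitz[OF n_pos n_cont dec _ m0 _ that]) (use a_inc \<mu>0 in auto)
    moreover have "\<alpha> x = a x" "\<alpha> y = a y" using \<alpha>a[of x] \<alpha>a[of y] that by auto
    ultimately show ?thesis using a_inc[OF that] by simp
  qed
  obtain E where P: "bounded_primitive (4 * \<mu> * m) E \<alpha>" and E0: "\<And>x. 0 \<le> E x"
    using mono_lipschitz_imp_bounded_primitive[OF \<alpha>_inc] by blast
  have E: "E \<in> borel_measurable borel" "\<And>x. \<bar>E x\<bar> \<le> 4 * \<mu> * m" using P by (auto simp: bounded_primitive_def)
  have clamp_cont: "continuous_on UNIV (\<lambda>x. h (cl x))" if "continuous_on {-1..1} h" for h :: "real \<Rightarrow> real"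
    by (rule continuous_on_compose2[OF that]) (auto simp: cl_def intro!: continuous_intros)
  have c\<alpha>: "continuous_on UNIV \<alpha>"
  proof -
    have "continuous_on UNIV (\<lambda>x. \<alpha> (cl x))"
      using bounded_primitive_continuous[OF P] by (rule clamp_cont)
    moreover have "\<alpha> (cl x) = \<alpha> x" for x by (simp add: \<alpha>_def cl(2)[OF cl(1)])
    ultimately show ?thesis by simp
  qed
  have m\<alpha>: "\<alpha> \<in> borel_measurable borel" using c\<alpha> by (rule borel_measurable_continuous_onI)
  define f where "f = flow_density \<alpha> Fm Fp"
  have f_rho: "integrable lborel (\<lambda>v. f (z, v))" "rho f z / n z = \<alpha> z" if z: "z \<in> {-1..1}" for z
  proof -
    have *: "integrable lborel (\<lambda>v. f (z, v)) \<and> rho f z = flux Fm (\<alpha> z - \<alpha> (-1)) + flux Fp (\<alpha> z - \<alpha> 1)"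
      unfolding f_def by (rule flow) (use \<alpha>_ord(2)[OF z] \<alpha>D in auto)
    then show "integrable lborel (\<lambda>v. f (z, v))" ..
    have "rho f z = n z * \<alpha> z" using * \<alpha>_eq[OF z] by simp
    moreover have "n z \<noteq> 0" using n_pos z by force
    ultimately show "rho f z / n z = \<alpha> z" by simp
  qed
  have f_meas: "f \<in> borel_measurable borel"
    unfolding f_def by (rule flow_density_measurable[OF m\<alpha> Fm(1) Fp(1)])
  have f_bound: "\<bar>f p\<bar> \<le> 2 * C" for p
    unfolding f_def by (rule flow_density_bounded; rule Fm Fp)
  have Linf_E: "Linf slab E" by (rule Linf_bounded[OF E(1) E(2) I])
  have wd: "weak_deriv {-1<..<1} \<alpha> E" using P by (rule bounded_primitive_weak_deriv)
  have f_sol: "kinetic_solution n fm fp f"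
    unfolding kinetic_solution_def
  proof (intro conjI exI)
    show "Linf phase_space f"
      by (rule Linf_bounded[OF f_meas f_bound A])
    show "AE z in slab. integrable lborel (\<lambda>v. f (z, v))"
      using f_rho(1) by (simp add: AE_restrict_lborel)
    show "Linf slab E" by (rule Linf_E)
    show "weak_deriv {-1<..<1} (\<lambda>z. rho f z / n z) E"
      by (rule weak_deriv_cong_on[OF wd]) (simp add: f_rho(2))
    show "weak_transport_solution E fm fp f"
      unfolding f_def by (rule flow_density_transport[OF P m\<alpha> \<alpha>_ord(2) D0 \<alpha>D Fm Fp fm_Linf fmF fp_Linf fpF])
  qed
  have "\<alpha> \<in> K_set n n' \<mu>"
  proof -
    have "Linf slab \<alpha>"
    proof (rule Linf_bounded[OF m\<alpha> _ I])
      show "\<bar>\<alpha> z\<bar> \<le> \<alpha> 1" if "z \<in> {-1..1}" for z using \<alpha>_ord[OF that] by simp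
    qed
    moreover have "AE z in slab. 0 \<le> E z \<and> E z \<le> 4 * \<mu> * Linf_norm slab (\<lambda>z. n' z / (n z)\<^sup>2)"
      using E0 E(2) by (simp add: m_def abs_le_iff)
    ultimately show ?thesis
      using bounded_primitive_continuous[OF P] \<alpha>_ord(1) \<alpha>D Linf_E wd
      unfolding K_set_def D_def by blast
  qed
  then have f_K: "AE_represents (K_set n n' \<mu>) (\<lambda>z. rho f z / n z)"
    unfolding AE_represents_def using f_rho(2) by (intro bexI[of _ \<alpha>]) (simp_all add: AE_restrict_lborel)

  \<comment> \<open>Uniqueness\<close>
  have "AE p in phase_space. g p = f p"
    if g: "kinetic_solution n fm fp g" and gK: "AE_represents (K_set n n' \<mu>) (\<lambda>z. rho g z / n z)" for g
  proof -
    from g have Lg: "Linf phase_space g" and gi: "AE z in slab. integrable lborel (\<lambda>v. g (z, v))"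
      by (auto simp: kinetic_solution_def)
    from g obtain Eg where Eg: "Linf slab Eg" "weak_deriv {-1<..<1} (\<lambda>z. rho g z / n z) Eg"
      "weak_transport_solution Eg fm fp g" by (auto simp: kinetic_solution_def)
    from gK obtain b where bK: "b \<in> K_set n n' \<mu>" and gb: "AE z in slab. rho g z / n z = b z"
      by (auto simp: AE_represents_def)
    from bK have bc: "continuous_on {-1..1} b" and bD: "b 1 - b (-1) \<le> D"
      by (auto simp: K_set_def D_def)
    from bK obtain b' where b': "Linf slab b'" "weak_deriv {-1<..<1} b b'"
      "AE z in slab. 0 \<le> b' z \<and> b' z \<le> 4 * \<mu> * Linf_norm slab (\<lambda>z. n' z / (n z)\<^sup>2)"
      by (auto simp: K_set_def)
    define \<beta> where "\<beta> x = b (cl x)" for x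
    have \<beta>b: "\<beta> x = b x" if "x \<in> {-1..1}" for x using cl(2)[OF that] by (simp add: \<beta>_def)
    have c\<beta>: "continuous_on UNIV \<beta>" unfolding \<beta>_def by (rule clamp_cont[OF bc])
    have m\<beta>: "\<beta> \<in> borel_measurable borel" using c\<beta> by (rule borel_measurable_continuous_onI)
    have \<beta>D: "\<beta> 1 - \<beta> (-1) \<le> D" using bD by (simp add: \<beta>b)
    \<comment> \<open>Two representatives of the derivative of \<beta>: \<open>e0\<close> comes from
      the equation for \<open>g\<close> and drives the transport, \<open>d0\<close> comes from
      membership in \<open>K_set\<close> and is nonnegative almost everywhere, which makes \<beta>
      increasing.\<close>
    obtain e0 M where e0: "e0 \<in> borel_measurable borel" "\<And>x. \<bar>e0 x\<bar> \<le> M" "AE z in lborel. z \<in> {-1..1} \<longrightarrow> Eg z = e0 z"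
      by (rule Linf_representative[OF I Eg(1)]) blast
    obtain d0 M' where d0: "d0 \<in> borel_measurable borel" "\<And>x. \<bar>d0 x\<bar> \<le> M'" "AE z in lborel. z \<in> {-1..1} \<longrightarrow> b' z = d0 z"
      by (rule Linf_representative[OF I b'(1)]) blast
    have "weak_deriv {-1<..<1} \<beta> d0"
    proof (rule weak_deriv_cong[OF b'(2) _ _ m\<beta> d0(1)])
      show "AE x in lborel. x \<in> {-1<..<1} \<longrightarrow> b x = \<beta> x" by (intro always_eventually allI impI) (simp add: \<beta>b less_imp_le)
      show "AE x in lborel. x \<in> {-1<..<1} \<longrightarrow> b' x = d0 x" using d0(3) by eventually_elim auto
    qed
    then have Pd: "bounded_primitive M' d0 \<beta>"
      by (rule weak_deriv_imp_bounded_primitive[OF _ continuous_on_subset[OF c\<beta> subset_UNIV] d0(1,2)])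
    have d0_nonneg: "AE z in lborel. z \<in> {-1..1} \<longrightarrow> 0 \<le> d0 z"
      using d0(3) b'(3)[unfolded AE_restrict_lborel[OF I]] by eventually_elim auto
    have \<beta>_mono: "\<beta> x \<le> \<beta> y" if xy: "-1 \<le> x" "x \<le> y" "y \<le> 1" for x y
    proof -
      have "0 \<le> (LINT t:{x..y}|lborel. d0 t)"
        unfolding set_lebesgue_integral_def using d0_nonneg
        by (intro integral_nonneg_AE) (use xy in \<open>auto elim!: eventually_mono simp: indicator_def\<close>)
      moreover have "\<beta> y - \<beta> x = (LINT t:{x..y}|lborel. d0 t)"
        using Pd xy unfolding bounded_primitive_def by blast
      ultimately show ?thesis by simp
    qed
    have \<beta>_ord: "\<beta> (-1) \<le> \<beta> z \<and> \<beta> z \<le> \<beta> 1" if "z \<in> {-1..1}" for z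
      using \<beta>_mono[of "-1" z] \<beta>_mono[of z 1] that by auto
    have "weak_deriv {-1<..<1} \<beta> e0"
    proof (rule weak_deriv_cong[OF Eg(2) _ _ m\<beta> e0(1)])
      show "AE x in lborel. x \<in> {-1<..<1} \<longrightarrow> rho g x / n x = \<beta> x"
        using gb[unfolded AE_restrict_lborel[OF I]] by eventually_elim (auto simp: \<beta>b)
      show "AE x in lborel. x \<in> {-1<..<1} \<longrightarrow> Eg x = e0 x" using e0(3) by eventually_elim auto
    qed
    then have Pe: "bounded_primitive M e0 \<beta>"
      by (rule weak_deriv_imp_bounded_primitive[OF _ continuous_on_subset[OF c\<beta> subset_UNIV] e0(1,2)])
    have gf: "AE p in lborel. p \<in> {-1..1} \<times> UNIV \<longrightarrow> g p = flow_density \<beta> Fm Fp p"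
      by (rule transport_solution_unique[OF Pe c\<beta> \<beta>_mono D0 \<beta>D Fm Fp fm_Linf fmF fp_Linf fpF Eg(1) e0(3) Lg Eg(3)])
    \<comment> \<open>By Fubini, for almost every z the slices of \<open>g\<close> and of the
      explicit solution for \<beta> agree, hence so do their densities; this yields the scalar
      equation for \<beta>.\<close>
    have "AE p in lborel \<Otimes>\<^sub>M lborel. p \<in> {-1..1} \<times> UNIV \<longrightarrow> g p = flow_density \<beta> Fm Fp p"
      using gf unfolding lborel_prod .
    then have "AE z in lborel. AE v in lborel. (z, v) \<in> {-1..1} \<times> UNIV \<longrightarrow> g (z, v) = flow_density \<beta> Fm Fp (z, v)"
      by (rule lborel_pair.AE_pair)
    then have "AE z in lborel. z \<in> {-1..1} \<longrightarrow> n z * \<beta> z - (flux Fm (\<beta> z - \<beta> (-1)) + flux Fp (\<beta> z - \<beta> 1)) = 0"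
      using gb[unfolded AE_restrict_lborel[OF I]] gi[unfolded AE_restrict_lborel[OF I]]
    proof eventually_elim
      case (elim z)
      show ?case
      proof
        assume z: "z \<in> {-1..1}"
        have fl: "integrable lborel (\<lambda>v. flow_density \<beta> Fm Fp (z, v))"
          "rho (flow_density \<beta> Fm Fp) z = flux Fm (\<beta> z - \<beta> (-1)) + flux Fp (\<beta> z - \<beta> 1)"
          using flow[of \<beta> z] \<beta>_ord[OF z] \<beta>D by auto
        have "rho g z = rho (flow_density \<beta> Fm Fp) z"
          unfolding rho_def
        proof (rule Bochner_Integration.integral_cong_AE)
          show "(\<lambda>v. g (z, v)) \<in> borel_measurable lborel" using elim(3) z by blast
          show "AE v in lborel. g (z, v) = flow_density \<beta> Fm Fp (z, v)"
            using elim(1) z by (auto elim: eventually_mono)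
        qed (use fl in blast)
        moreover have "n z * \<beta> z = rho g z"
        proof -
          have "rho g z / n z = b z" using elim(2) z by blast
          moreover have "n z \<noteq> 0" using n_pos z by force
          ultimately show ?thesis by (simp add: \<beta>b[OF z] field_simps)
        qed
        ultimately show "n z * \<beta> z - (flux Fm (\<beta> z - \<beta> (-1)) + flux Fp (\<beta> z - \<beta> 1)) = 0"
          using fl(2) by simp
      qed
    qed
    \<comment> \<open>Continuity extends the scalar equation from almost every z to all z. The
      points -1 and 1 matter most, since the end values are determined there.\<close>
    moreover have "continuous_on {-1..1} (\<lambda>z. n z * \<beta> z - (flux Fm (\<beta> z - \<beta> (-1)) + flux Fp (\<beta> z - \<beta> 1)))"
    proof -
      have 1: "continuous_on {0..D} (flux Fm)" by (rule mono_slope_imp_continuous_on[OF n14]) (use left(2) in auto)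
      have 2: "continuous_on {..0} (flux Fp)" by (rule mono_slope_imp_continuous_on[OF n14]) (use right(2) in auto)
      have c\<beta>': "continuous_on {-1..1} \<beta>" using c\<beta> by (rule continuous_on_subset) simp
      have "continuous_on {-1..1} (\<lambda>z. flux Fm (\<beta> z - \<beta> (-1)))"
        by (rule continuous_on_compose2[OF 1]) (use \<beta>_ord \<beta>D in \<open>force intro!: continuous_intros c\<beta>'\<close>)+
      moreover have "continuous_on {-1..1} (\<lambda>z. flux Fp (\<beta> z - \<beta> 1))"
        by (rule continuous_on_compose2[OF 2]) (use \<beta>_ord in \<open>force intro!: continuous_intros c\<beta>'\<close>)+
      ultimately show ?thesis by (intro continuous_intros n_cont c\<beta>')
    qed
    ultimately have \<beta>_eq: "n z * \<beta> z = flux Fm (\<beta> z - \<beta> (-1)) + flux Fp (\<beta> z - \<beta> 1)" if "z \<in> {-1..1}" for z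
      using AE_zero_imp_zero_continuous[of "\<lambda>z. n z * \<beta> z - (flux Fm (\<beta> z - \<beta> (-1)) + flux Fp (\<beta> z - \<beta> 1))" z] that
      by simp
    have \<alpha>\<beta>: "\<alpha> z = \<beta> z" if "z \<in> {-1..1}" for z
      by (rule density_profile_unique[where n=n and D=D and A="flux Fm" and B="flux Fp" and \<alpha>=\<alpha> and \<beta>=\<beta>, OF n1 nm _ _ \<alpha>_eq \<alpha>_ord(2) \<alpha>D \<beta>_eq \<beta>_ord \<beta>D that])
         (use left(2) right(2) in auto)
    have "flow_density \<beta> Fm Fp p = f p" if "p \<in> {-1..1} \<times> UNIV" for p
      using \<alpha>\<beta>[of "fst p"] \<alpha>\<beta>[of 1] \<alpha>\<beta>[of "-1"] that
      by (auto simp: f_def flow_density_def beam_def mem_Times_iff)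
    with gf have "AE p in lborel. p \<in> {-1..1} \<times> UNIV \<longrightarrow> g p = f p" by (auto elim: eventually_mono)
    then show ?thesis by (simp add: AE_restrict_lborel[OF A])
  qed
  with f_sol f_K show ?thesis unfolding \<mu>_def by blast
qed

end
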